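(* For any $\gamma>0$ and $k\in\mathbb{N}$ there exists a constant $c_{\gamma,k}$, depending only on $\gamma$ and $k$, such that for all $k$-lukewarm starts $\nu_N$ (for Shifted IDLA on $\mathbb{Z}_N\times\mathbb{Z}$) it holds $$\nu_N\big(\{A: h(A)>c_{\gamma,k}\log N\}\big)\leq N^{-\gamma}$$ for $N$ large enough.
   Context: Here $\mathbb{N}=\{0,1,2,\dots\}$. For an integer $N\ge 3$, $\mathbb{Z}_N\times\mathbb{Z}$ is the cylinder graph whose base graph is the cycle on $N$ vertices; level $k$ is $\mathbb{Z}_N\times\{k\}$ and $R_k=\{(x,y)\in\mathbb{Z}_N\times\mathbb{Z}: y\leq k\}$. Internal DLA (IDLA): the state space is $\Omega=\{A\subseteq\mathbb{Z}_N\times\mathbb{Z}: A=R_0\cup F\text{ for some finite }F\}$. Given $A(0)\in\Omega$, for integers $t\ge1$ set $A(t)=A(t-1)\cup\{Z_t\}$, where $Z_t$ is the exit location from $A(t-1)$ (the first site visited outside $A(t-1)$) of a simple random walk on the cylinder graph started from a uniformly random site of level $0$, independent of the past. Shifted IDLA: for $A\in\Omega$ let $k_A=\max\{k\ge0: R_k\subseteq A\}$ and let the downshift of $A$ be $\mathcal{S}(A)=\{(x,y-k_A):(x,y)\in A\}$. The shifted process is $A^*(t)=\mathcal{S}(A(t))$; it is a positive recurrent Markov chain and $\mu_N$ denotes its stationary distribution (a probability measure on $\Omega$). A probability measure $\nu_N$ on $\Omega$ is a $k$-lukewarm start if $\nu_N(A)\leq N^k\mu_N(A)$ for all $A\in\Omega$.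 The height of $A\in\Omega$ is $h(A)=\max\{y:(x,y)\in A\text{ for some }x\in\mathbb{Z}_N\}$. *)

theory Defs
  imports "HOL-Probability.Probability"
begin

section \<open>The cylinder graph\<close>

text \<open>The cycle on \<open>N\<close> vertices is represented by the residues \<open>{0..<N}\<close>, so a site is a pair of
  integers whose first component lies in that range.\<close>

type_synonym site = "int \<times> int"

definition cylinder :: "nat \<Rightarrow> site set" where
  "cylinder N = {0..<int N} \<times> UNIV"

definition cyl_adj :: "nat \<Rightarrow> site \<Rightarrow> site \<Rightarrow> bool" where
  "cyl_adj N u v \<longleftrightarrow> u \<in> cylinder N \<and> v \<in> cylinder N \<and>
     (snd u = snd v \<and> ((fst u + 1) mod int N = fst v \<or> (fst v + 1) mod int N = fst u) \<or>
      fst u = fst v \<and> \<bar>snd u - snd v\<bar> = 1)"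

definition level :: "nat \<Rightarrow> int \<Rightarrow> site set" where
  "level N k = {0..<int N} \<times> {k}"

definition lower_part :: "nat \<Rightarrow> int \<Rightarrow> site set" where
  "lower_part N k = {(x, y) \<in> cylinder N. y \<le> k}"

section \<open>Simple random walk and its exit location\<close>

definition step_pmf :: "(int \<times> int) pmf" where
  "step_pmf = pmf_of_set {(1, 0), (-1, 0), (0, 1), (0, -1)}"

definition move :: "nat \<Rightarrow> site \<Rightarrow> int \<times> int \<Rightarrow> site" where
  "move N u d = ((fst u + fst d) mod int N, snd u + snd d)"

fun walk :: "nat \<Rightarrow> site \<Rightarrow> (int \<times> int) stream \<Rightarrow> nat \<Rightarrow> site" where
  "walk N u \<omega> 0 = u"
| "walk N u \<omega> (Suc n) = move N (walk N u \<omega> n) (\<omega> !! n)"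

text \<open>If the walk never leaves \<open>A\<close>, the exit location is an unspecified value; for the sets \<open>A\<close> in the
  state space below this happens with probability zero.\<close>

definition exit_site :: "nat \<Rightarrow> site set \<Rightarrow> site \<times> (int \<times> int) stream \<Rightarrow> site" where
  "exit_site N A = (\<lambda>(u, \<omega>). walk N u \<omega> (LEAST n. walk N u \<omega> n \<notin> A))"

text \<open>The randomness used by one particle: a uniform starting site of level \<open>0\<close> and, independently,
  a stream of i.i.d. uniform unit steps.\<close>

definition particle :: "nat \<Rightarrow> (site \<times> (int \<times> int) stream) measure" where
  "particle N = measure_pmf (pmf_of_set (level N 0)) \<Otimes>\<^sub>M stream_space (measure_pmf step_pmf)"

text \<open>On the cylinder graph with \<open>N \<ge> 3\<close>, adding a uniform unit step is jumping to a uniformly chosen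
  neighbour.\<close>

lemma map_move_step_pmf:
  assumes N: "N \<ge> 3" and u: "u \<in> cylinder N"
  shows "map_pmf (move N u) step_pmf = pmf_of_set {v. cyl_adj N u v}"
proof -
  obtain x y where uxy: "u = (x, y)" by (cases u)
  have x: "0 \<le> x" "x < int N" using u by (auto simp: cylinder_def uxy)
  have up: "(x + 1) mod int N = (if x + 1 = int N then 0 else x + 1)"
    using x by auto
  have down: "(x - 1) mod int N = (if x = 0 then int N - 1 else x - 1)"
  proof (cases "x = 0")
    case True
    then show ?thesis using N by (simp add: zmod_minus1)
  next
    case False
    then show ?thesis using x by simp
  qed
  have inj: "inj_on (move N u) {(1, 0), (-1, 0), (0, 1), (0, -1)}"
    using N x up down by (auto simp: inj_on_def move_def uxy split: if_splits)
  have prv: "(a + 1) mod int N = x \<longleftrightarrow> a = (x - 1) mod int N" if "0 \<le> a" "a < int N" for a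
  proof -
    have "(a + 1) mod int N = (if a + 1 = int N then 0 else a + 1)"
      using that by auto
    then show ?thesis using that x N down by auto
  qed
  have img: "move N u ` {(1, 0), (-1, 0), (0, 1), (0, -1)} = {v. cyl_adj N u v}" (is "?L = ?R")
  proof (intro equalityI subsetI)
    fix v assume "v \<in> ?L"
    then show "v \<in> ?R"
      using N x prv by (auto simp: cyl_adj_def cylinder_def move_def uxy)
  next
    fix v assume v: "v \<in> ?R"
    obtain a b where ab: "v = (a, b)" by (cases v)
    have a: "0 \<le> a" "a < int N" using v by (auto simp: cyl_adj_def cylinder_def ab)
    have "(y = b \<and> ((x + 1) mod int N = a \<or> a = (x - 1) mod int N)) \<or> (x = a \<and> (b = y + 1 \<or> b = y - 1))"
      using v prv[OF a] by (auto simp: cyl_adj_def ab uxy abs_if split: if_splits)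
    then show "v \<in> ?L" using x by (auto simp: move_def uxy ab)
  qed
  show ?thesis
    unfolding step_pmf_def using map_pmf_of_set_inj[OF inj] img by simp
qed

section \<open>Internal DLA and Shifted IDLA\<close>

definition idla_states :: "nat \<Rightarrow> site set set" where
  "idla_states N = {A. A \<subseteq> cylinder N \<and> (\<exists>F. finite F \<and> A = lower_part N 0 \<union> F)}"

definition idla_step :: "nat \<Rightarrow> site set \<Rightarrow> site \<times> (int \<times> int) stream \<Rightarrow> site set" where
  "idla_step N A p = A \<union> {exit_site N A p}"

definition filled_level :: "nat \<Rightarrow> site set \<Rightarrow> nat" where
  "filled_level N A = (GREATEST k. lower_part N (int k) \<subseteq> A)"

definition downshift :: "nat \<Rightarrow> site set \<Rightarrow> site set" where
  "downshift N A = (\<lambda>(x, y). (x, y - int (filled_level N A))) ` A"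

definition shifted_trans :: "nat \<Rightarrow> site set \<Rightarrow> site set \<Rightarrow> real" where
  "shifted_trans N A B =
     measure (particle N) {p \<in> space (particle N). downshift N (idla_step N A p) = B}"

text \<open>The state space is countable, so probability measures on it are mass functions supported there.\<close>

definition shifted_stationary :: "nat \<Rightarrow> site set pmf \<Rightarrow> bool" where
  "shifted_stationary N \<mu> \<longleftrightarrow> set_pmf \<mu> \<subseteq> idla_states N \<and>
     (\<forall>B \<in> idla_states N. pmf \<mu> B = measure_pmf.expectation \<mu> (\<lambda>A. shifted_trans N A B))"

definition lukewarm_start :: "nat \<Rightarrow> nat \<Rightarrow> site set pmf \<Rightarrow> site set pmf \<Rightarrow> bool" where
  "lukewarm_start N k \<mu> \<nu> \<longleftrightarrow> set_pmf \<nu> \<subseteq> idla_states N \<and>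
     (\<forall>A \<in> idla_states N. pmf \<nu> A \<le> real N ^ k * pmf \<mu> A)"

text \<open>\<open>GREATEST\<close> rather than \<open>Max\<close>, since the set of occupied levels is infinite (unbounded below).\<close>

definition idla_height :: "site set \<Rightarrow> int" where
  "idla_height A = (GREATEST y. \<exists>x. (x, y) \<in> A)"

end

theory Submission
  imports Defs "HOL-Real_Asymp.Real_Asymp"
begin

text \<open>
  By stationarity and the lukewarm bound it suffices to show, for each fixed initial state, that after
  sufficiently many steps the cluster exceeds its highest filled level by more than \<open>C log N\<close> with
  probability at most \<open>N\<^sup>-\<^sup>\<gamma>\<^sup>-\<^sup>k\<close>.

  If \<open>H\<close> is a bounded harmonic function on a half-cylinder with level averages \<open>1 / N\<close>, the sum of
  \<open>H - 1 / N\<close> over the settled sites is a martingale along the growth. Its quadratic variation is the sum of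
  the squares over the same sites, which is deterministically \<open>O(log N)\<close> because \<open>H\<close> decays like the
  inverse of the distance to its pole. Hence the martingale has exponential tails at scale \<open>log N\<close>.

  If the pole is an unoccupied site just above the highest filled level, the martingale equals minus the
  number of particles above that level, divided by \<open>N\<close>; so this excess is \<open>O(log N)\<close>. If the pole lies
  \<open>m\<close> levels above the topmost occupied site, where \<open>m\<close> is a large multiple of \<open>log N\<close>, then
  \<open>H\<close> is of order \<open>1 / m\<close> on the square of radius \<open>m\<close> around that site. This square contains at least
  \<open>b m\<^sup>2\<close> particles, since thin tentacles have exponentially small probability, and the
  martingale would be of order \<open>m\<close>. The horizontal profile of \<open>H\<close> is a Fejer kernel, which is positive
  and easy to bound from both sides.
\<close>

section \<open>Exit laws of the walk\<close>

text \<open>No mixing estimate is used: a stationary law is preserved by \<open>n\<close> steps for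
  every \<open>n\<close>, so the tail bound is wanted for each fixed initial state only in the limit
  of large \<open>n\<close>, without uniformity in that state. Waiting puts the relevant poles far
  above the initial sites, whose total share of the martingale is then at most \<open>1\<close>. The
  quadratic variation is deterministic because an increment depends on the settled site alone and no
  site is settled twice. Its logarithm comes from the sum of \<open>1 / d - 1 / (d + 2 * N)\<close>
  over depths \<open>d\<close>: the kernel differs from \<open>1 / N\<close> by order
  \<open>1 / d\<close> near the pole and by order \<open>N / d^2\<close> far below it, so the sum is
  at most \<open>harm (2 * N)\<close> however deep the slab is. On the square the kernel is bounded
  below term by term: frequencies below \<open>J\<close>, about \<open>N / (64 * m)\<close>, hardly
  vary over a window of size \<open>m\<close>, while the upper bounds hold for every
  \<open>J\<close> up to \<open>N\<close>. The pole position depends on the random cluster, so each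
  bound is paid once per possible position. Only finitely many occur, since every level between the
  initial state and the top is occupied, which bounds the height by the number of sites above the
  filled level.\<close>

locale cyl =
  fixes N :: nat
  assumes N3: "3 \<le> N"
begin

definition nb_avg :: "(site \<Rightarrow> real) \<Rightarrow> site \<Rightarrow> real" where
  "nb_avg f u = (f (move N u (1, 0)) + f (move N u (-1, 0)) + f (move N u (0, 1)) + f (move N u (0, -1))) / 4"

text \<open>Only boundedness from above is asked: clusters contain a whole lower half-cylinder, and
  the walk nevertheless leaves them almost surely.\<close>

definition domain :: "site set \<Rightarrow> bool" where
  "domain D \<longleftrightarrow> D \<subseteq> cylinder N \<and> (\<exists>h. \<forall>z\<in>D. snd z \<le> h)"

lemma domain_mono: "domain A \<Longrightarrow> D \<subseteq> A \<Longrightarrow> domain D"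
  unfolding domain_def by blast

lemma move_cylinder: "move N u d \<in> cylinder N"
  using N3 by (auto simp: move_def cylinder_def)

lemma snd_move [simp]: "snd (move N u d) = snd u + snd d"
  by (simp add: move_def)

lemma expectation_step:
  fixes f :: "int \<times> int \<Rightarrow> real"
  shows "measure_pmf.expectation step_pmf f = (f (1, 0) + f (-1, 0) + f (0, 1) + f (0, -1)) / 4"
  unfolding step_pmf_def by (subst integral_pmf_of_set) auto

lemma set_step_pmf: "set_pmf step_pmf = {(1, 0), (-1, 0), (0, 1), (0, -1)}"
  unfolding step_pmf_def by (rule set_pmf_of_set) auto

lemma finite_slab: "finite {z \<in> cylinder N. a \<le> snd z \<and> snd z \<le> b}"
proof (rule finite_subset)
  show "{z \<in> cylinder N. a \<le> snd z \<and> snd z \<le> b} \<subseteq> {0..<int N} \<times> {a..b}"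
    by (auto simp: cylinder_def)
qed auto

text \<open>Comparison with the unbounded harmonic function \<open>h + 1 - y\<close> replaces recurrence of the walk.\<close>

lemma bounded_harmonic_nonpos:
  fixes s :: "site \<Rightarrow> real"
  assumes D: "domain D" and le1: "\<And>z. s z \<le> 1" and off: "\<And>z. z \<notin> D \<Longrightarrow> s z \<le> 0"
    and avg: "\<And>z. z \<in> D \<Longrightarrow> s z \<le> nb_avg s z"
  shows "s u \<le> 0"
proof (rule ccontr)
  assume "\<not> s u \<le> 0"
  then have pos: "s u > 0" by simp
  then have uD: "u \<in> D" using off[of u] by force
  obtain h where h: "\<And>z. z \<in> D \<Longrightarrow> snd z \<le> h" and sub: "D \<subseteq> cylinder N"
    using D unfolding domain_def by blast
  define v where "v z = real_of_int (h + 1 - snd z)" for z :: site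
  have vpos: "v z \<ge> 1" if "z \<in> D" for z using h[OF that] by (simp add: v_def)
  \<comment> \<open>This choice leaves \<open>g u = s u / 2\<close>, still positive.\<close>
  define \<epsilon> where "\<epsilon> = s u / (2 * v u)"
  have eps: "\<epsilon> > 0" using pos vpos[OF uD] by (simp add: \<epsilon>_def)
  define g where "g z = s z - \<epsilon> * v z" for z
  have gu: "g u > 0" using pos vpos[OF uD] by (simp add: g_def \<epsilon>_def)
  define T where "T = {z \<in> D. g z > 0}"
  have "T \<subseteq> {z \<in> cylinder N. \<lfloor>h + 1 - 1 / \<epsilon>\<rfloor> \<le> snd z \<and> snd z \<le> h}"
  proof
    fix z assume "z \<in> T"
    then have zD: "z \<in> D" and gz: "g z > 0" by (auto simp: T_def)
    have "\<epsilon> * v z < 1" using gz le1[of z] by (simp add: g_def)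
    then have "v z < 1 / \<epsilon>" using eps by (simp add: field_simps)
    then have "real_of_int (snd z) \<ge> h + 1 - 1 / \<epsilon>" by (simp add: v_def)
    then have "\<lfloor>h + 1 - 1 / \<epsilon>\<rfloor> \<le> snd z" by linarith
    then show "z \<in> {z \<in> cylinder N. \<lfloor>h + 1 - 1 / \<epsilon>\<rfloor> \<le> snd z \<and> snd z \<le> h}"
      using zD sub h by auto
  qed
  then have finT: "finite T" using finite_slab finite_subset by blast
  have uT: "u \<in> T" using gu uD by (simp add: T_def)
  define G where "G = Max (g ` T)"
  have Gin: "G \<in> g ` T" unfolding G_def using finT uT by (intro Max_in) auto
  have Gge: "g z \<le> G" if "z \<in> T" for z unfolding G_def using finT that by auto
  define T' where "T' = {z \<in> T. g z = G}"
  have T': "finite T'" "T' \<noteq> {}" using finT Gin by (auto simp: T'_def)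
  \<comment> \<open>Since \<open>v\<close> is harmonic, \<open>g\<close> is still subharmonic in
    \<open>D\<close>, so every neighbour of a maximizer is again one. Taking the topmost maximizer
    makes its upper neighbour a contradiction.\<close>
  define y where "y = Max (snd ` T')"
  have "y \<in> snd ` T'" unfolding y_def using T' by (intro Max_in) auto
  then obtain z where z: "z \<in> T'" "snd z = y" by auto
  have ymax: "snd w \<le> y" if "w \<in> T'" for w unfolding y_def using T' that by auto
  have zD: "z \<in> D" and gz: "g z = G" and Gpos: "G > 0" using z by (auto simp: T'_def T_def)
  have nb: "g w \<le> G" if "snd w \<le> snd z + 1" for w
  proof (cases "w \<in> D")
    case True
    then show ?thesis using Gge[of w] Gpos by (cases "g w > 0") (auto simp: T_def)
  next
    case False
    have "v w \<ge> 0" using that h[OF zD] by (simp add: v_def)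
    then have "g w \<le> 0" using off[OF False] eps by (simp add: g_def mult_nonneg_nonneg order_trans[OF _ mult_nonneg_nonneg])
    then show ?thesis using Gpos by simp
  qed
  have "nb_avg g z = nb_avg s z - \<epsilon> * v z"
    by (simp add: nb_avg_def g_def v_def field_simps)
  then have "g z \<le> nb_avg g z" using avg[OF zD] by (simp add: g_def)
  then have "4 * G \<le> g (move N z (1, 0)) + g (move N z (-1, 0)) + g (move N z (0, 1)) + g (move N z (0, -1))"
    using gz by (simp add: nb_avg_def)
  moreover have "g (move N z (1, 0)) \<le> G" "g (move N z (-1, 0)) \<le> G" "g (move N z (0, 1)) \<le> G"
    "g (move N z (0, -1)) \<le> G" by (auto intro!: nb)
  ultimately have gup: "g (move N z (0, 1)) = G" by linarith
  have "move N z (0, 1) \<in> D"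
  proof (rule ccontr)
    assume n: "move N z (0, 1) \<notin> D"
    have "v (move N z (0, 1)) \<ge> 0" using h[OF zD] by (simp add: v_def)
    then have "\<epsilon> * v (move N z (0, 1)) \<ge> 0" using eps by simp
    then have "g (move N z (0, 1)) \<le> 0" using off[OF n] by (simp add: g_def)
    then show False using gup Gpos by simp
  qed
  then have "move N z (0, 1) \<in> T'" using gup Gpos by (simp add: T'_def T_def)
  from ymax[OF this] z show False by simp
qed

section \<open>Almost sure exit from sets bounded above\<close>

abbreviation steps :: "(int \<times> int) stream measure" where
  "steps \<equiv> stream_space (measure_pmf step_pmf)"

lemma prob_space_steps: "prob_space steps"
  by (rule prob_space.prob_space_stream_space[OF prob_space_measure_pmf])

lemma walk_Stream: "walk N u (d ## \<omega>) (Suc n) = walk N (move N u d) \<omega> n"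
  by (induction n) auto

lemma measurable_walk [measurable]: "(\<lambda>\<omega>. walk N u \<omega> n) \<in> measurable steps (count_space UNIV)"
proof (induction n)
  case (Suc n)
  have "(\<lambda>\<omega>. \<omega> !! n) \<in> measurable steps (measure_pmf step_pmf)" by simp
  then have s: "(\<lambda>\<omega>. \<omega> !! n) \<in> measurable steps (count_space UNIV)"
    by (simp cong: measurable_cong_sets)
  have "(\<lambda>\<omega>. move N (walk N u \<omega> n) (\<omega> !! n)) \<in> measurable steps (count_space UNIV)"
  proof (rule measurable_compose_countable[OF _ Suc])
    fix v :: site
    show "(\<lambda>\<omega>. move N v (\<omega> !! n)) \<in> measurable steps (count_space UNIV)"
      by (rule measurable_compose[OF s]) simp
  qed
  then show ?case by simp
qed simp

lemma measurable_exit_site [measurable]: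
  "(\<lambda>\<omega>. exit_site N D (u, \<omega>)) \<in> measurable steps (count_space UNIV)"
proof -
  have [measurable]: "Measurable.pred steps (\<lambda>\<omega>. walk N u \<omega> n \<notin> D)" for n
    by (rule measurable_compose[OF measurable_walk]) simp
  show ?thesis
    unfolding exit_site_def prod.case
    by (rule measurable_compose_countable[OF measurable_walk]) measurable
qed

text \<open>The survival probabilities decrease in \<open>n\<close> and satisfy a first-step
  recursion, so their limit is bounded, harmonic in \<open>D\<close> and zero outside. The
  comparison principle forces it to vanish.\<close>

lemma survival_tendsto_0:
  assumes D: "domain D"
  shows "(\<lambda>n. \<P>(\<omega> in steps. \<forall>i\<le>n. walk N u \<omega> i \<in> D)) \<longlonglongrightarrow> 0"
proof -
  interpret S: prob_space steps by (rule prob_space_steps)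
  define s where "s n u = \<P>(\<omega> in steps. \<forall>i\<le>n. walk N u \<omega> i \<in> D)" for n u
  have [measurable]: "Measurable.pred steps (\<lambda>\<omega>. walk N u \<omega> n \<in> D)" for n u
    by (rule measurable_compose[OF measurable_walk]) simp
  have rec: "s (Suc n) u = nb_avg (s n) u" if "u \<in> D" for n u
  proof -
    have *: "(\<forall>i\<le>Suc n. walk N u (d ## \<omega>) i \<in> D) \<longleftrightarrow> (\<forall>i\<le>n. walk N (move N u d) \<omega> i \<in> D)" for d \<omega>
    proof -
      have "(\<forall>i\<le>Suc n. walk N u (d ## \<omega>) i \<in> D) \<longleftrightarrow> walk N u (d ## \<omega>) 0 \<in> D \<and> (\<forall>i\<le>n. walk N u (d ## \<omega>) (Suc i) \<in> D)"
        by (metis Suc_le_mono bot_nat_0.extremum not0_implies_Suc)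
      then show ?thesis using that by (simp only: walk_Stream) simp
    qed
    have "ennreal (s (Suc n) u) = (\<integral>\<^sup>+d. \<P>(\<omega> in steps. \<forall>i\<le>Suc n. walk N u (d ## \<omega>) i \<in> D) \<partial>measure_pmf step_pmf)"
      unfolding s_def by (rule prob_space.prob_stream_space[OF prob_space_measure_pmf]) measurable
    also have "\<dots> = (\<integral>\<^sup>+d. ennreal (s n (move N u d)) \<partial>measure_pmf step_pmf)"
      by (simp only: * s_def)
    also have "\<dots> = ennreal (measure_pmf.expectation step_pmf (\<lambda>d. s n (move N u d)))"
      by (rule nn_integral_eq_integral)
        (auto simp: s_def intro!: measure_pmf.integrable_const_bound[where B = 1])
    also have "measure_pmf.expectation step_pmf (\<lambda>d. s n (move N u d)) = nb_avg (s n) u"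
      by (simp add: expectation_step nb_avg_def)
    finally show ?thesis by (subst (asm) ennreal_inj) (auto simp: s_def nb_avg_def)
  qed
  have off: "s n u = 0" if "u \<notin> D" for n u
  proof -
    have "{\<omega> \<in> space steps. \<forall>i\<le>n. walk N u \<omega> i \<in> D} = {}" using that by (auto dest: spec[of _ 0])
    then show ?thesis unfolding s_def by (simp only: measure_empty)
  qed
  have dec: "decseq (\<lambda>n. s n u)" for u
    unfolding s_def decseq_def by (auto intro!: S.finite_measure_mono)
  have conv: "convergent (\<lambda>n. s n u)" for u
    by (rule decseq_convergent[OF dec, of 0]) (auto simp: s_def convergent_def)
  define L where "L u = lim (\<lambda>n. s n u)" for u
  have L: "(\<lambda>n. s n u) \<longlonglongrightarrow> L u" for u unfolding L_def using conv by (simp add: convergent_LIMSEQ_iff)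
  have L0: "L u \<ge> 0" for u by (rule LIMSEQ_le_const[OF L]) (auto simp: s_def)
  have "L u \<le> 0"
  proof (rule bounded_harmonic_nonpos[OF D])
    show "L z \<le> 1" for z by (rule LIMSEQ_le_const2[OF L]) (auto simp: s_def)
    show "L z \<le> 0" if "z \<notin> D" for z by (rule LIMSEQ_le_const2[OF L]) (auto simp: off that)
    show "L z \<le> nb_avg L z" if "z \<in> D" for z
    proof -
      have "(\<lambda>n. nb_avg (s n) z) \<longlonglongrightarrow> nb_avg L z"
        unfolding nb_avg_def by (intro tendsto_intros L) simp
      then have "(\<lambda>n. s (Suc n) z) \<longlonglongrightarrow> nb_avg L z" using rec[OF that] by simp
      moreover have "(\<lambda>n. s (Suc n) z) \<longlonglongrightarrow> L z" using L by (rule LIMSEQ_Suc)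
      ultimately show ?thesis using LIMSEQ_unique by fastforce
    qed
  qed
  then have "L u = 0" using L0[of u] by simp
  then show ?thesis using L[of u] by (simp add: s_def)
qed

lemma AE_exits:
  assumes D: "domain D"
  shows "AE \<omega> in steps. \<exists>n. walk N u \<omega> n \<notin> D"
proof -
  interpret S: prob_space steps by (rule prob_space_steps)
  have [measurable]: "Measurable.pred steps (\<lambda>\<omega>. walk N u \<omega> n \<in> D)" for n u
    by (rule measurable_compose[OF measurable_walk]) simp
  let ?p = "\<P>(\<omega> in steps. \<forall>n. walk N u \<omega> n \<in> D)"
  have "?p \<le> 0"
    by (rule LIMSEQ_le_const[OF survival_tendsto_0[OF D, of u]])
      (auto intro!: exI S.finite_measure_mono)
  then have "?p = 0" by (simp add: measure_le_0_iff)
  then have "AE \<omega> in steps. \<not> (\<forall>n. walk N u \<omega> n \<in> D)"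
    by (subst (asm) S.prob_Collect_eq_0) auto
  then show ?thesis by simp
qed

text \<open>A \<open>pmf\<close> is available because there are only countably many sites; all later
  work is then free of measurability questions about step streams.\<close>

definition exit_law :: "site set \<Rightarrow> site \<Rightarrow> site pmf" where
  "exit_law D u = Abs_pmf (distr steps (count_space UNIV) (\<lambda>\<omega>. exit_site N D (u, \<omega>)))"

lemma measure_exit_law:
  "measure_pmf (exit_law D u) = distr steps (count_space UNIV) (\<lambda>\<omega>. exit_site N D (u, \<omega>))"
  unfolding exit_law_def
proof (rule Abs_pmf_inverse, intro CollectI conjI)
  let ?M = "distr steps (count_space UNIV) (\<lambda>\<omega>. exit_site N D (u, \<omega>))"
  interpret S: prob_space steps by (rule prob_space_steps)
  show ps: "prob_space ?M" by (rule S.prob_space_distr) simp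
  show "sets ?M = UNIV" by simp
  interpret M: prob_space ?M by (rule ps)
  show "AE x in ?M. measure ?M {x} \<noteq> 0"
    by (subst M.AE_support_countable) (auto intro!: exI[of _ UNIV])
qed

lemma exit_site_first:
  assumes "walk N u \<omega> n \<notin> D"
  shows "exit_site N D (u, \<omega>) \<notin> D"
  unfolding exit_site_def prod.case by (rule LeastI[of "\<lambda>n. walk N u \<omega> n \<notin> D"], rule assms)

lemma exit_site_outside: "u \<notin> D \<Longrightarrow> exit_site N D (u, \<omega>) = u"
  unfolding exit_site_def prod.case by (subst Least_eq_0) auto

lemma exit_site_Stream:
  assumes "u \<in> D" "walk N (move N u d) \<omega> n \<notin> D"
  shows "exit_site N D (u, d ## \<omega>) = exit_site N D (move N u d, \<omega>)"
proof -
  have "walk N u (d ## \<omega>) (Suc n) \<notin> D" using assms(2) by (simp only: walk_Stream not_False_eq_True)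
  moreover have "\<not> walk N u (d ## \<omega>) 0 \<notin> D" using assms(1) by simp
  ultimately have "(LEAST n. walk N u (d ## \<omega>) n \<notin> D) = Suc (LEAST m. walk N u (d ## \<omega>) (Suc m) \<notin> D)"
    by (rule Least_Suc)
  then show ?thesis unfolding exit_site_def prod.case by (simp only: walk_Stream)
qed

lemma exit_law_outside: "u \<notin> D \<Longrightarrow> exit_law D u = return_pmf u"
proof (rule pmf_eqI)
  fix z assume u: "u \<notin> D"
  interpret S: prob_space steps by (rule prob_space_steps)
  have "pmf (exit_law D u) z = measure steps {\<omega> \<in> space steps. u = z}"
    unfolding pmf.rep_eq measure_exit_law using u
    by (subst measure_distr) (auto simp: exit_site_outside intro!: arg_cong[where f = "measure steps"])
  also have "\<dots> = pmf (return_pmf u) z" by (cases "u = z") (auto simp: S.prob_space)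
  finally show "pmf (exit_law D u) z = pmf (return_pmf u) z" .
qed

lemma exit_law_step:
  assumes D: "domain D" and u: "u \<in> D"
  shows "exit_law D u = bind_pmf step_pmf (\<lambda>d. exit_law D (move N u d))"
proof (rule pmf_eqI)
  fix z
  interpret S: prob_space steps by (rule prob_space_steps)
  have [measurable]: "Measurable.pred steps (\<lambda>\<omega>. exit_site N D (u, \<omega>) = z)" for u
    by (rule measurable_compose[OF measurable_exit_site]) simp
  have p: "pmf (exit_law D u) z = \<P>(\<omega> in steps. exit_site N D (u, \<omega>) = z)" for u
    unfolding pmf.rep_eq measure_exit_law
    by (subst measure_distr) (auto intro!: arg_cong[where f = "measure steps"])
  have "ennreal (pmf (exit_law D u) z)
      = (\<integral>\<^sup>+d. \<P>(\<omega> in steps. exit_site N D (u, d ## \<omega>) = z) \<partial>measure_pmf step_pmf)"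
    unfolding p by (rule prob_space.prob_stream_space[OF prob_space_measure_pmf]) measurable
  also have "\<dots> = (\<integral>\<^sup>+d. ennreal (pmf (exit_law D (move N u d)) z) \<partial>measure_pmf step_pmf)"
  proof (intro nn_integral_cong arg_cong[where f = ennreal])
    fix d :: "int \<times> int"
    have [measurable]: "(\<lambda>\<omega>. d ## \<omega>) \<in> measurable steps steps"
      by (rule measurable_Stream) auto
    \<comment> \<open>For a walk that never leaves \<open>D\<close> the exit site is an arbitrary
      value and the shift identity may fail; such walks form a null set.\<close>
    have "AE \<omega> in steps. exit_site N D (u, d ## \<omega>) = exit_site N D (move N u d, \<omega>)"
      using AE_exits[OF D, of "move N u d"] by eventually_elim (use u exit_site_Stream in blast)
    then show "\<P>(\<omega> in steps. exit_site N D (u, d ## \<omega>) = z) = pmf (exit_law D (move N u d)) z"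
      unfolding p by (intro S.finite_measure_eq_AE) (auto elim: eventually_mono)
  qed
  also have "\<dots> = ennreal (pmf (bind_pmf step_pmf (\<lambda>d. exit_law D (move N u d))) z)"
    by (simp add: ennreal_pmf_bind)
  finally show "pmf (exit_law D u) z = pmf (bind_pmf step_pmf (\<lambda>d. exit_law D (move N u d))) z"
    by (subst (asm) ennreal_inj) auto
qed

lemma AE_snth_step: "AE \<omega> in steps. \<forall>n. \<omega> !! n \<in> set_pmf step_pmf"
proof -
  have "AE \<omega> in steps. stream_all (\<lambda>d. d \<in> set_pmf step_pmf) \<omega>"
    by (rule prob_space.AE_stream_all[OF prob_space_measure_pmf]) (auto simp: AE_measure_pmf)
  then show ?thesis by (auto simp: sset_range elim!: eventually_mono)
qed

text \<open>The last fact, that the exit site is adjacent to \<open>D\<close>, is the source of the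
  connectedness of clusters used for tentacles and for the height bound.\<close>

lemma set_exit_law:
  assumes D: "domain D" and z: "z \<in> set_pmf (exit_law D u)"
  shows "z \<notin> D" and "u \<notin> D \<Longrightarrow> z = u"
    and "u \<in> D \<Longrightarrow> \<exists>w\<in>D. \<exists>d\<in>set_pmf step_pmf. z = move N w d"
proof -
  let ?Q = "\<lambda>z. z \<notin> D \<and> (u \<in> D \<longrightarrow> (\<exists>w\<in>D. \<exists>d\<in>set_pmf step_pmf. z = move N w d))"
  have "AE \<omega> in steps. ?Q (exit_site N D (u, \<omega>))"
    using AE_exits[OF D, of u] AE_snth_step
  proof eventually_elim
    case (elim \<omega>)
    then obtain n where n: "walk N u \<omega> n \<notin> D" by blast
    define T where "T = (LEAST n. walk N u \<omega> n \<notin> D)"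
    have e: "exit_site N D (u, \<omega>) = walk N u \<omega> T" by (simp add: exit_site_def T_def)
    have "\<exists>w\<in>D. \<exists>d\<in>set_pmf step_pmf. walk N u \<omega> T = move N w d" if "u \<in> D"
    proof (cases T)
      case 0
      then show ?thesis using exit_site_first[OF n] e that by simp
    next
      case (Suc m)
      then have "walk N u \<omega> m \<in> D" using not_less_Least[of m "\<lambda>n. walk N u \<omega> n \<notin> D"] by (simp add: T_def)
      then show ?thesis using Suc elim by auto
    qed
    then show ?case using exit_site_first[OF n] e by simp
  qed
  then have "AE z in measure_pmf (exit_law D u). ?Q z"
    unfolding measure_exit_law by (subst AE_distr_iff) auto
  then have "?Q z" using z by (simp add: AE_measure_pmf_iff)
  then show "z \<notin> D" "u \<in> D \<Longrightarrow> \<exists>w\<in>D. \<exists>d\<in>set_pmf step_pmf. z = move N w d" by auto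
  show "u \<notin> D \<Longrightarrow> z = u" using z by (simp add: exit_law_outside)
qed

end

section \<open>Optional stopping and the shifted chain\<close>

lemma integrable_bounded_pmf:
  fixes f :: "'a \<Rightarrow> real"
  assumes "\<And>x. \<bar>f x\<bar> \<le> B"
  shows "integrable (measure_pmf p) f"
  using assms by (intro measure_pmf.integrable_const_bound[where B = B]) auto

lemma expectation_bounded:
  fixes f :: "'a \<Rightarrow> real"
  assumes "\<And>x. \<bar>f x\<bar> \<le> B"
  shows "\<bar>measure_pmf.expectation p f\<bar> \<le> B"
proof -
  have "f x \<le> B" "- B \<le> f x" for x using assms[of x] by auto
  then have "measure_pmf.expectation p f \<le> B" "- B \<le> measure_pmf.expectation p f"
    using integrable_bounded_pmf[OF assms]
    by (auto intro!: measure_pmf.integral_le_const measure_pmf.integral_ge_const)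
  then show ?thesis by simp
qed

lemma expectation_bind_bounded:
  fixes f :: "'b \<Rightarrow> real"
  assumes B: "\<And>x. \<bar>f x\<bar> \<le> B"
  shows "measure_pmf.expectation (bind_pmf p g) f
    = measure_pmf.expectation p (\<lambda>x. measure_pmf.expectation (g x) f)"
proof -
  have nn: "measure_pmf.expectation (bind_pmf p g) h = measure_pmf.expectation p (\<lambda>x. measure_pmf.expectation (g x) h)"
    if h: "\<And>x. 0 \<le> h x" "\<And>x. h x \<le> C" for h :: "'b \<Rightarrow> real" and C
  proof -
    have bd: "\<bar>h x\<bar> \<le> C" for x using h[of x] by simp
    have e0: "0 \<le> measure_pmf.expectation (q :: 'c pmf) k" if "\<And>x. 0 \<le> k x" for q and k :: "'c \<Rightarrow> real"
      using that by simp
    have "ennreal (measure_pmf.expectation (bind_pmf p g) h) = (\<integral>\<^sup>+x. \<integral>\<^sup>+y. ennreal (h y) \<partial>g x \<partial>p)"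
      by (subst nn_integral_eq_integral[symmetric]) (auto simp: h intro!: integrable_bounded_pmf[OF bd])
    also have "\<dots> = (\<integral>\<^sup>+x. ennreal (measure_pmf.expectation (g x) h) \<partial>p)"
      by (intro nn_integral_cong nn_integral_eq_integral) (auto simp: h intro!: integrable_bounded_pmf[OF bd])
    also have "\<dots> = ennreal (measure_pmf.expectation p (\<lambda>x. measure_pmf.expectation (g x) h))"
      by (intro nn_integral_eq_integral)
        (auto simp: h intro!: integrable_bounded_pmf[OF expectation_bounded[OF bd]])
    finally show ?thesis by (subst (asm) ennreal_inj) (auto simp: h)
  qed
  \<comment> \<open>Adding \<open>B\<close> makes the integrand nonnegative, where the rule for
    \<open>nn_integral\<close> applies; the constant is removed afterwards.\<close>
  have "measure_pmf.expectation (bind_pmf p g) (\<lambda>x. f x + B)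
      = measure_pmf.expectation p (\<lambda>x. measure_pmf.expectation (g x) (\<lambda>x. f x + B))"
  proof (rule nn)
    show "0 \<le> f x + B" "f x + B \<le> 2 * B" for x using B[of x] by auto
  qed
  moreover have "measure_pmf.expectation q (\<lambda>x. f x + B) = measure_pmf.expectation q f + B" for q
    by (subst Bochner_Integration.integral_add) (auto intro: integrable_bounded_pmf[OF B])
  moreover have "measure_pmf.expectation p (\<lambda>x. measure_pmf.expectation (g x) f + B)
      = measure_pmf.expectation p (\<lambda>x. measure_pmf.expectation (g x) f) + B"
    by (subst Bochner_Integration.integral_add)
      (auto intro: integrable_bounded_pmf[OF expectation_bounded[OF B]])
  ultimately show ?thesis by simp
qed

context cyl
begin

lemma expectation_exit_step:
  fixes f :: "site \<Rightarrow> real"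
  assumes "domain D" "u \<in> D" "\<And>z. \<bar>f z\<bar> \<le> B"
  shows "measure_pmf.expectation (exit_law D u) f = nb_avg (\<lambda>v. measure_pmf.expectation (exit_law D v) f) u"
  using assms by (simp add: exit_law_step expectation_bind_bounded[where B = B] expectation_step nb_avg_def)

text \<open>The exit expectation \<open>E\<close> is harmonic in \<open>D\<close> and agrees with
  \<open>f\<close> outside. Hence \<open>f - E\<close> is bounded, subharmonic in \<open>D\<close>
  and zero outside, and after normalization the comparison principle applies; no stopping times are
  needed.\<close>

lemma optional_stopping:
  fixes f :: "site \<Rightarrow> real"
  assumes D: "domain D" and B: "\<And>z. \<bar>f z\<bar> \<le> B" and sub: "\<And>z. z \<in> D \<Longrightarrow> f z \<le> nb_avg f z"
  shows "f u \<le> measure_pmf.expectation (exit_law D u) f"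
proof -
  define E where "E z = measure_pmf.expectation (exit_law D z) f" for z
  have EB: "\<bar>E z\<bar> \<le> B" for z unfolding E_def by (rule expectation_bounded[OF B])
  have B0: "B \<ge> 0" using B[of u] by simp
  define s where "s z = (f z - E z) / (2 * B + 1)" for z
  have "s u \<le> 0"
  proof (rule bounded_harmonic_nonpos[OF D])
    show "s z \<le> 1" for z using B[of z] EB[of z] B0 by (simp add: s_def)
    show "s z \<le> 0" if "z \<notin> D" for z using that by (simp add: s_def E_def exit_law_outside)
    show "s z \<le> nb_avg s z" if z: "z \<in> D" for z
    proof -
      have "nb_avg s z = (nb_avg f z - nb_avg E z) / (2 * B + 1)"
        by (simp add: nb_avg_def s_def diff_divide_distrib add_divide_distrib mult.commute)
      moreover have "E z = nb_avg E z"
        using expectation_exit_step[OF D z B] unfolding E_def by (simp add: nb_avg_def)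
      ultimately show ?thesis using sub[OF z] B0 by (simp add: s_def divide_right_mono)
    qed
  qed
  then show ?thesis using B0 by (simp add: s_def E_def divide_le_0_iff)
qed

section \<open>States and the settling place of one particle\<close>

lemma idla_states_iff:
  "A \<in> idla_states N \<longleftrightarrow> A \<subseteq> cylinder N \<and> lower_part N 0 \<subseteq> A \<and> finite (A - lower_part N 0)"
proof
  assume "A \<in> idla_states N"
  then obtain F where "A \<subseteq> cylinder N" "finite F" "A = lower_part N 0 \<union> F" by (auto simp: idla_states_def)
  then show "A \<subseteq> cylinder N \<and> lower_part N 0 \<subseteq> A \<and> finite (A - lower_part N 0)"
    by (auto simp: Un_Diff)
next
  assume "A \<subseteq> cylinder N \<and> lower_part N 0 \<subseteq> A \<and> finite (A - lower_part N 0)"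
  then show "A \<in> idla_states N" unfolding idla_states_def
    by (auto intro!: exI[of _ "A - lower_part N 0"])
qed

lemma states_height_bound:
  assumes "A \<in> idla_states N"
  obtains h where "0 \<le> h" "\<And>z. z \<in> A \<Longrightarrow> snd z \<le> h"
proof -
  let ?F = "A - lower_part N 0"
  have fin: "finite ?F" and sub: "A \<subseteq> cylinder N" using assms by (auto simp: idla_states_iff)
  define h where "h = Max (insert 0 (snd ` ?F))"
  have "0 \<le> h" unfolding h_def using fin by simp
  moreover have "snd z \<le> h" if "z \<in> A" for z
  proof (cases "z \<in> ?F")
    case True
    then show ?thesis unfolding h_def using fin by simp
  next
    case False
    then have "snd z \<le> 0" using that by (auto simp: lower_part_def)
    then show ?thesis using \<open>0 \<le> h\<close> by simp
  qed
  ultimately show ?thesis by (rule that)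
qed

lemma domain_state: "A \<in> idla_states N \<Longrightarrow> domain A"
  unfolding domain_def by (metis idla_states_iff states_height_bound)

lemma level_finite: "finite (level N k)" and level_nonempty: "level N k \<noteq> {}" and card_level: "card (level N k) = N"
  using N3 by (auto simp: level_def card_cartesian_product)

lemma sum_level: "(\<Sum>z\<in>level N k. f z) = (\<Sum>x\<in>{0..<int N}. f (x, k))"
  unfolding level_def by (rule sum.reindex_bij_witness[of _ "\<lambda>x. (x, k)" fst]) auto

definition start_exit :: "site set \<Rightarrow> site pmf" where
  "start_exit A = bind_pmf (pmf_of_set (level N 0)) (exit_law A)"

lemma expectation_start_exit:
  fixes f :: "site \<Rightarrow> real"
  assumes B: "\<And>z. \<bar>f z\<bar> \<le> B"
  shows "measure_pmf.expectation (start_exit A) f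
    = (\<Sum>x\<in>{0..<int N}. measure_pmf.expectation (exit_law A (x, 0)) f) / N"
  unfolding start_exit_def
  by (simp add: expectation_bind_bounded[OF B] integral_pmf_of_set level_finite level_nonempty card_level sum_level)

lemma start_exit_subharmonic:
  fixes f :: "site \<Rightarrow> real"
  assumes D: "domain A" and B: "\<And>z. \<bar>f z\<bar> \<le> B" and sub: "\<And>z. z \<in> A \<Longrightarrow> f z \<le> nb_avg f z"
  shows "(\<Sum>x\<in>{0..<int N}. f (x, 0)) / N \<le> measure_pmf.expectation (start_exit A) f"
  unfolding expectation_start_exit[OF B]
  by (intro divide_right_mono sum_mono optional_stopping[OF D B sub]) auto

lemma set_start_exit:
  assumes D: "domain A" and L: "level N 0 \<subseteq> A" and z: "z \<in> set_pmf (start_exit A)"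
  shows "z \<notin> A" "\<exists>w\<in>A. \<exists>d\<in>set_pmf step_pmf. z = move N w d"
proof -
  obtain u where u: "u \<in> level N 0" "z \<in> set_pmf (exit_law A u)"
    using z by (auto simp: start_exit_def level_finite level_nonempty)
  with set_exit_law[OF D u(2)] L show "z \<notin> A" "\<exists>w\<in>A. \<exists>d\<in>set_pmf step_pmf. z = move N w d" by auto
qed

lemma sum_shift_mod: "(\<Sum>x\<in>{0..<int N}. f ((x + c) mod int N)) = (\<Sum>x\<in>{0..<int N}. f x)"
  by (rule sum.reindex_bij_witness[of _ "\<lambda>x. (x - c) mod int N" "\<lambda>x. (x + c) mod int N"])
    (use N3 in \<open>auto simp: mod_diff_left_eq mod_add_left_eq\<close>)

text \<open>Level sums of a function harmonic in a filled half-cylinder are affine in the level, and bounded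
  only if constant.\<close>

lemma level_sum_constant:
  fixes f :: "site \<Rightarrow> real"
  assumes B: "\<And>z. \<bar>f z\<bar> \<le> B" and k: "0 \<le> k"
    and harm: "\<And>z. z \<in> lower_part N k \<Longrightarrow> f z = nb_avg f z"
  shows "(\<Sum>x\<in>{0..<int N}. f (x, k)) = (\<Sum>x\<in>{0..<int N}. f (x, 0))"
proof -
  define c where "c y = (\<Sum>x\<in>{0..<int N}. f (x, y))" for y
  have cb: "\<bar>c y\<bar> \<le> N * B" for y
  proof -
    have "\<bar>c y\<bar> \<le> (\<Sum>x\<in>{0..<int N}. B)" unfolding c_def
      by (rule order_trans[OF sum_abs]) (intro sum_mono B)
    then show ?thesis by simp
  qed
  have rec: "c (y + 1) - c y = c y - c (y - 1)" if "y \<le> k" for y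
  proof -
    have "c y = (\<Sum>x\<in>{0..<int N}. (f ((x + 1) mod int N, y) + f ((x + - 1) mod int N, y) + f (x, y + 1) + f (x, y - 1)) / 4)"
      unfolding c_def
    proof (rule sum.cong)
      fix x assume x: "x \<in> {0..<int N}"
      then have "(x, y) \<in> lower_part N k" using that by (auto simp: lower_part_def cylinder_def)
      from harm[OF this] show "f (x, y) = (f ((x + 1) mod int N, y) + f ((x + - 1) mod int N, y) + f (x, y + 1) + f (x, y - 1)) / 4"
        using x by (simp add: nb_avg_def move_def)
    qed simp
    also have "\<dots> = (c y + c y + c (y + 1) + c (y - 1)) / 4"
      unfolding sum_divide_distrib[symmetric] sum.distrib
      using sum_shift_mod[of "\<lambda>x. f (x, y)" 1] sum_shift_mod[of "\<lambda>x. f (x, y)" "-1"] by (simp add: c_def)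
    finally show ?thesis by simp
  qed
  \<comment> \<open>The common slope of the level sums; going down \<open>n\<close> levels changes
    the sum by \<open>n * \<delta>\<close>, which boundedness permits only for zero slope.\<close>
  define \<delta> where "\<delta> = c (k + 1) - c k"
  have d: "c (k + 1 - int n) - c (k - int n) = \<delta>" for n
  proof (induction n)
    case 0
    then show ?case by (simp add: \<delta>_def)
  next
    case (Suc n)
    have "c (k - int n + 1) - c (k - int n) = c (k - int n) - c (k - int n - 1)" by (rule rec) simp
    moreover have "c (k - int n + 1) = c (k + 1 - int n)" by (rule arg_cong[of _ _ c]) simp
    ultimately show ?case using Suc by (simp add: algebra_simps)
  qed
  have lin: "c (k - int n) = c k - n * \<delta>" for n
  proof (induction n)
    case (Suc n)
    have "c (k - int n) - c (k - int (Suc n)) = \<delta>" using d[of "Suc n"] by (simp add: algebra_simps)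
    then show ?case using Suc by (simp add: algebra_simps)
  qed simp
  have "\<delta> = 0"
  proof (rule ccontr)
    assume "\<delta> \<noteq> 0"
    then obtain n where n: "2 * (N * B) < real n * \<bar>\<delta>\<bar>"
      using reals_Archimedean3[of "\<bar>\<delta>\<bar>" ] by auto
    have "real n * \<bar>\<delta>\<bar> = \<bar>c k - c (k - int n)\<bar>" by (simp add: lin abs_mult)
    also have "\<dots> \<le> 2 * (N * B)" using cb[of k] cb[of "k - int n"] by linarith
    finally show False using n by simp
  qed
  then show ?thesis using lin[of "nat k"] k by (simp add: c_def)
qed

section \<open>Compatibility of the growth with vertical shifts\<close>

definition vshift :: "int \<Rightarrow> site \<Rightarrow> site" where
  "vshift k z = (fst z, snd z - k)"

lemma walk_vshift: "walk N (vshift k u) \<omega> n = vshift k (walk N u \<omega> n)"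
  by (induction n) (auto simp: vshift_def move_def)

lemma inj_vshift: "inj (vshift k)"
  by (auto simp: inj_def vshift_def prod_eq_iff)

lemma exit_site_vshift: "exit_site N (vshift k ` D) (vshift k u, \<omega>) = vshift k (exit_site N D (u, \<omega>))"
  unfolding exit_site_def prod.case walk_vshift by (simp add: inj_image_mem_iff[OF inj_vshift])

lemma exit_law_vshift: "exit_law (vshift k ` D) (vshift k u) = map_pmf (vshift k) (exit_law D u)"
proof -
  have "measure_pmf (exit_law (vshift k ` D) (vshift k u)) = measure_pmf (map_pmf (vshift k) (exit_law D u))"
    unfolding map_pmf_rep_eq measure_exit_law by (simp add: distr_distr exit_site_vshift comp_def)
  then show ?thesis by (simp add: measure_pmf_inject)
qed

lemma lower_part_mono: "i \<le> j \<Longrightarrow> lower_part N i \<subseteq> lower_part N j"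
  by (auto simp: lower_part_def)

text \<open>A state is bounded above, so the \<open>GREATEST\<close> in \<open>filled_level\<close>
  is attained and this equivalence characterizes it.\<close>

lemma filled_iff:
  assumes A: "A \<in> idla_states N"
  shows "lower_part N (int k) \<subseteq> A \<longleftrightarrow> k \<le> filled_level N A"
proof -
  obtain h where h: "0 \<le> h" "\<And>z. z \<in> A \<Longrightarrow> snd z \<le> h" using states_height_bound[OF A] by blast
  have b: "j \<le> nat h" if "lower_part N (int j) \<subseteq> A" for j
  proof -
    have "(0, int j) \<in> lower_part N (int j)" using N3 by (auto simp: lower_part_def cylinder_def)
    then have "int j \<le> h" using that h(2) by fastforce
    then show ?thesis by simp
  qed
  have "lower_part N (int 0) \<subseteq> A" using A by (auto simp: idla_states_iff)
  from GreatestI_nat[of "\<lambda>k. lower_part N (int k) \<subseteq> A", OF this b]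
  have g: "lower_part N (int (filled_level N A)) \<subseteq> A" unfolding filled_level_def by simp
  show ?thesis
  proof
    assume "lower_part N (int k) \<subseteq> A"
    from Greatest_le_nat[of "\<lambda>k. lower_part N (int k) \<subseteq> A", OF this b]
    show "k \<le> filled_level N A" unfolding filled_level_def by simp
  next
    assume "k \<le> filled_level N A"
    then show "lower_part N (int k) \<subseteq> A" using g lower_part_mono[of "int k" "int (filled_level N A)"] by auto
  qed
qed

lemma mem_vshift_image: "z \<in> vshift k ` A \<longleftrightarrow> (fst z, snd z + k) \<in> A"
proof
  assume "(fst z, snd z + k) \<in> A"
  then show "z \<in> vshift k ` A" by (intro image_eqI[of _ _ "(fst z, snd z + k)"]) (auto simp: vshift_def)
qed (auto simp: vshift_def)

lemma lower_part_subset_vshift: "lower_part N j \<subseteq> vshift k ` A \<longleftrightarrow> lower_part N (j + k) \<subseteq> A"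
proof
  assume L: "lower_part N j \<subseteq> vshift k ` A"
  show "lower_part N (j + k) \<subseteq> A"
  proof
    fix z assume "z \<in> lower_part N (j + k)"
    then have "vshift k z \<in> lower_part N j" by (auto simp: lower_part_def cylinder_def vshift_def)
    with L have "vshift k z \<in> vshift k ` A" by blast
    then show "z \<in> A" using inj_image_mem_iff[OF inj_vshift] by blast
  qed
next
  assume L: "lower_part N (j + k) \<subseteq> A"
  show "lower_part N j \<subseteq> vshift k ` A"
  proof
    fix z assume "z \<in> lower_part N j"
    then have "(fst z, snd z + k) \<in> lower_part N (j + k)" by (auto simp: lower_part_def cylinder_def)
    with L show "z \<in> vshift k ` A" by (auto simp: mem_vshift_image)
  qed
qed

lemma vshift_state:
  assumes A: "A \<in> idla_states N" and k: "k \<le> filled_level N A"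
  shows "vshift (int k) ` A \<in> idla_states N"
  unfolding idla_states_iff
proof (intro conjI)
  show "vshift (int k) ` A \<subseteq> cylinder N" using A by (auto simp: idla_states_iff vshift_def cylinder_def)
  show "lower_part N 0 \<subseteq> vshift (int k) ` A"
    using k filled_iff[OF A, of k] by (simp add: lower_part_subset_vshift)
  have "vshift (int k) ` A - lower_part N 0 \<subseteq> vshift (int k) ` (A - lower_part N 0)"
    by (auto simp: lower_part_def vshift_def cylinder_def)
  moreover have "finite (A - lower_part N 0)" using A by (simp add: idla_states_iff)
  ultimately show "finite (vshift (int k) ` A - lower_part N 0)" using finite_subset by blast
qed

lemma downshift_eq: "downshift N A = vshift (int (filled_level N A)) ` A"
  by (auto simp: downshift_def vshift_def split_def)

lemma downshift_state: "A \<in> idla_states N \<Longrightarrow> downshift N A \<in> idla_states N"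
  by (simp add: downshift_eq vshift_state)

lemma filled_vshift:
  assumes A: "A \<in> idla_states N" and k: "k \<le> filled_level N A"
  shows "filled_level N (vshift (int k) ` A) = filled_level N A - k"
proof -
  have "j \<le> filled_level N (vshift (int k) ` A) \<longleftrightarrow> j \<le> filled_level N A - k" for j
    using k by (simp add: filled_iff[OF vshift_state[OF A k], symmetric] lower_part_subset_vshift
        filled_iff[OF A, of "j + k", simplified] le_diff_conv2)
  then show ?thesis by (metis order_antisym order_refl)
qed

lemma downshift_vshift:
  assumes A: "A \<in> idla_states N" and k: "k \<le> filled_level N A"
  shows "downshift N (vshift (int k) ` A) = downshift N A"
proof -
  have "vshift (int (filled_level N A - k)) ` vshift (int k) ` A = vshift (int (filled_level N A)) ` A"
    using k by (simp add: image_image vshift_def of_nat_diff)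
  then show ?thesis by (simp add: downshift_eq filled_vshift[OF A k])
qed

lemma insert_state:
  assumes "A \<in> idla_states N" "z \<in> cylinder N"
  shows "insert z A \<in> idla_states N"
  using assms by (auto simp: idla_states_iff insert_Diff_if)

lemma level0_subset: "A \<in> idla_states N \<Longrightarrow> level N 0 \<subseteq> A"
  by (auto simp: idla_states_iff level_def lower_part_def cylinder_def)

lemma set_start_exit_state:
  assumes A: "A \<in> idla_states N" and z: "z \<in> set_pmf (start_exit A)"
  shows "z \<in> cylinder N" "z \<notin> A" "\<exists>w\<in>A. \<exists>d\<in>set_pmf step_pmf. z = move N w d" "insert z A \<in> idla_states N"
proof -
  from set_start_exit[OF domain_state[OF A] level0_subset[OF A] z]
  show *: "z \<notin> A" "\<exists>w\<in>A. \<exists>d\<in>set_pmf step_pmf. z = move N w d" by auto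
  then show "z \<in> cylinder N" using move_cylinder by auto
  with A show "insert z A \<in> idla_states N" by (rule insert_state)
qed

text \<open>In the shifted picture particles start at what was level \<open>k\<close>. This does not
  alter the exit law: the probability of a given exit site is harmonic on the filled part, so its
  average over level \<open>k\<close> equals that over level \<open>0\<close>.\<close>

lemma start_exit_vshift:
  assumes A: "A \<in> idla_states N" and k: "k \<le> filled_level N A"
  shows "start_exit (vshift (int k) ` A) = map_pmf (vshift (int k)) (start_exit A)"
proof (rule pmf_eqI)
  fix z :: site
  let ?i = "indicat_real {z}"
  have pmf_E: "pmf p z = measure_pmf.expectation p ?i" for p :: "site pmf"
    by (simp add: pmf.rep_eq)
  have bd: "\<bar>?i v\<bar> \<le> 1" for v by (auto simp: indicator_def)
  define f where "f u = measure_pmf.expectation (exit_law A u) (\<lambda>v. ?i (vshift (int k) v))" for u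
  have "pmf (start_exit (vshift (int k) ` A)) z
      = (\<Sum>x\<in>{0..<int N}. measure_pmf.expectation (exit_law (vshift (int k) ` A) (x, 0)) ?i) / N"
    unfolding pmf_E by (rule expectation_start_exit[OF bd])
  also have "\<dots> = (\<Sum>x\<in>{0..<int N}. f (x, int k)) / N"
  proof -
    have "exit_law (vshift (int k) ` A) (x, 0) = map_pmf (vshift (int k)) (exit_law A (x, int k))" for x
      using exit_law_vshift[of "int k" A "(x, int k)"] by (simp add: vshift_def)
    then show ?thesis by (simp only: f_def integral_map_pmf)
  qed
  also have "\<dots> = (\<Sum>x\<in>{0..<int N}. f (x, 0)) / N"
  proof -
    have "(\<Sum>x\<in>{0..<int N}. f (x, int k)) = (\<Sum>x\<in>{0..<int N}. f (x, 0))"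
    proof (rule level_sum_constant)
      show "\<bar>f u\<bar> \<le> 1" for u unfolding f_def by (rule expectation_bounded) (auto simp: indicator_def)
      show "f u = nb_avg f u" if "u \<in> lower_part N (int k)" for u
      proof -
        have uA: "u \<in> A" using that k filled_iff[OF A, of k] by auto
        show ?thesis unfolding f_def by (rule expectation_exit_step[OF domain_state[OF A] uA, where B = 1]) (auto simp: indicator_def)
      qed
    qed simp
    then show ?thesis by simp
  qed
  also have "\<dots> = pmf (map_pmf (vshift (int k)) (start_exit A)) z"
    unfolding pmf_E integral_map_pmf f_def by (rule expectation_start_exit[symmetric, where B = 1]) (auto simp: indicator_def)
  finally show "pmf (start_exit (vshift (int k) ` A)) z = pmf (map_pmf (vshift (int k)) (start_exit A)) z" .
qed

section \<open>The unshifted growth chain and the stationary law\<close>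

definition grow :: "site set \<Rightarrow> site set pmf" where
  "grow A = map_pmf (\<lambda>z. insert z A) (start_exit A)"

primrec idla :: "site set \<Rightarrow> nat \<Rightarrow> site set pmf" where
  "idla A 0 = return_pmf A"
| "idla A (Suc n) = bind_pmf (idla A n) grow"

lemma set_idla_state:
  assumes "A \<in> idla_states N" "B \<in> set_pmf (idla A n)"
  shows "B \<in> idla_states N"
  using assms(2)
proof (induction n arbitrary: B)
  case 0
  then show ?case using assms(1) by simp
next
  case (Suc n)
  then show ?case by (auto simp: grow_def intro: set_start_exit_state(4))
qed

text \<open>Links the particle space of the definitions to \<open>pmf\<close>s: Fubini integrates
  out the steps for each starting site.\<close>

lemma shifted_trans_eq:
  "shifted_trans N A B = pmf (map_pmf (downshift N) (grow A)) B"
proof -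
  interpret S: prob_space steps by (rule prob_space_steps)
  interpret S: sigma_finite_measure steps by unfold_locales
  define T where "T = {z. downshift N (insert z A) = B}"
  let ?P = "{p \<in> space (particle N). downshift N (idla_step N A p) = B}"
  have P: "?P = exit_site N A -` T \<inter> space (particle N)"
    by (auto simp: T_def idla_step_def)
  have "sets (particle N) = sets (count_space UNIV \<Otimes>\<^sub>M steps)"
    unfolding particle_def by (intro sets_pair_measure_cong) auto
  moreover have "exit_site N A \<in> measurable (count_space UNIV \<Otimes>\<^sub>M steps) (count_space UNIV)"
    by (rule measurable_pair_measure_countable1) auto
  ultimately have "exit_site N A \<in> measurable (particle N) (count_space UNIV)"
    by (simp cong: measurable_cong_sets)
  then have Pm: "?P \<in> sets (particle N)" unfolding P by (rule measurable_sets) simp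
  have "emeasure (particle N) ?P = (\<integral>\<^sup>+u. emeasure steps (Pair u -` ?P) \<partial>measure_pmf (pmf_of_set (level N 0)))"
    using Pm unfolding particle_def by (rule S.emeasure_pair_measure_alt)
  also have "\<dots> = (\<integral>\<^sup>+u. emeasure (exit_law A u) T \<partial>measure_pmf (pmf_of_set (level N 0)))"
  proof (rule nn_integral_cong)
    fix u
    have "Pair u -` ?P = (\<lambda>\<omega>. exit_site N A (u, \<omega>)) -` T \<inter> space steps"
      unfolding P by (auto simp: particle_def space_pair_measure)
    then show "emeasure steps (Pair u -` ?P) = emeasure (exit_law A u) T"
      unfolding measure_exit_law by (subst emeasure_distr) auto
  qed
  also have "\<dots> = emeasure (start_exit A) T" by (simp add: start_exit_def)
  finally have "measure (particle N) ?P = measure (start_exit A) T" by (simp add: measure_def)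
  also have "\<dots> = pmf (map_pmf (downshift N) (grow A)) B"
    unfolding grow_def map_pmf_comp pmf.rep_eq measure_map_pmf by (simp add: T_def vimage_def)
  finally show ?thesis by (simp add: shifted_trans_def)
qed

text \<open>A downshift before a step is absorbed by the downshift after it, because filled levels
  are never lost. Intermediate downshifts can therefore be dropped.\<close>

lemma grow_downshift:
  assumes A: "A \<in> idla_states N"
  shows "map_pmf (downshift N) (grow (downshift N A)) = map_pmf (downshift N) (grow A)"
proof -
  let ?k = "int (filled_level N A)"
  have "map_pmf (downshift N) (grow (downshift N A))
      = map_pmf (\<lambda>z. downshift N (insert (vshift ?k z) (vshift ?k ` A))) (start_exit A)"
    unfolding grow_def downshift_eq[of A] start_exit_vshift[OF A order_refl] map_pmf_comp ..
  also have "\<dots> = map_pmf (\<lambda>z. downshift N (insert z A)) (start_exit A)"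
  proof (rule map_pmf_cong[OF refl])
    fix z assume z: "z \<in> set_pmf (start_exit A)"
    have ins: "insert z A \<in> idla_states N" by (rule set_start_exit_state(4)[OF A z])
    have "filled_level N A \<le> filled_level N (insert z A)"
      using filled_iff[OF A, of "filled_level N A"] filled_iff[OF ins, of "filled_level N A"] by auto
    from downshift_vshift[OF ins this]
    show "downshift N (insert (vshift ?k z) (vshift ?k ` A)) = downshift N (insert z A)" by simp
  qed
  also have "\<dots> = map_pmf (downshift N) (grow A)" by (simp add: grow_def map_pmf_comp)
  finally show ?thesis .
qed

lemma stationary_step:
  assumes st: "shifted_stationary N \<mu>"
  shows "\<mu> = bind_pmf \<mu> (\<lambda>A. map_pmf (downshift N) (grow A))"
proof (rule pmf_eqI)
  fix B
  have sub: "set_pmf \<mu> \<subseteq> idla_states N" using st by (simp add: shifted_stationary_def)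
  show "pmf \<mu> B = pmf (bind_pmf \<mu> (\<lambda>A. map_pmf (downshift N) (grow A))) B"
  proof (cases "B \<in> idla_states N")
    case True
    then show ?thesis using st by (simp add: shifted_stationary_def pmf_bind shifted_trans_eq)
  next
    case False
    have "B \<notin> set_pmf (bind_pmf \<mu> (\<lambda>A. map_pmf (downshift N) (grow A)))"
    proof
      assume "B \<in> set_pmf (bind_pmf \<mu> (\<lambda>A. map_pmf (downshift N) (grow A)))"
      then obtain A z where "A \<in> set_pmf \<mu>" "z \<in> set_pmf (start_exit A)" "B = downshift N (insert z A)"
        by (auto simp: grow_def)
      then have "B \<in> idla_states N" using sub by (auto intro!: downshift_state set_start_exit_state(4))
      then show False using False by simp
    qed
    moreover have "B \<notin> set_pmf \<mu>" using False sub by auto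
    ultimately show ?thesis unfolding set_pmf_iff by simp
  qed
qed

text \<open>All downshifts are postponed to the end, so the unshifted growth can be studied instead.
  The index \<open>Suc n\<close> avoids zero steps, a case that would ask that \<open>\<mu>\<close>
  be invariant under \<open>downshift\<close> alone.\<close>

lemma stationary_idla:
  assumes st: "shifted_stationary N \<mu>"
  shows "\<mu> = bind_pmf \<mu> (\<lambda>A. map_pmf (downshift N) (idla A (Suc n)))"
proof (induction n)
  case 0
  then show ?case using stationary_step[OF st] by (simp add: bind_return_pmf)
next
  case (Suc n)
  have sub: "set_pmf \<mu> \<subseteq> idla_states N" using st by (simp add: shifted_stationary_def)
  have "\<mu> = bind_pmf \<mu> (\<lambda>A. map_pmf (downshift N) (grow A))" by (rule stationary_step[OF st])
  also have "\<dots> = bind_pmf (bind_pmf \<mu> (\<lambda>A. map_pmf (downshift N) (idla A (Suc n))))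
      (\<lambda>A. map_pmf (downshift N) (grow A))"
    by (rule arg_cong[where f = "\<lambda>p. bind_pmf p (\<lambda>A. map_pmf (downshift N) (grow A))"]) (rule Suc)
  also have "\<dots> = bind_pmf \<mu> (\<lambda>A. bind_pmf (idla A (Suc n)) (\<lambda>B. map_pmf (downshift N) (grow (downshift N B))))"
    by (simp only: bind_assoc_pmf bind_map_pmf)
  also have "\<dots> = bind_pmf \<mu> (\<lambda>A. bind_pmf (idla A (Suc n)) (\<lambda>B. map_pmf (downshift N) (grow B)))"
  proof (rule bind_pmf_cong[OF refl], rule bind_pmf_cong[OF refl])
    fix A B assume "A \<in> set_pmf \<mu>" "B \<in> set_pmf (idla A (Suc n))"
    then show "map_pmf (downshift N) (grow (downshift N B)) = map_pmf (downshift N) (grow B)"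
      using sub set_idla_state[of A B "Suc n"] by (intro grow_downshift) blast
  qed
  also have "\<dots> = bind_pmf \<mu> (\<lambda>A. map_pmf (downshift N) (idla A (Suc (Suc n))))"
    by (simp only: idla.simps(2)[of _ "Suc n"] map_bind_pmf)
  finally show ?case .
qed

end

section \<open>Multiplicative supermartingales\<close>

context cyl
begin

lemma set_idla:
  assumes A0: "A0 \<in> idla_states N" and B: "B \<in> set_pmf (idla A0 n)"
  shows "A0 \<subseteq> B" "finite (B - A0)" "card (B - A0) = n"
proof -
  have "A0 \<subseteq> B \<and> finite (B - A0) \<and> card (B - A0) = n"
    using B
  proof (induction n arbitrary: B)
    case (Suc n)
    then obtain A z where A: "A \<in> set_pmf (idla A0 n)" and z: "z \<in> set_pmf (start_exit A)" and "B = insert z A"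
      by (auto simp: grow_def)
    moreover have "z \<notin> A" by (rule set_start_exit_state(2)[OF set_idla_state[OF A0 A] z])
    ultimately show ?case using Suc.IH[OF A] by (auto simp: insert_Diff_if)
  qed simp
  then show "A0 \<subseteq> B" "finite (B - A0)" "card (B - A0) = n" by auto
qed

text \<open>Each step multiplies the product by \<open>\<phi>\<close> at the new, previously empty
  site. The condition \<open>C\<close> passes to smaller clusters, so if it holds at the end it held
  throughout; its indicator takes the place of a stopping time.\<close>

lemma multiplicative_supermartingale:
  fixes \<phi> :: "site \<Rightarrow> real"
  assumes A0: "A0 \<in> idla_states N" and nonneg: "\<And>z. 0 \<le> \<phi> z"
    and C: "\<And>A z. C (insert z A) \<Longrightarrow> C A"
    and step: "\<And>A. A \<in> idla_states N \<Longrightarrow> A0 \<subseteq> A \<Longrightarrow> C A \<Longrightarrow> (\<integral>\<^sup>+z. ennreal (\<phi> z) \<partial>start_exit A) \<le> 1"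
  shows "(\<integral>\<^sup>+A. ennreal (\<Prod>z\<in>A - A0. \<phi> z) * indicator {A. C A} A \<partial>idla A0 n) \<le> 1"
proof (induction n)
  case 0
  then show ?case by (simp add: indicator_def)
next
  case (Suc n)
  let ?g = "\<lambda>A. ennreal (\<Prod>z\<in>A - A0. \<phi> z) * indicator {A. C A} A"
  have "(\<integral>\<^sup>+A. ?g A \<partial>idla A0 (Suc n)) = (\<integral>\<^sup>+A. (\<integral>\<^sup>+z. ?g (insert z A) \<partial>start_exit A) \<partial>idla A0 n)"
    by (simp add: grow_def)
  also have "\<dots> \<le> (\<integral>\<^sup>+A. ?g A \<partial>idla A0 n)"
  proof (rule nn_integral_mono_AE, rule AE_pmfI)
    fix A assume A: "A \<in> set_pmf (idla A0 n)"
    have AS: "A \<in> idla_states N" by (rule set_idla_state[OF A0 A])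
    note AA = set_idla[OF A0 A]
    have "(\<integral>\<^sup>+z. ?g (insert z A) \<partial>start_exit A) \<le> (\<integral>\<^sup>+z. ?g A * ennreal (\<phi> z) \<partial>start_exit A)"
    proof (rule nn_integral_mono_AE, rule AE_pmfI)
      fix z assume "z \<in> set_pmf (start_exit A)"
      then have z: "z \<notin> A" by (rule set_start_exit_state(2)[OF AS])
      then have "(\<Prod>z\<in>insert z A - A0. \<phi> z) = \<phi> z * (\<Prod>z\<in>A - A0. \<phi> z)"
        using AA by (subst insert_Diff_if) auto
      then show "?g (insert z A) \<le> ?g A * ennreal (\<phi> z)"
        using C[of z A] nonneg by (auto simp: indicator_def ennreal_mult prod_nonneg mult.commute)
    qed
    also have "\<dots> = ?g A * (\<integral>\<^sup>+z. ennreal (\<phi> z) \<partial>start_exit A)" by (rule nn_integral_cmult) simp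
    also have "\<dots> \<le> ?g A"
    proof (cases "C A")
      case True
      from mult_left_mono[OF step[OF AS AA(1) True], of "?g A"] show ?thesis by simp
    qed simp
    finally show "(\<integral>\<^sup>+z. ?g (insert z A) \<partial>start_exit A) \<le> ?g A" .
  qed
  also have "\<dots> \<le> 1" by (rule Suc)
  finally show ?case .
qed

text \<open>Markov's inequality for that product.\<close>

lemma multiplicative_bound:
  fixes \<phi> :: "site \<Rightarrow> real"
  assumes A0: "A0 \<in> idla_states N" and nonneg: "\<And>z. 0 \<le> \<phi> z"
    and C: "\<And>A z. C (insert z A) \<Longrightarrow> C A"
    and step: "\<And>A. A \<in> idla_states N \<Longrightarrow> A0 \<subseteq> A \<Longrightarrow> C A \<Longrightarrow> (\<integral>\<^sup>+z. ennreal (\<phi> z) \<partial>start_exit A) \<le> 1"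
    and K: "K > 0"
    and E: "\<And>A. A \<in> set_pmf (idla A0 n) \<Longrightarrow> A \<in> E \<Longrightarrow> C A \<and> K \<le> (\<Prod>z\<in>A - A0. \<phi> z)"
  shows "measure_pmf.prob (idla A0 n) E \<le> 1 / K"
proof -
  have "ennreal K * emeasure (idla A0 n) E = (\<integral>\<^sup>+A. ennreal K * indicator E A \<partial>idla A0 n)"
    by (simp add: nn_integral_cmult)
  also have "\<dots> \<le> (\<integral>\<^sup>+A. ennreal (\<Prod>z\<in>A - A0. \<phi> z) * indicator {A. C A} A \<partial>idla A0 n)"
    using E by (intro nn_integral_mono_AE AE_pmfI) (auto simp: indicator_def intro: ennreal_leI)
  also have "\<dots> \<le> 1" by (rule multiplicative_supermartingale[OF A0 nonneg C step])
  finally have "ennreal (K * measure_pmf.prob (idla A0 n) E) \<le> ennreal 1"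
    using K by (simp add: measure_pmf.emeasure_eq_measure ennreal_mult)
  then have "K * measure_pmf.prob (idla A0 n) E \<le> 1" by (subst (asm) ennreal_le_iff) auto
  then show ?thesis using K by (simp add: field_simps)
qed

lemma exp_minus_square_le:
  fixes x :: real
  assumes "\<bar>x\<bar> \<le> 1 / 2"
  shows "exp (x - 2 * x\<^sup>2) \<le> 1 + x"
proof -
  have "\<bar>ln (1 + x) - x\<bar> \<le> 2 * x\<^sup>2" using abs_ln_one_plus_x_minus_x_bound assms by simp
  then have "x - 2 * x\<^sup>2 \<le> ln (1 + x)" by linarith
  then have "exp (x - 2 * x\<^sup>2) \<le> exp (ln (1 + x))" by simp
  also have "\<dots> = 1 + x" using assms by (intro exp_ln) auto
  finally show ?thesis .
qed

text \<open>Since \<open>exp (x - 2 x\<^sup>2) \<le> 1 + x\<close>, the quadratic variation along the settled sites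
  compensates the exponential: it is a sum over the cluster, hence bounded deterministically.\<close>

lemma exponential_bound:
  fixes \<xi> :: "site \<Rightarrow> real"
  assumes A0: "A0 \<in> idla_states N" and small: "\<And>z. \<bar>\<xi> z\<bar> \<le> 1 / 2"
    and C: "\<And>A z. C (insert z A) \<Longrightarrow> C A"
    and step: "\<And>A. A \<in> idla_states N \<Longrightarrow> C A \<Longrightarrow> measure_pmf.expectation (start_exit A) \<xi> \<le> 0"
    and E: "\<And>A. A \<in> set_pmf (idla A0 n) \<Longrightarrow> A \<in> E \<Longrightarrow> C A \<and> b \<le> (\<Sum>z\<in>A - A0. \<xi> z) - 2 * (\<Sum>z\<in>A - A0. (\<xi> z)\<^sup>2)"
  shows "measure_pmf.prob (idla A0 n) E \<le> exp (- b)"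
proof -
  have "measure_pmf.prob (idla A0 n) E \<le> 1 / exp b"
  proof (rule multiplicative_bound[OF A0, where C = C and \<phi> = "\<lambda>z. exp (\<xi> z - 2 * (\<xi> z)\<^sup>2)"])
    fix A assume A: "A \<in> idla_states N" "C A"
    have ib: "integrable (measure_pmf (start_exit A)) \<xi>" by (rule integrable_bounded_pmf[OF small])
    have "(\<integral>\<^sup>+z. ennreal (exp (\<xi> z - 2 * (\<xi> z)\<^sup>2)) \<partial>start_exit A) \<le> (\<integral>\<^sup>+z. ennreal (1 + \<xi> z) \<partial>start_exit A)"
      by (intro nn_integral_mono ennreal_leI exp_minus_square_le small)
    also have "\<dots> = ennreal (measure_pmf.expectation (start_exit A) (\<lambda>z. 1 + \<xi> z))"
    proof (rule nn_integral_eq_integral)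
      show "AE z in start_exit A. 0 \<le> 1 + \<xi> z"
      proof (rule AE_pmfI)
        fix z show "0 \<le> 1 + \<xi> z" using small[of z] by linarith
      qed
    qed (use ib in auto)
    also have "\<dots> \<le> ennreal 1" using step[OF A] ib by (intro ennreal_leI) simp
    finally show "(\<integral>\<^sup>+z. ennreal (exp (\<xi> z - 2 * (\<xi> z)\<^sup>2)) \<partial>start_exit A) \<le> 1" by simp
  next
    fix A assume A: "A \<in> set_pmf (idla A0 n)" "A \<in> E"
    then have "exp b \<le> exp ((\<Sum>z\<in>A - A0. \<xi> z) - 2 * (\<Sum>z\<in>A - A0. (\<xi> z)\<^sup>2))" using E by simp
    also have "\<dots> = (\<Prod>z\<in>A - A0. exp (\<xi> z - 2 * (\<xi> z)\<^sup>2))"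
      by (subst exp_sum[symmetric]) (auto simp: set_idla[OF A0 A(1)] sum_subtractf sum_distrib_left)
    finally show "C A \<and> exp b \<le> (\<Prod>z\<in>A - A0. exp (\<xi> z - 2 * (\<xi> z)\<^sup>2))" using E A by simp
  qed (auto intro: C)
  then show ?thesis by (simp add: exp_minus field_simps)
qed

end

section \<open>Harmonic kernels on the half-cylinder\<close>

text \<open>A weak form of Jordan's inequality. Up to \<open>pi / 3\<close> the mean value theorem
  applies with \<open>cos\<close> at least \<open>1 / 2\<close>; beyond, monotonicity gives
  \<open>4 / 5\<close>, which exceeds \<open>pi / 4\<close>.\<close>

lemma sin_ge_half:
  fixes x :: real
  assumes "0 \<le> x" "x \<le> pi / 2"
  shows "x / 2 \<le> sin x"
proof (cases "x \<le> pi / 3")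
  case True
  show ?thesis
  proof (cases "x = 0")
    case False
    then have "\<exists>z. 0 < z \<and> z < x \<and> sin x - sin 0 = (x - 0) * cos z"
      using assms by (intro MVT2) (auto intro!: derivative_eq_intros)
    then obtain z where z: "0 < z" "z < x" "sin x = x * cos z" by auto
    have "cos (pi / 3) \<le> cos z" using z True by (intro cos_monotone_0_pi_le) auto
    then have "x * (1 / 2) \<le> x * cos z" using assms by (intro mult_left_mono) (auto simp: cos_60)
    then show ?thesis using z by simp
  qed simp
next
  case False
  have "sin (pi / 3) \<le> sin x" using False assms by (intro sin_monotone_2pi_le) auto
  moreover have "(8 / 5 :: real) \<le> sqrt 3" by (rule real_le_rsqrt) (simp add: power2_eq_square)
  then have "4 / 5 \<le> sin (pi / 3)" by (simp add: sin_60)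
  moreover have "x / 2 \<le> 4 / 5" using assms pi_less_4 pi_approx by simp
  ultimately show ?thesis by linarith
qed

lemma harm_le_ln: "n > 0 \<Longrightarrow> harm n \<le> 1 + ln (real n)"
proof -
  assume "n > 0"
  then obtain m where m: "n = Suc m" by (cases n) auto
  have "harm (Suc m) - ln (real (Suc m)) \<le> harm (Suc 0) - ln (real (Suc 0))"
    using decseq_harm_diff_ln unfolding decseq_def by (metis le0)
  then show ?thesis by (simp add: m harm_expand)
qed

text \<open>The sum equals \<open>harm D + harm M - harm (D + M)\<close>, hence is bounded uniformly
  in \<open>D\<close>. This is where the logarithm in the quadratic variation arises.\<close>

lemma sum_inverse_shift_le:
  "(\<Sum>d\<in>{1..D}. 1 / real d - 1 / real (d + M)) \<le> harm M"
proof -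
  have "(\<Sum>d\<in>{1..D}. 1 / real (d + M)) = harm (D + M) - harm M"
    by (induction D) (auto simp: harm_Suc inverse_eq_divide)
  moreover have "(\<Sum>d\<in>{1..D}. 1 / real d) = harm D" by (simp add: harm_def inverse_eq_divide)
  moreover have "harm D \<le> (harm (D + M) :: real)" by (rule harm_mono) simp
  ultimately show ?thesis by (simp add: sum_subtractf)
qed

context cyl
begin

text \<open>\<open>decay l\<close> is the root in \<open>(0, 1]\<close> of \<open>r + 1 / r = 4 - 2 cos (2 \<pi> l / N)\<close>, so that
  \<open>cos (2 \<pi> l x / N) r\<^sup>d\<close> is discrete harmonic.\<close>

definition mode_sin :: "int \<Rightarrow> real" where
  "mode_sin l = \<bar>sin (pi * l / N)\<bar>"

definition decay :: "int \<Rightarrow> real" where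
  "decay l = (sqrt (1 + (mode_sin l)\<^sup>2) - mode_sin l)\<^sup>2"

lemma mode_sin_range: "0 \<le> mode_sin l" "mode_sin l \<le> 1"
  by (auto simp: mode_sin_def)

lemma decay_root_range: "0 < sqrt (1 + (mode_sin l)\<^sup>2) - mode_sin l" "sqrt (1 + (mode_sin l)\<^sup>2) - mode_sin l \<le> 1 - mode_sin l / 2"
  "1 - mode_sin l \<le> sqrt (1 + (mode_sin l)\<^sup>2) - mode_sin l"
proof -
  let ?t = "mode_sin l"
  note t = mode_sin_range[of l]
  have "sqrt (?t\<^sup>2) < sqrt (1 + ?t\<^sup>2)" by (rule real_sqrt_less_mono) simp
  then show "0 < sqrt (1 + ?t\<^sup>2) - ?t" using t by simp
  have "?t * ?t \<le> ?t * 1" by (rule mult_left_mono) (use t in auto)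
  then have "1 + ?t\<^sup>2 \<le> (1 + ?t / 2)\<^sup>2" using t by (simp add: power2_eq_square field_simps)
  then have "sqrt (1 + ?t\<^sup>2) \<le> 1 + ?t / 2" using t by (intro real_le_lsqrt) auto
  then show "sqrt (1 + ?t\<^sup>2) - ?t \<le> 1 - ?t / 2" by simp
  show "1 - ?t \<le> sqrt (1 + ?t\<^sup>2) - ?t" by simp
qed

lemma decay_range: "0 < decay l" "decay l \<le> 1"
proof -
  show "0 < decay l" unfolding decay_def using decay_root_range(1)[of l] by simp
  have "sqrt (1 + (mode_sin l)\<^sup>2) - mode_sin l \<le> 1" using decay_root_range(2)[of l] mode_sin_range[of l] by linarith
  then show "decay l \<le> 1" unfolding decay_def using decay_root_range(1)[of l] by (intro power_le_one) auto
qed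

text \<open>With \<open>t = mode_sin l\<close>, the square root \<open>q\<close> of
  \<open>decay l\<close> solves \<open>1 - q^2 = 2 * t * q\<close>; squaring this and using
  \<open>cos (2 a) = 1 - 2 * (sin a)^2\<close> gives the quadratic equation.\<close>

lemma decay_eq: "(decay l)\<^sup>2 + 1 = decay l * (4 - 2 * cos (2 * pi * l / N))"
proof -
  define t where "t = mode_sin l"
  define q where "q = sqrt (1 + t\<^sup>2) - t"
  have "(q + t)\<^sup>2 = 1 + t\<^sup>2" by (simp add: q_def)
  then have "1 - q\<^sup>2 = 2 * t * q" by (simp add: power2_eq_square algebra_simps)
  then have "(1 - q\<^sup>2)\<^sup>2 = 4 * t\<^sup>2 * q\<^sup>2" by (simp add: power_mult_distrib)
  then have 1: "(q\<^sup>2)\<^sup>2 + 1 = q\<^sup>2 * (2 + 4 * t\<^sup>2)" by (simp add: power2_eq_square algebra_simps)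
  have "cos (2 * (pi * l / N)) = 1 - 2 * t\<^sup>2" unfolding t_def mode_sin_def by (subst cos_double_sin) simp
  then have "4 - 2 * cos (2 * pi * l / N) = 2 + 4 * t\<^sup>2" by (simp add: algebra_simps)
  then show ?thesis using 1 by (simp add: decay_def q_def t_def)
qed

lemma cos_mode_periodic: "cos (2 * pi * real_of_int l * real_of_int (x mod int N) / N) = cos (2 * pi * real_of_int l * x / N)"
proof -
  have "real_of_int x = real_of_int (x mod int N) + N * real_of_int (x div int N)"
    by (metis mult_div_mod_eq add.commute of_int_add of_int_mult of_int_of_nat_eq)
  then have "2 * pi * real_of_int l * x / N = 2 * pi * real_of_int l * real_of_int (x mod int N) / N + 2 * pi * real_of_int (l * (x div int N))"
    using N3 by (simp add: field_simps)
  then show ?thesis by (simp only: cos_add cos_integer_2pi sin_integer_2pi Ints_of_int)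
qed

lemma decay_periodic: "decay (l mod int N) = decay l"
proof -
  have "(mode_sin l)\<^sup>2 = (1 - cos (2 * pi * real_of_int 1 * l / N)) / 2" for l
    using cos_double_sin[of "pi * l / N"] by (simp add: mode_sin_def mult.assoc)
  then have "(mode_sin (l mod int N))\<^sup>2 = (mode_sin l)\<^sup>2" by (simp only: cos_mode_periodic)
  then have "mode_sin (l mod int N) = mode_sin l"
    using mode_sin_range(1) power2_eq_iff_nonneg by blast
  then show ?thesis by (simp add: decay_def)
qed

lemma decay_0 [simp]: "decay 0 = 1"
  by (simp add: decay_def mode_sin_def)

lemma decay_minus: "decay (- l) = decay l"
  by (simp add: decay_def mode_sin_def)

text \<open>Here \<open>mode_sin l\<close> is at least \<open>pi * l / (2 * N)\<close>, hence at
  least \<open>l / N\<close>, and \<open>q \<le> 1 - t / 2 \<le> exp (- t / 2)\<close> is squared.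
  Beyond \<open>N / 2\<close> the sine decreases again.\<close>

lemma decay_le_half:
  assumes "0 \<le> l" "2 * l \<le> int N"
  shows "decay l \<le> exp (- (real_of_int l / N))"
proof -
  define t where "t = mode_sin l"
  define q where "q = sqrt (1 + t\<^sup>2) - t"
  have N0: "real N > 0" using N3 by simp
  have "real_of_int (2 * l) \<le> real N" using assms(2) by (metis of_int_le_iff of_int_of_nat_eq)
  then have l2: "real_of_int l / N \<le> 1 / 2" using N0 by (simp add: field_simps)
  have l0: "0 \<le> real_of_int l / N" using assms by simp
  define a where "a = pi * (real_of_int l / N)"
  have a: "0 \<le> a" "a \<le> pi / 2"
    unfolding a_def using mult_nonneg_nonneg[OF _ l0, of pi] mult_left_mono[OF l2, of pi] by auto
  have "a / 2 \<le> t" using sin_ge_half[OF a] unfolding t_def mode_sin_def a_def by simp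
  moreover have "real_of_int l / N * 2 \<le> a"
    unfolding a_def using mult_right_mono[of 2 pi "real_of_int l / N"] pi_gt3 l0 by (simp add: mult.commute)
  then have "real_of_int l / N \<le> a / 2" by simp
  ultimately have t: "real_of_int l / N \<le> t" by (rule order_trans[rotated])
  have "q \<le> 1 - t / 2" "0 < q" using decay_root_range[of l] by (auto simp: q_def t_def)
  moreover have "1 - t / 2 \<le> exp (- (t / 2))" using exp_ge_add_one_self[of "- (t / 2)"] by simp
  ultimately have "q\<^sup>2 \<le> (exp (- (t / 2)))\<^sup>2" by (intro power_mono) auto
  also have "\<dots> = exp (- t)" by (simp add: power2_eq_square exp_add[symmetric])
  also have "\<dots> \<le> exp (- (real_of_int l / N))" using t by simp
  finally show ?thesis by (simp add: decay_def q_def t_def)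
qed

text \<open>The distance from \<open>l\<close> to the nearer end of the frequency range governs the
  decay; adding the contributions of both ends avoids a minimum.\<close>

lemma decay_power_le:
  assumes "1 \<le> l" "l < int N"
  shows "decay l ^ d \<le> exp (- (real d / N)) ^ nat l + exp (- (real d / N)) ^ nat (int N - l)"
proof -
  have *: "exp (- (real_of_int k / N)) ^ d = exp (- (real d / N)) ^ nat k" if "0 \<le> k" for k
    using that by (simp add: exp_of_nat_mult[symmetric] mult.commute)
  show ?thesis
  proof (cases "2 * l \<le> int N")
    case True
    then have "decay l ^ d \<le> exp (- (real_of_int l / N)) ^ d"
      using assms decay_range(1)[of l] by (intro power_mono decay_le_half) auto
    then show ?thesis using *[of l] assms by (simp add: add_increasing2)
  next
    case False
    have "decay l = decay (int N - l)"
      using decay_periodic[of "int N - l"] decay_periodic[of "- l"] decay_minus[of l]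
      by (metis minus_mod_self1 diff_0 diff_conv_add_uminus add.commute mod_add_self1)
    moreover have "decay (int N - l) ^ d \<le> exp (- (real_of_int (int N - l) / N)) ^ d"
      using assms False decay_range(1)[of "int N - l"] by (intro power_mono decay_le_half) auto
    ultimately show ?thesis using *[of "int N - l"] assms by (simp add: add_increasing)
  qed
qed

text \<open>Two geometric series of ratio \<open>exp (- d / N)\<close>, one from each end of the
  range. The bound keeps \<open>exp (d / N) - 1\<close> because its quadratic growth is what makes
  depths beyond \<open>N\<close> summable.\<close>

lemma sum_decay_le:
  assumes d: "d \<ge> 1"
  shows "(\<Sum>l\<in>{1..<int N}. decay l ^ d) \<le> 2 / (exp (real d / N) - 1)"
proof -
  define x where "x = exp (- (real d / N))"
  have x: "0 < x" "x < 1" using d N3 by (auto simp: x_def)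
  have geo: "(\<Sum>i\<in>{1..<N}. x ^ i) \<le> x / (1 - x)"
  proof -
    have "summable (\<lambda>i. x ^ Suc i)" using x by (simp add: summable_geometric)
    then have "(\<Sum>i\<in>{..<N - 1}. x ^ Suc i) \<le> (\<Sum>i. x ^ Suc i)" using x by (intro sum_le_suminf) auto
    moreover have "(\<Sum>i. x ^ Suc i) = x * (1 / (1 - x))"
      using x by (simp add: suminf_mult summable_geometric suminf_geometric)
    moreover have "(\<Sum>i\<in>{1..<N}. x ^ i) = (\<Sum>i\<in>{..<N - 1}. x ^ Suc i)"
      using N3 by (intro sum.reindex_bij_witness[of _ Suc "\<lambda>i. i - 1"]) auto
    ultimately show ?thesis by simp
  qed
  have "(\<Sum>l\<in>{1..<int N}. decay l ^ d) \<le> (\<Sum>l\<in>{1..<int N}. x ^ nat l + x ^ nat (int N - l))"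
    unfolding x_def by (intro sum_mono decay_power_le) auto
  also have "\<dots> = (\<Sum>l\<in>{1..<int N}. x ^ nat l) + (\<Sum>l\<in>{1..<int N}. x ^ nat (int N - l))"
    by (rule sum.distrib)
  also have "(\<Sum>l\<in>{1..<int N}. x ^ nat l) = (\<Sum>i\<in>{1..<N}. x ^ i)"
    by (rule sum.reindex_bij_witness[of _ int nat]) auto
  also have "(\<Sum>l\<in>{1..<int N}. x ^ nat (int N - l)) = (\<Sum>i\<in>{1..<N}. x ^ i)"
    by (rule sum.reindex_bij_witness[of _ "\<lambda>i. int N - int i" "\<lambda>l. nat (int N - l)"]) auto
  finally have "(\<Sum>l\<in>{1..<int N}. decay l ^ d) \<le> 2 * (x / (1 - x))" using geo by simp
  also have "x / (1 - x) = 1 / (exp (real d / N) - 1)"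
    using x unfolding x_def by (simp add: exp_minus field_simps)
  finally show ?thesis by simp
qed

text \<open>Orthogonality of characters in real form: the sum is invariant under shifts by
  \<open>c\<close>, and adding the shifts by \<open>1\<close> and \<open>- 1\<close> gives
  \<open>2 * S = 2 * cos \<theta> * S\<close>, so \<open>S\<close> vanishes unless
  \<open>cos \<theta> = 1\<close>.\<close>

lemma sum_cos_mode:
  "(\<Sum>x\<in>{0..<int N}. cos (2 * pi * real_of_int l * real_of_int (x + c) / N)) = (if int N dvd l then real N else 0)"
proof -
  define S where "S c = (\<Sum>x\<in>{0..<int N}. cos (2 * pi * real_of_int l * real_of_int (x + c) / N))" for c
  have shift: "S c = S 0" for c
    unfolding S_def
    using sum_shift_mod[of "\<lambda>x. cos (2 * pi * real_of_int l * real_of_int x / N)" c] cos_mode_periodic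
    by simp
  show ?thesis
  proof (cases "int N dvd l")
    case True
    then obtain q where "l = int N * q" by blast
    then have "cos (2 * pi * real_of_int l * real_of_int (x + c) / N) = 1" for x
      using cos_integer_2pi[of "real_of_int (q * (x + c))"] N3 by (simp add: mult.assoc)
    then show ?thesis using True by simp
  next
    case False
    define \<theta> where "\<theta> = 2 * pi * real_of_int l / N"
    have "S 1 + S (- 1) = (\<Sum>x\<in>{0..<int N}. 2 * cos \<theta> * cos (2 * pi * real_of_int l * real_of_int x / N))"
      unfolding S_def sum.distrib[symmetric]
    proof (rule sum.cong)
      fix x
      have "2 * pi * real_of_int l * real_of_int (x + 1) / N = 2 * pi * real_of_int l * real_of_int x / N + \<theta>"
        "2 * pi * real_of_int l * real_of_int (x + - 1) / N = 2 * pi * real_of_int l * real_of_int x / N - \<theta>"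
        by (simp_all add: \<theta>_def field_simps diff_divide_distrib add_divide_distrib)
      note e = this
      show "cos (2 * pi * real_of_int l * real_of_int (x + 1) / N) + cos (2 * pi * real_of_int l * real_of_int (x + - 1) / N)
        = 2 * cos \<theta> * cos (2 * pi * real_of_int l * real_of_int x / N)"
        unfolding e cos_add cos_diff by simp
    qed simp
    also have "\<dots> = 2 * cos \<theta> * S 0" by (simp add: S_def sum_distrib_left)
    finally have "S 0 * (1 - cos \<theta>) = 0" using shift[of 1] shift[of "- 1"] by (simp add: algebra_simps)
    moreover have "cos \<theta> \<noteq> 1"
    proof
      assume "cos \<theta> = 1"
      then obtain n :: int where "\<theta> = real_of_int n * 2 * pi" using cos_one_2pi_int by blast
      then have "real_of_int l = real_of_int (n * int N)" using N3 by (simp add: \<theta>_def field_simps)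
      then show False using False by (metis dvd_triv_right of_int_eq_iff)
    qed
    ultimately have "S 0 = 0" by simp
    then show ?thesis using False shift[of c] by (simp add: S_def)
  qed
qed

text \<open>The arguments are the horizontal offset from the pole and the depth below it. Fejer weights make
  the boundary values nonnegative; for \<open>J = N\<close> they are the delta function, for small \<open>J\<close> they are
  spread over a window of width \<open>N / J\<close>.\<close>

definition fejer :: "nat \<Rightarrow> int \<Rightarrow> nat \<Rightarrow> real" where
  "fejer J x d = (\<Sum>j\<in>{0..<int J}. \<Sum>k\<in>{0..<int J}. cos (2 * pi * real_of_int (j - k) * x / N) * decay (j - k) ^ d) / (N * J)"

lemma fejer_periodic: "fejer J (x mod int N) d = fejer J x d"
  by (simp only: fejer_def cos_mode_periodic)

lemma fejer_harmonic: "fejer J (x + 1) (Suc d) + fejer J (x - 1) (Suc d) + fejer J x (Suc (Suc d)) + fejer J x d = 4 * fejer J x (Suc d)"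
proof -
  have "cos (2 * pi * l * real_of_int (x + 1) / N) * decay l ^ Suc d + cos (2 * pi * l * real_of_int (x - 1) / N) * decay l ^ Suc d
    + cos (2 * pi * l * x / N) * decay l ^ Suc (Suc d) + cos (2 * pi * l * x / N) * decay l ^ d
    = 4 * (cos (2 * pi * l * x / N) * decay l ^ Suc d)" for l :: int
  proof -
    define r a \<theta> where "r = decay l" and "a = 2 * pi * l * x / N" and "\<theta> = 2 * pi * l / N"
    have e: "2 * pi * l * real_of_int (x + 1) / N = a + \<theta>" "2 * pi * l * real_of_int (x - 1) / N = a - \<theta>"
      by (simp_all add: a_def \<theta>_def field_simps diff_divide_distrib add_divide_distrib)
    have r: "r * r + 1 = r * (4 - 2 * cos \<theta>)" using decay_eq[of l] by (simp add: r_def \<theta>_def power2_eq_square)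
    have "cos (a + \<theta>) * r ^ Suc d + cos (a - \<theta>) * r ^ Suc d + cos a * r ^ Suc (Suc d) + cos a * r ^ d
      = cos a * r ^ d * (2 * cos \<theta> * r + (r * r + 1))" by (simp add: cos_add cos_diff algebra_simps)
    also have "\<dots> = 4 * (cos a * r ^ Suc d)" unfolding r by (simp add: algebra_simps)
    finally show ?thesis unfolding e r_def[symmetric] a_def[symmetric] .
  qed
  note mode = this
  show ?thesis
    unfolding fejer_def times_divide_eq_right add_divide_distrib[symmetric] sum_distrib_left sum.distrib[symmetric] mode ..
qed

text \<open>Only the pairs \<open>j = k\<close> survive orthogonality, since
  \<open>J \<le> N\<close> keeps other differences from being multiples of \<open>N\<close>. There
  are \<open>J\<close> of them, each contributing \<open>N\<close>.\<close>

lemma fejer_sum: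
  assumes J: "1 \<le> J" "J \<le> N"
  shows "(\<Sum>x\<in>{0..<int N}. fejer J (x - c) d) = 1"
proof -
  have "(\<Sum>x\<in>{0..<int N}. fejer J (x - c) d) = (\<Sum>j\<in>{0..<int J}. \<Sum>k\<in>{0..<int J}. \<Sum>x\<in>{0..<int N}.
      cos (2 * pi * real_of_int (j - k) * real_of_int (x + - c) / N) * decay (j - k) ^ d) / (N * J)"
    unfolding fejer_def sum_divide_distrib[symmetric]
    by (subst sum.swap, subst (2) sum.swap) simp
  also have "\<dots> = (\<Sum>j\<in>{0..<int J}. \<Sum>k\<in>{0..<int J}. if j = k then real N else 0) / (N * J)"
  proof (intro arg_cong[where f = "\<lambda>s. s / (N * J)"] sum.cong refl)
    fix j k assume jk: "j \<in> {0..<int J}" "k \<in> {0..<int J}"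
    have "int N dvd (j - k) \<longleftrightarrow> j = k"
    proof
      assume "int N dvd (j - k)"
      moreover have "\<bar>j - k\<bar> < int N" using jk J by auto
      ultimately show "j = k" using zdvd_imp_le[of "int N" "\<bar>j - k\<bar>"] by (cases "j = k") auto
    qed simp
    then show "(\<Sum>x\<in>{0..<int N}. cos (2 * pi * real_of_int (j - k) * real_of_int (x + - c) / N) * decay (j - k) ^ d)
        = (if j = k then real N else 0)"
      unfolding sum_distrib_right[symmetric] sum_cos_mode by simp
  qed
  also have "\<dots> = 1" using J N3 by simp
  finally show ?thesis .
qed

lemma fejer_delta: "fejer N x 0 = (if int N dvd x then 1 else 0)"
proof -
  have "(\<Sum>j\<in>{0..<int N}. cos (2 * pi * real_of_int (j - k) * x / N)) = (if int N dvd x then real N else 0)" for k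
    using sum_cos_mode[of x "- k"] by (simp add: mult_ac)
  moreover have "fejer N x 0 = (\<Sum>k\<in>{0..<int N}. \<Sum>j\<in>{0..<int N}. cos (2 * pi * real_of_int (j - k) * x / N)) / (N * N)"
    unfolding fejer_def by (subst sum.swap) simp
  ultimately show ?thesis using N3 by simp
qed

lemma fejer_abs_le:
  assumes J: "1 \<le> J" "J \<le> N"
  shows "\<bar>fejer J x d\<bar> \<le> 1"
proof -
  have "\<bar>\<Sum>j\<in>{0..<int J}. \<Sum>k\<in>{0..<int J}. cos (2 * pi * real_of_int (j - k) * x / N) * decay (j - k) ^ d\<bar>
      \<le> (\<Sum>j\<in>{0..<int J}. \<Sum>k\<in>{0..<int J}. 1)"
  proof (rule order_trans[OF sum_abs], rule sum_mono, rule order_trans[OF sum_abs], rule sum_mono)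
    fix j k
    have "\<bar>decay (j - k) ^ d\<bar> \<le> 1" using decay_range[of "j - k"] by (simp add: power_le_one)
    then show "\<bar>cos (2 * pi * real_of_int (j - k) * x / N) * decay (j - k) ^ d\<bar> \<le> 1"
      unfolding abs_mult by (intro mult_le_one) auto
  qed
  also have "\<dots> = real J * real J" by simp
  also have "\<dots> \<le> real N * J" using J by (intro mult_right_mono) auto
  finally show ?thesis using J N3 by (simp add: fejer_def)
qed

text \<open>At depth \<open>0\<close> the double sum is the squared modulus of a sum of
  \<open>J\<close> complex exponentials.\<close>

lemma fejer_boundary_nonneg: "0 \<le> fejer J x 0"
proof -
  define \<alpha> where "\<alpha> = 2 * pi * x / N"
  have e: "2 * pi * real_of_int (j - k) * x / N = \<alpha> * j - \<alpha> * k" for j k :: int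
    by (simp add: \<alpha>_def algebra_simps diff_divide_distrib)
  have "(\<Sum>j\<in>{0..<int J}. \<Sum>k\<in>{0..<int J}. cos (2 * pi * real_of_int (j - k) * x / N))
      = (\<Sum>j\<in>{0..<int J}. cos (\<alpha> * j))\<^sup>2 + (\<Sum>j\<in>{0..<int J}. sin (\<alpha> * j))\<^sup>2"
    unfolding e cos_diff sum.distrib power2_eq_square sum_product ..
  then show ?thesis by (simp add: fejer_def)
qed

text \<open>The kernel with pole at column \<open>x0\<close> of level \<open>Y\<close>, cut off
  above. For \<open>J = N\<close> its value below \<open>Y\<close> is the probability that the walk
  first meets level \<open>Y\<close> in that column.\<close>

definition pole :: "nat \<Rightarrow> int \<Rightarrow> int \<Rightarrow> site \<Rightarrow> real" where
  "pole J x0 Y z = (if snd z \<le> Y then fejer J (fst z - x0) (nat (Y - snd z)) else 0)"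

lemma pole_harmonic:
  assumes "snd z < Y"
  shows "nb_avg (pole J x0 Y) z = pole J x0 Y z"
proof -
  obtain d where d: "nat (Y - snd z) = Suc d" using assms by (cases "nat (Y - snd z)") auto
  then have dn: "nat (Y - (snd z + 1)) = d" "nat (Y - (snd z - 1)) = Suc (Suc d)" by auto
  have p: "fejer J (a mod int N - x0) k = fejer J (a - x0) k" for a k
    using fejer_periodic[of J "a mod int N - x0" k] fejer_periodic[of J "a - x0" k] by (simp add: mod_diff_left_eq)
  have "4 * nb_avg (pole J x0 Y) z
    = fejer J (fst z - x0 + 1) (Suc d) + fejer J (fst z - x0 - 1) (Suc d) + fejer J (fst z - x0) (Suc (Suc d)) + fejer J (fst z - x0) d"
    using assms d dn by (simp add: nb_avg_def pole_def move_def p algebra_simps)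
  also have "\<dots> = 4 * pole J x0 Y z" unfolding fejer_harmonic using assms d by (simp add: pole_def)
  finally show ?thesis by simp
qed

text \<open>The maximum principle carries nonnegativity from the boundary level to every depth: a
  walk below level \<open>0\<close> leaves that region on the boundary.\<close>

lemma fejer_nonneg:
  assumes J: "1 \<le> J" "J \<le> N"
  shows "0 \<le> fejer J x d"
proof -
  define D where "D = {z \<in> cylinder N. snd z < 0}"
  have D: "domain D" unfolding domain_def D_def by (auto intro!: exI[of _ 0])
  define f where "f = (\<lambda>z. - pole J 0 0 z)"
  define u where "u = (x mod int N, - int d)"
  have "f u \<le> measure_pmf.expectation (exit_law D u) f"
  proof (rule optional_stopping[OF D])
    show "\<bar>f z\<bar> \<le> 1" for z using fejer_abs_le[OF J] by (simp add: f_def pole_def)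
    show "f z \<le> nb_avg f z" if "z \<in> D" for z
    proof -
      have "nb_avg f z = - nb_avg (pole J 0 0) z" by (simp add: f_def nb_avg_def field_simps)
      then show ?thesis using that by (simp add: pole_harmonic D_def f_def)
    qed
  qed
  also have "\<dots> \<le> 0"
  proof -
    have uc: "u \<in> cylinder N" using N3 by (simp add: u_def cylinder_def)
    have "f z \<le> 0" if "z \<in> set_pmf (exit_law D u)" for z
    proof -
      have "z \<notin> D" "z \<in> cylinder N"
        using set_exit_law[OF D that] uc move_cylinder by blast+
      then have "snd z \<ge> 0" by (simp add: D_def)
      then show ?thesis by (auto simp: f_def pole_def fejer_boundary_nonneg)
    qed
    then have "measure_pmf.expectation (exit_law D u) f \<le> measure_pmf.expectation (exit_law D u) (\<lambda>_. 0)"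
      using fejer_abs_le[OF J] by (intro integral_mono_AE AE_pmfI integrable_bounded_pmf[where B = 1]) (auto simp: f_def pole_def)
    then show ?thesis by simp
  qed
  finally show ?thesis by (simp add: f_def pole_def u_def fejer_periodic)
qed

text \<open>The zero mode contributes exactly \<open>1 / N\<close>, the others at most
  \<open>R / N\<close>. With \<open>exp y - 1 \<ge> y + y^2 / 2\<close> at \<open>y = d / N\<close>
  the bound becomes \<open>4 * N / (d * (d + 2 * N))\<close>, written in partial fractions to suit
  \<open>sum_inverse_shift_le\<close>.\<close>

lemma fejer_deviation:
  assumes J: "1 \<le> J" "J \<le> N" and d: "1 \<le> d"
  shows "\<bar>fejer J x d - 1 / N\<bar> \<le> 2 * (1 / d - 1 / real (d + 2 * N))"
proof -
  define R where "R = (\<Sum>l\<in>{1..<int N}. decay l ^ d)"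
  have N0: "real N > 0" using N3 by simp
  let ?c = "\<lambda>j k. cos (2 * pi * real_of_int (j - k) * x / N) * decay (j - k) ^ d"
  have full: "(\<Sum>k\<in>{0..<int N}. decay (j - k) ^ d) = 1 + R" for j
  proof -
    have "decay (j - k) = decay ((k + (- j)) mod int N)" for k
      using decay_minus[of "k - j"] decay_periodic[of "k + - j"] by simp
    then have "(\<Sum>k\<in>{0..<int N}. decay (j - k) ^ d) = (\<Sum>k\<in>{0..<int N}. decay k ^ d)"
      using sum_shift_mod[of "\<lambda>k. decay k ^ d" "- j"] by simp
    also have "\<dots> = decay 0 ^ d + R"
    proof -
      have "{0..<int N} = insert 0 {1..<int N}" using N3 by auto
      then show ?thesis by (simp add: R_def)
    qed
    finally show ?thesis by simp
  qed
  have inner: "\<bar>(\<Sum>k\<in>{0..<int J}. ?c j k) - 1\<bar> \<le> R" if j: "j \<in> {0..<int J}" for j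
  proof -
    have "(\<Sum>k\<in>{0..<int J}. ?c j k) - 1 = (\<Sum>k\<in>{0..<int J} - {j}. ?c j k)"
      using j by (subst sum.remove[of _ j]) auto
    also have "\<bar>\<dots>\<bar> \<le> (\<Sum>k\<in>{0..<int J} - {j}. decay (j - k) ^ d)"
    proof (rule order_trans[OF sum_abs], rule sum_mono)
      fix k
      have "\<bar>cos (2 * pi * real_of_int (j - k) * x / N)\<bar> * \<bar>decay (j - k) ^ d\<bar> \<le> 1 * \<bar>decay (j - k) ^ d\<bar>"
        by (rule mult_right_mono) auto
      then show "\<bar>?c j k\<bar> \<le> decay (j - k) ^ d" using decay_range[of "j - k"] by (simp add: abs_mult)
    qed
    also have "\<dots> \<le> (\<Sum>k\<in>{0..<int N} - {j}. decay (j - k) ^ d)"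
      using J decay_range(1) by (intro sum_mono2) (auto simp: less_imp_le)
    also have "\<dots> = R" using full[of j] j J by (subst (asm) sum.remove[of _ j]) auto
    finally show ?thesis .
  qed
  have "fejer J x d - 1 / N = (\<Sum>j\<in>{0..<int J}. (\<Sum>k\<in>{0..<int J}. ?c j k) - 1) / (N * J)"
    using J N0 by (simp add: fejer_def sum_subtractf diff_divide_distrib)
  also have "\<bar>\<dots>\<bar> \<le> (\<Sum>j\<in>{0..<int J}. R) / (N * J)"
    unfolding abs_divide using J N0
    by (intro frac_le order_trans[OF sum_abs] sum_mono inner) (auto simp: R_def intro!: sum_nonneg mult_nonneg_nonneg zero_le_power less_imp_le[OF decay_range(1)])
  also have "\<dots> = R / N" using J by simp
  also have "\<dots> \<le> (2 / (exp (real d / N) - 1)) / N"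
    unfolding R_def by (rule divide_right_mono[OF sum_decay_le[OF d]]) simp
  also have "\<dots> \<le> (2 / (real d / N + (real d / N)\<^sup>2 / 2)) / N"
  proof -
    have y: "real d / N > 0" using d N0 by simp
    have "real d / N + (real d / N)\<^sup>2 / 2 \<le> exp (real d / N) - 1"
      using exp_lower_Taylor_quadratic[of "real d / N"] y by simp
    then show ?thesis using y N0 by (intro divide_right_mono divide_left_mono mult_pos_pos add_pos_nonneg) (auto intro: add_pos_nonneg less_le_trans[rotated])
  qed
  also have "\<dots> = 2 * (1 / d - 1 / real (d + 2 * N))"
  proof -
    have *: "2 / (a / n + (a / n)\<^sup>2 / 2) / n = 2 * (1 / a - 1 / (a + 2 * n))" if "a > 0" "n > 0" for a n :: real
    proof -
      have "a / n + (a / n)\<^sup>2 / 2 = a * (a + 2 * n) / (2 * n\<^sup>2)"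
        using that by (simp add: divide_simps power2_eq_square) (simp add: algebra_simps)
      then have "2 / (a / n + (a / n)\<^sup>2 / 2) / n = 4 * n / (a * (a + 2 * n))"
        using that by (simp add: power2_eq_square)
      also have "\<dots> = 2 * (1 / a - 1 / (a + 2 * n))"
        using that by (simp add: divide_simps)
      finally show ?thesis .
    qed
    show ?thesis using *[of "real d" "real N"] d N0 by simp
  qed
  finally show ?thesis .
qed

text \<open>One factor of the square is bounded by its supremum; by positivity the other is at most
  \<open>fejer + 1 / N\<close>, whose sum over a level is \<open>2\<close>.\<close>

lemma fejer_square_sum:
  assumes J: "1 \<le> J" "J \<le> N" and d: "1 \<le> d"
  shows "(\<Sum>x\<in>{0..<int N}. (fejer J (x - c) d - 1 / N)\<^sup>2) \<le> 4 * (1 / d - 1 / real (d + 2 * N))"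
proof -
  let ?b = "2 * (1 / d - 1 / real (d + 2 * N))"
  have b0: "?b \<ge> 0" using fejer_deviation[OF J d, of 0] by linarith
  have "(\<Sum>x\<in>{0..<int N}. (fejer J (x - c) d - 1 / N)\<^sup>2) \<le> (\<Sum>x\<in>{0..<int N}. ?b * (fejer J (x - c) d + 1 / N))"
  proof (rule sum_mono)
    fix x
    have "\<bar>fejer J (x - c) d - 1 / N\<bar> \<le> fejer J (x - c) d + 1 / N"
      using fejer_nonneg[OF J, of "x - c" d] by (simp add: abs_le_iff)
    then have "\<bar>fejer J (x - c) d - 1 / N\<bar> * \<bar>fejer J (x - c) d - 1 / N\<bar> \<le> ?b * (fejer J (x - c) d + 1 / N)"
      using fejer_deviation[OF J d, of "x - c"] b0 by (intro mult_mono) auto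
    then show "(fejer J (x - c) d - 1 / N)\<^sup>2 \<le> ?b * (fejer J (x - c) d + 1 / N)"
      by (simp add: power2_eq_square)
  qed
  also have "\<dots> = ?b * (1 + 1)"
    unfolding sum_distrib_left[symmetric] sum.distrib fejer_sum[OF J] using N3 by simp
  finally show ?thesis by simp
qed

text \<open>With \<open>64 * m * J \<le> N\<close> every frequency difference produces only small
  angles and little decay on the window, so each of the \<open>J^2\<close> terms is at least
  \<open>1 / 4\<close>.\<close>

lemma fejer_lower_bound:
  assumes m: "1 \<le> m" and J: "1 \<le> J" "64 * m * J \<le> N" and x: "\<bar>x\<bar> \<le> int m" and d: "d \<le> 3 * m"
  shows "real J / (4 * N) \<le> fejer J x d"
proof -
  have N0: "real N > 0" using N3 by simp
  have m0: "real m > 0" and J0: "real J > 0" using m J by auto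
  have JN: "64 * real m * real J \<le> real N" using J(2) by (metis of_nat_le_iff of_nat_mult of_nat_numeral)
  have each: "1 / 4 \<le> cos (2 * pi * real_of_int (j - k) * x / N) * decay (j - k) ^ d"
    if "j \<in> {0..<int J}" "k \<in> {0..<int J}" for j k
  proof -
    define l where "l = \<bar>real_of_int (j - k)\<bar>"
    have "\<bar>j - k\<bar> \<le> int J" using that by auto
    then have l: "l \<le> J" unfolding l_def by linarith
    have pl: "pi * l / N \<le> pi / (64 * m)"
    proof -
      have "l * (64 * m) \<le> real J * (64 * m)" using l by (intro mult_right_mono) auto
      also have "\<dots> \<le> N" using JN by (simp add: mult_ac)
      finally have "l * (64 * m) \<le> N" .
      then have "l / N \<le> 1 / (64 * m)" using N0 m0 by (simp add: field_simps)
      then have "pi * (l / N) \<le> pi * (1 / (64 * m))" by (intro mult_left_mono) auto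
      then show ?thesis by simp
    qed
    have t: "mode_sin (j - k) \<le> pi / (64 * m)"
    proof -
      have "mode_sin (j - k) \<le> \<bar>pi * real_of_int (j - k) / N\<bar>" unfolding mode_sin_def by (rule abs_sin_x_le_abs_x)
      also have "\<dots> = pi * l / N" by (simp add: l_def abs_mult)
      finally show ?thesis using pl by simp
    qed
    have pi4: "pi / (64 * m) \<le> 1 / (16 * m)" using pi_less_4 m0 by (simp add: field_simps)
    have t1: "mode_sin (j - k) \<le> 1 / (16 * m)" using t pi4 by linarith
    moreover have "1 / (16 * real m) \<le> 1" using m by simp
    ultimately have t2: "mode_sin (j - k) \<le> 1" by linarith
    \<comment> \<open>Bernoulli's inequality for \<open>(1 - t) ^ (2 * d)\<close>: the loss
      \<open>2 * d * t\<close> is at most \<open>6 * m / (16 * m)\<close>, below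
      \<open>1 / 2\<close>.\<close>
    have "1 / 2 \<le> 1 + real (2 * d) * (- mode_sin (j - k))"
    proof -
      have "real (2 * d) * mode_sin (j - k) \<le> real (6 * m) * (1 / (16 * m))"
        using t1 d mode_sin_range(1) by (intro mult_mono) auto
      also have "\<dots> \<le> 1 / 2" using m0 by simp
      finally show ?thesis by simp
    qed
    also have "\<dots> \<le> (1 + (- mode_sin (j - k))) ^ (2 * d)" using t2 by (intro Bernoulli_inequality) simp
    also have "\<dots> \<le> (sqrt (1 + (mode_sin (j - k))\<^sup>2) - mode_sin (j - k)) ^ (2 * d)"
      using decay_root_range(3)[of "j - k"] t2 by (intro power_mono) auto
    also have "\<dots> = decay (j - k) ^ d" by (simp add: decay_def power_mult)
    finally have r: "1 / 2 \<le> decay (j - k) ^ d" .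
    define b where "b = pi * real_of_int (j - k) * x / N"
    have "\<bar>b\<bar> = pi * l / N * \<bar>real_of_int x\<bar>" by (simp add: b_def l_def abs_mult)
    also have "\<dots> \<le> 1 / (16 * m) * m"
      using pl pi4 x by (intro mult_mono) (auto simp: l_def)
    also have "\<dots> = 1 / 16" using m0 by simp
    finally have bb: "\<bar>b\<bar> \<le> 1 / 16" .
    have "\<bar>sin b\<bar> \<le> 1 / 16" using abs_sin_x_le_abs_x[of b] bb by linarith
    then have "\<bar>sin b\<bar>\<^sup>2 \<le> (1 / 16)\<^sup>2" by (intro power_mono) auto
    then have "(sin b)\<^sup>2 \<le> 1 / 4" by (simp add: power2_eq_square)
    then have "1 / 2 \<le> cos (2 * b)" by (simp add: cos_double_sin)
    moreover have "2 * b = 2 * pi * real_of_int (j - k) * x / N" by (simp add: b_def)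
    ultimately have c: "1 / 2 \<le> cos (2 * pi * real_of_int (j - k) * x / N)" by simp
    have "(1 / 2) * (1 / 2) \<le> cos (2 * pi * real_of_int (j - k) * x / N) * decay (j - k) ^ d"
      using c r by (intro mult_mono) auto
    then show ?thesis by simp
  qed
  have "(\<Sum>j\<in>{0..<int J}. \<Sum>k\<in>{0..<int J}. 1 / 4) \<le> (\<Sum>j\<in>{0..<int J}. \<Sum>k\<in>{0..<int J}. cos (2 * pi * real_of_int (j - k) * x / N) * decay (j - k) ^ d)"
    by (intro sum_mono each)
  then have "(real J * real J / 4) / (N * J) \<le> fejer J x d"
    unfolding fejer_def using N0 J0 by (intro divide_right_mono) auto
  then show ?thesis using J0 by simp
qed

end

section \<open>Depth of holes\<close>

context cyl
begin

definition upper :: "site set \<Rightarrow> int \<Rightarrow> site set" where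
  "upper A K = A - lower_part N K"

lemma finite_above: "A \<in> idla_states N \<Longrightarrow> 0 \<le> K \<Longrightarrow> finite (upper A K)"
  using lower_part_mono[of 0 K] unfolding upper_def idla_states_iff by (metis Diff_mono finite_subset order_refl)

lemma above_slab: "upper (lower_part N K) 0 = {0..<int N} \<times> {1..K}"
  by (auto simp: upper_def lower_part_def cylinder_def)

lemma finite_slab_set: "finite (upper (lower_part N K) 0)"
  by (simp add: above_slab)

lemma sum_slab: "(\<Sum>z\<in>upper (lower_part N K) 0. f z) = (\<Sum>y\<in>{1..K}. \<Sum>x\<in>{0..<int N}. f (x, y))"
  unfolding above_slab by (subst sum.swap) (simp add: sum.cartesian_product)

lemma card_slab: "0 \<le> K \<Longrightarrow> card (upper (lower_part N K) 0) = N * nat K"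
  unfolding above_slab by (simp add: card_cartesian_product)

lemma pole_nonneg: "1 \<le> J \<Longrightarrow> J \<le> N \<Longrightarrow> 0 \<le> pole J x0 Y z"
  by (simp add: pole_def fejer_nonneg)

lemma pole_le_1: "1 \<le> J \<Longrightarrow> J \<le> N \<Longrightarrow> pole J x0 Y z \<le> 1"
  using fejer_abs_le[of J "fst z - x0" "nat (Y - snd z)"] by (auto simp: pole_def)

lemma pole_level_sum:
  assumes "1 \<le> J" "J \<le> N" "y \<le> Y"
  shows "(\<Sum>x\<in>{0..<int N}. pole J x0 Y (x, y)) = 1"
  using assms fejer_sum[OF assms(1,2), of x0] by (simp add: pole_def)

lemma pole_slab_sum:
  assumes J: "1 \<le> J" "J \<le> N" and K: "0 \<le> K" "K \<le> Y"
  shows "(\<Sum>z\<in>upper (lower_part N K) 0. pole J x0 Y z) = K"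
  unfolding sum_slab using K by (simp add: pole_level_sum[OF J])

text \<open>\<open>fejer_square_sum\<close> summed over depths \<open>1\<close> to
  \<open>Y - 1\<close>; the level of the pole is left out as the deviation bound starts at depth
  \<open>1\<close>.\<close>

lemma pole_slab_square_sum:
  assumes J: "1 \<le> J" "J \<le> N"
  shows "(\<Sum>z\<in>upper (lower_part N (Y - 1)) 0. (pole J x0 Y z - 1 / N)\<^sup>2) \<le> 4 * harm (2 * N)"
proof (cases "1 \<le> Y")
  case True
  let ?f = "\<lambda>d. 4 * (1 / real d - 1 / real (d + 2 * N))"
  have "(\<Sum>z\<in>upper (lower_part N (Y - 1)) 0. (pole J x0 Y z - 1 / N)\<^sup>2) \<le> (\<Sum>y\<in>{1..Y - 1}. ?f (nat (Y - y)))"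
    unfolding sum_slab
  proof (rule sum_mono)
    fix y assume y: "y \<in> {1..Y - 1}"
    then have "(\<Sum>x\<in>{0..<int N}. (pole J x0 Y (x, y) - 1 / N)\<^sup>2) = (\<Sum>x\<in>{0..<int N}. (fejer J (x - x0) (nat (Y - y)) - 1 / N)\<^sup>2)"
      by (simp add: pole_def)
    also have "\<dots> \<le> ?f (nat (Y - y))" using y by (intro fejer_square_sum J) auto
    finally show "(\<Sum>x\<in>{0..<int N}. (pole J x0 Y (x, y) - 1 / N)\<^sup>2) \<le> ?f (nat (Y - y))" .
  qed
  also have "\<dots> = (\<Sum>d\<in>{1..nat (Y - 1)}. ?f d)"
    by (rule sum.reindex_bij_witness[of _ "\<lambda>d. Y - int d" "\<lambda>y. nat (Y - y)"]) (use True in auto)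
  also have "\<dots> \<le> 4 * harm (2 * N)"
    unfolding sum_distrib_left[symmetric] using sum_inverse_shift_le[where D = "nat (Y - 1)" and M = "2 * N"] by simp
  finally show ?thesis .
next
  case False
  then show ?thesis by (simp add: above_slab harm_nonneg)
qed

lemma above_split:
  assumes "0 \<le> K" "lower_part N K \<subseteq> A"
  shows "upper A 0 = upper (lower_part N K) 0 \<union> upper A K" "upper (lower_part N K) 0 \<inter> upper A K = {}"
  using assms lower_part_mono[of 0 K] by (auto simp: upper_def)

lemma sum_above_split:
  fixes f :: "site \<Rightarrow> real"
  assumes "A \<in> idla_states N" "0 \<le> K" "lower_part N K \<subseteq> A"
  shows "(\<Sum>z\<in>upper A 0. f z) = (\<Sum>z\<in>upper (lower_part N K) 0. f z) + (\<Sum>z\<in>upper A K. f z)"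
  unfolding above_split(1)[OF assms(2,3)]
  by (rule sum.union_disjoint) (auto simp: finite_above[OF assms(1,2)] finite_slab_set above_split(2)[OF assms(2,3)])

lemma card_above_split:
  assumes "A \<in> idla_states N" "0 \<le> K" "lower_part N K \<subseteq> A"
  shows "card (upper A 0) = N * nat K + card (upper A K)"
proof -
  have "real (card (upper A 0)) = real (card (upper (lower_part N K) 0)) + real (card (upper A K))"
    using sum_above_split[OF assms, of "\<lambda>_. 1"] by simp
  then show ?thesis using card_slab[OF assms(2)] by linarith
qed

lemma sum_new_sites:
  fixes f :: "site \<Rightarrow> real"
  assumes A0: "A0 \<in> idla_states N" and A: "A \<in> set_pmf (idla A0 n)"
  shows "(\<Sum>z\<in>A - A0. f z) = (\<Sum>z\<in>upper A 0. f z) - (\<Sum>z\<in>upper A0 0. f z)"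
proof -
  have "lower_part N 0 \<subseteq> A0" using A0 by (simp add: idla_states_iff)
  then have "A - A0 = upper A 0 - upper A0 0" "upper A0 0 \<subseteq> upper A 0"
    using set_idla(1)[OF A0 A] by (auto simp: upper_def)
  then show ?thesis
    by (simp add: sum_diff finite_above[OF set_idla_state[OF A0 A]])
qed

lemma card_above_idla:
  assumes A0: "A0 \<in> idla_states N" and A: "A \<in> set_pmf (idla A0 n)"
  shows "card (upper A 0) = card (upper A0 0) + n"
proof -
  have "real (card (upper A 0)) = real (card (upper A0 0)) + real n"
    using sum_new_sites[OF A0 A, of "\<lambda>_. 1"] set_idla(3)[OF A0 A] by simp
  then show ?thesis by linarith
qed

text \<open>Extended by zero above the level of its pole, the kernel stays subharmonic away from the pole.\<close>

lemma start_exit_delta_pole: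
  assumes A: "A \<in> idla_states N" and x0: "x0 \<in> {0..<int N}" and Y: "0 \<le> Y" and hole: "(x0, Y) \<notin> A"
  shows "1 / N \<le> measure_pmf.expectation (start_exit A) (pole N x0 Y)"
proof -
  have J: "1 \<le> N" "N \<le> N" using N3 by auto
  have "(\<Sum>x\<in>{0..<int N}. pole N x0 Y (x, 0)) / N \<le> measure_pmf.expectation (start_exit A) (pole N x0 Y)"
  proof (rule start_exit_subharmonic[OF domain_state[OF A]])
    show "\<bar>pole N x0 Y z\<bar> \<le> 1" for z using pole_nonneg[OF J] pole_le_1[OF J] by simp
    show "pole N x0 Y z \<le> nb_avg (pole N x0 Y) z" if z: "z \<in> A" for z
    proof (cases "snd z < Y")
      case True
      then show ?thesis by (simp add: pole_harmonic)
    next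
      case False
      have "pole N x0 Y z = 0"
      proof (cases "snd z = Y")
        case True
        have "fst z \<in> {0..<int N}" using z A by (auto simp: idla_states_iff cylinder_def)
        moreover have "fst z \<noteq> x0" using hole z True by (metis prod.collapse)
        ultimately have "\<not> int N dvd (fst z - x0)"
          using x0 zdvd_imp_le[of "int N" "\<bar>fst z - x0\<bar>"] by auto
        then show ?thesis using True by (simp add: pole_def fejer_delta)
      qed (use False in \<open>simp add: pole_def\<close>)
      then show ?thesis using pole_nonneg[OF J] by (simp add: nb_avg_def)
    qed
  qed
  then show ?thesis by (simp add: pole_level_sum[OF J Y])
qed

text \<open>The pole sits at the hole. The filled slab contributes \<open>0\<close>, and each site
  above it contributes \<open>- 1 / N\<close> since the kernel vanishes there, so the martingale is
  \<open>- w\<close> up to the initial share \<open>e\<close>. Halving and reversing the sign gives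
  a \<open>\<xi>\<close> of size at most \<open>1 / 2\<close> with nonpositive drift while the hole
  persists.\<close>

lemma hole_probability:
  fixes n K :: nat
  assumes A0: "A0 \<in> idla_states N" and x0: "x0 \<in> {0..<int N}"
  defines "g0 \<equiv> card (upper A0 0)"
  defines "w \<equiv> real (g0 + n) / N - real K"
  assumes e: "- e \<le> (\<Sum>z\<in>upper A0 0. pole N x0 (int K + 1) z - 1 / N)"
  shows "measure_pmf.prob (idla A0 n) {A. lower_part N (int K) \<subseteq> A \<and> (x0, int K + 1) \<notin> A}
    \<le> exp (- (w / 3 - e / 2 - 2 * harm (2 * N)))"
proof (cases "w \<ge> 0")
  case w0: True
  have J: "1 \<le> N" "N \<le> N" using N3 by auto
  have N0: "real N > 0" using N3 by simp
  let ?Y = "int K + 1"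
  let ?p = "pole N x0 ?Y"
  define \<xi> where "\<xi> z = (1 / N - ?p z) / 2" for z
  show ?thesis
  proof (rule exponential_bound[OF A0, where C = "\<lambda>A. (x0, ?Y) \<notin> A" and \<xi> = \<xi>])
    show "\<bar>\<xi> z\<bar> \<le> 1 / 2" for z
    proof -
      have "0 \<le> 1 / real N" "1 / real N \<le> 1" using N3 by auto
      then have "\<bar>?p z - 1 / N\<bar> \<le> 1" using pole_nonneg[OF J, of x0 ?Y z] pole_le_1[OF J, of x0 ?Y z] by linarith
      then show ?thesis by (simp add: \<xi>_def)
    qed
    show "measure_pmf.expectation (start_exit A) \<xi> \<le> 0" if A: "A \<in> idla_states N" "(x0, ?Y) \<notin> A" for A
    proof -
      have "integrable (start_exit A) ?p" using pole_nonneg[OF J] pole_le_1[OF J]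
        by (intro integrable_bounded_pmf[where B = 1]) auto
      then have "measure_pmf.expectation (start_exit A) \<xi> = (1 / N - measure_pmf.expectation (start_exit A) ?p) / 2"
        unfolding \<xi>_def by simp
      then show ?thesis using start_exit_delta_pole[OF A(1) x0 _ A(2)] by simp
    qed
    fix A assume A: "A \<in> set_pmf (idla A0 n)" and E: "A \<in> {A. lower_part N (int K) \<subseteq> A \<and> (x0, int K + 1) \<notin> A}"
    have AS: "A \<in> idla_states N" by (rule set_idla_state[OF A0 A])
    have L: "0 \<le> int K" "lower_part N (int K) \<subseteq> A" using E by auto
    have off: "?p z = 0" if z: "z \<in> upper A (int K)" for z
    proof -
      have zc: "fst z \<in> {0..<int N}" and zK: "snd z > int K" and zA: "z \<in> A"
        using z AS by (auto simp: upper_def idla_states_iff cylinder_def lower_part_def)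
      show ?thesis
      proof (cases "snd z = ?Y")
        case True
        then have "fst z \<noteq> x0" using E zA by (metis (mono_tags, lifting) mem_Collect_eq prod.collapse)
        then have "\<not> int N dvd (fst z - x0)"
          using x0 zc zdvd_imp_le[of "int N" "\<bar>fst z - x0\<bar>"] by auto
        then show ?thesis using True by (simp add: pole_def fejer_delta)
      qed (use zK in \<open>simp add: pole_def\<close>)
    qed
    have cardK: "real (card (upper A (int K))) = N * w"
    proof -
      have "real (card (upper A 0)) = real N * K + card (upper A (int K))" using card_above_split[OF AS L] by simp
      moreover have "real (card (upper A 0)) = g0 + n" using card_above_idla[OF A0 A] by (simp add: g0_def)
      ultimately show ?thesis using N0 by (simp add: w_def field_simps)
    qed
    have "(\<Sum>z\<in>A - A0. ?p z - 1 / N) = (\<Sum>z\<in>upper A 0. ?p z - 1 / N) - (\<Sum>z\<in>upper A0 0. ?p z - 1 / N)"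
      by (rule sum_new_sites[OF A0 A])
    also have "(\<Sum>z\<in>upper A 0. ?p z - 1 / N) = - w"
    proof -
      have "(\<Sum>z\<in>upper A 0. ?p z - 1 / N) = (\<Sum>z\<in>upper (lower_part N (int K)) 0. ?p z - 1 / N) + (\<Sum>z\<in>upper A (int K). ?p z - 1 / N)"
        by (rule sum_above_split[OF AS L])
      also have "(\<Sum>z\<in>upper (lower_part N (int K)) 0. ?p z - 1 / N) = 0"
        using pole_slab_sum[OF J, of "int K" ?Y x0] N0 card_slab[of "int K"] by (simp add: sum_subtractf)
      also have "(\<Sum>z\<in>upper A (int K). ?p z - 1 / N) = - w"
        using off cardK N0 by simp
      finally show ?thesis by simp
    qed
    finally have "w - e \<le> - (\<Sum>z\<in>A - A0. ?p z - 1 / N)" using e by simp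
    then have s1: "(\<Sum>z\<in>A - A0. \<xi> z) \<ge> (w - e) / 2"
      unfolding \<xi>_def sum_divide_distrib[symmetric] by (simp add: sum_negf[symmetric])
    have "(\<Sum>z\<in>A - A0. (?p z - 1 / N)\<^sup>2) \<le> (\<Sum>z\<in>upper A 0. (?p z - 1 / N)\<^sup>2)"
      unfolding sum_new_sites[OF A0 A, of "\<lambda>z. (?p z - 1 / N)\<^sup>2"] by (simp add: sum_nonneg)
    also have "\<dots> = (\<Sum>z\<in>upper (lower_part N (int K)) 0. (?p z - 1 / N)\<^sup>2) + (\<Sum>z\<in>upper A (int K). (?p z - 1 / N)\<^sup>2)"
      by (rule sum_above_split[OF AS L])
    also have "(\<Sum>z\<in>upper A (int K). (?p z - 1 / N)\<^sup>2) = w / N"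
      using off cardK N0 by (simp add: power2_eq_square)
    also have "(\<Sum>z\<in>upper (lower_part N (int K)) 0. (?p z - 1 / N)\<^sup>2) \<le> 4 * harm (2 * N)"
      using pole_slab_square_sum[OF J, where Y = ?Y and ?x0.0 = x0] by simp
    finally have "(\<Sum>z\<in>A - A0. (?p z - 1 / N)\<^sup>2) \<le> 4 * harm (2 * N) + w / N" by simp
    \<comment> \<open>After the factors in \<open>\<xi>\<close> this part costs
      \<open>w / 6\<close>, which leaves \<open>w / 3\<close> of the linear term
      \<open>w / 2\<close>.\<close>
    also have "w / N \<le> w / 3" using N3 w0 by (intro divide_left_mono) auto
    finally have s2: "(\<Sum>z\<in>A - A0. (\<xi> z)\<^sup>2) \<le> (4 * harm (2 * N) + w / 3) / 4"
      unfolding \<xi>_def by (simp add: power_divide sum_divide_distrib[symmetric] power2_commute[of "1 / real N"])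
    from s1 s2 have "w / 3 - e / 2 - 2 * harm (2 * N) \<le> (\<Sum>z\<in>A - A0. \<xi> z) - 2 * (\<Sum>z\<in>A - A0. (\<xi> z)\<^sup>2)"
      by (simp add: field_simps)
    then show "(x0, ?Y) \<notin> A \<and> w / 3 - e / 2 - 2 * harm (2 * N) \<le> (\<Sum>z\<in>A - A0. \<xi> z) - 2 * (\<Sum>z\<in>A - A0. (\<xi> z)\<^sup>2)"
      using E by simp
  qed auto
next
  case False
  \<comment> \<open>For negative \<open>w\<close> there are too few sites to fill \<open>K\<close>
    levels.\<close>
  have "measure_pmf.prob (idla A0 n) {A. lower_part N (int K) \<subseteq> A \<and> (x0, int K + 1) \<notin> A} = 0"
  proof -
    have "A \<notin> {A. lower_part N (int K) \<subseteq> A \<and> (x0, int K + 1) \<notin> A}" if A: "A \<in> set_pmf (idla A0 n)" for A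
    proof
      assume "A \<in> {A. lower_part N (int K) \<subseteq> A \<and> (x0, int K + 1) \<notin> A}"
      then have L: "lower_part N (int K) \<subseteq> A" by simp
      have "N * K \<le> g0 + n"
        using card_above_split[OF set_idla_state[OF A0 A] _ L] card_above_idla[OF A0 A] by (simp add: g0_def)
      then have "real N * real K \<le> real (g0 + n)" by (metis of_nat_le_iff of_nat_mult)
      then show False using False N3 by (simp add: w_def field_simps)
    qed
    then show ?thesis by (auto simp: measure_pmf_zero_iff)
  qed
  then show ?thesis by simp
qed

lemma filled_level_hole:
  assumes A: "A \<in> idla_states N"
  obtains x0 where "x0 \<in> {0..<int N}" "(x0, int (filled_level N A) + 1) \<notin> A"
proof -
  let ?k = "filled_level N A"
  have "lower_part N (int ?k) \<subseteq> A" using filled_iff[OF A, of ?k] by simp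
  moreover have "\<not> lower_part N (int (Suc ?k)) \<subseteq> A" using filled_iff[OF A, of "Suc ?k"] by simp
  ultimately obtain z where "z \<in> lower_part N (int ?k + 1)" "z \<notin> lower_part N (int ?k)" "z \<notin> A"
    by (auto simp: add.commute)
  then have "fst z \<in> {0..<int N}" "z = (fst z, int ?k + 1)" "z \<notin> A"
    by (auto simp: lower_part_def cylinder_def prod_eq_iff)
  then show ?thesis using that by metis
qed

section \<open>Exponential tail of the normalized number of sites above the filled level\<close>

definition excess :: "site set \<Rightarrow> real" where
  "excess A = real (card (upper A (int (filled_level N A)))) / N"

lemma excess_idla:
  assumes A0: "A0 \<in> idla_states N" and A: "A \<in> set_pmf (idla A0 n)"
  shows "excess A = real (card (upper A0 0) + n) / N - real (filled_level N A)"
proof -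
  have AS: "A \<in> idla_states N" by (rule set_idla_state[OF A0 A])
  have "lower_part N (int (filled_level N A)) \<subseteq> A" using filled_iff[OF AS, of "filled_level N A"] by simp
  from card_above_split[OF AS _ this] card_above_idla[OF A0 A]
  have "real (card (upper A0 0) + n) = real N * filled_level N A + card (upper A (int (filled_level N A)))"
    by (metis nat_int of_nat_0_le_iff of_nat_add of_nat_mult)
  then show ?thesis using N3 by (simp add: excess_def field_simps)
qed

text \<open>A union bound over the filled level \<open>K\<close> and the column of a hole just above
  it. By volume, excess at least \<open>W\<close> means \<open>K \<le> c - W\<close>, and the
  probabilities decay geometrically in \<open>c - K\<close>, so the number of levels costs only a
  constant.\<close>

lemma excess_tail:
  assumes A0: "A0 \<in> idla_states N" and W: "0 \<le> W"
  shows "\<forall>\<^sub>F n in sequentially. measure_pmf.prob (idla A0 n) {A. W \<le> excess A}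
    \<le> 5 * N * exp (1 / 2 + 2 * harm (2 * N)) * exp (- (W / 4))"
proof -
  define g0 where "g0 = card (upper A0 0)"
  have N0: "real N > 0" using N3 by simp
  have J: "1 \<le> N" "N \<le> N" using N3 by auto
  obtain h where h: "0 \<le> h" "\<And>z. z \<in> A0 \<Longrightarrow> snd z \<le> h" using states_height_bound[OF A0] by blast
  show ?thesis
    unfolding eventually_sequentially
  proof (intro exI allI impI)
    \<comment> \<open>This makes \<open>c\<close> at least \<open>h + 8 * g0\<close>, so that
      \<open>K\<close> below \<open>h + 2 * g0\<close> forces
      \<open>c - K \<ge> 6 * g0\<close>.\<close>
    fix n assume n: "N * (nat h + 8 * g0) \<le> n"
    define c where "c = real (g0 + n) / N"
    define M where "M = \<lfloor>c - W\<rfloor>"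
    let ?E = "\<lambda>p. {A. lower_part N (int (fst p)) \<subseteq> A \<and> (snd p, int (fst p) + 1) \<notin> A}"
    let ?I = "{K. real K \<le> c - W} \<times> {0..<int N}"
    have KM: "{K. real K \<le> c - W} = {K. int K \<le> M}" by (auto simp: M_def le_floor_iff)
    have finK: "finite {K. real K \<le> c - W}" unfolding KM by (rule finite_subset[of _ "{..nat M}"]) auto
    have p1: "measure_pmf.prob (idla A0 n) (?E (K, x)) \<le> exp (1 / 2 + 2 * harm (2 * N)) * exp (- ((c - K) / 4))"
      if K: "real K \<le> c - W" and x: "x \<in> {0..<int N}" for K x
    proof -
      let ?p = "pole N x (int K + 1)"
      define e where "e = - (\<Sum>z\<in>upper A0 0. ?p z - 1 / N)"
      \<comment> \<open>High poles lie at depth at least \<open>2 * g0\<close> above each initial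
        site, which costs at most \<open>1 / g0\<close> per site. For low poles the trivial
        \<open>e \<le> g0\<close> is absorbed by \<open>(c - K) / 12\<close>; the rate drops from
        \<open>1 / 3\<close> to \<open>1 / 4\<close>.\<close>
      have ec: "e / 2 \<le> 1 / 2 + (c - K) / 12"
      proof (cases "nat h + 2 * g0 \<le> K")
        case True
        have "1 / N - ?p z \<le> 1 / g0" if z: "z \<in> upper A0 0" for z
        proof -
          have g0: "g0 > 0" using z finite_above[OF A0, of 0] by (auto simp: g0_def card_gt_0_iff)
          have zh: "snd z \<le> h" using z h(2) by (auto simp: upper_def)
          define d where "d = nat (int K + 1 - snd z)"
          have d: "2 * g0 \<le> d" using True zh h(1) g0 by (simp add: d_def)
          have "1 / N - ?p z \<le> 2 * (1 / d - 1 / real (d + 2 * N))"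
            using fejer_deviation[OF J, of d "fst z - x"] d g0 True zh h(1) by (simp add: pole_def flip: d_def) linarith
          also have "\<dots> \<le> 2 * (1 / d)" by simp
          also have "\<dots> \<le> 2 * (1 / (2 * g0))" using d g0 by (intro mult_left_mono divide_left_mono) auto
          finally show ?thesis by simp
        qed
        then have "e \<le> (\<Sum>z\<in>upper A0 0. 1 / g0)" unfolding e_def sum_negf[symmetric] by (intro sum_mono) simp
        also have "\<dots> \<le> 1" by (simp add: g0_def)
        finally have "e \<le> 1" .
        moreover have "0 \<le> (c - K) / 12" using K W by simp
        ultimately show ?thesis by linarith
      next
        case False
        have "e \<le> (\<Sum>z\<in>upper A0 0. 1)"
          unfolding e_def sum_negf[symmetric]
        proof (rule sum_mono)
          fix z
          have "1 / real N \<le> 1" using N3 by simp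
          then show "- (?p z - 1 / N) \<le> 1" using pole_nonneg[OF J, of x "int K + 1" z] by linarith
        qed
        then have e: "e \<le> g0" by (simp add: g0_def)
        have "real N * (real (nat h) + 8 * real g0) \<le> real (g0 + n)"
          using n by (metis (mono_tags) of_nat_add of_nat_le_iff of_nat_mult of_nat_numeral trans_le_add2)
        then have "real (nat h) + 8 * real g0 \<le> c" using N0 by (simp add: c_def field_simps)
        moreover have "real K \<le> real (nat h) + 2 * real g0" using False by linarith
        ultimately have "6 * real g0 \<le> c - K" by linarith
        then have "6 * real g0 / 12 \<le> (c - K) / 12" by (intro divide_right_mono) auto
        then show ?thesis using e by linarith
      qed
      have "measure_pmf.prob (idla A0 n) (?E (K, x)) \<le> exp (- ((c - K) / 3 - e / 2 - 2 * harm (2 * N)))"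
        using hole_probability[OF A0 x, of e K n] by (simp add: e_def c_def g0_def)
      also have "\<dots> \<le> exp (1 / 2 + 2 * harm (2 * N) + (- ((c - K) / 4)))"
      proof -
        have "e / 2 \<le> 1 / 2 + y / 12 \<Longrightarrow> - (y / 3 - e / 2 - q) \<le> 1 / 2 + q + (- (y / 4))" for y q :: real
          by linarith
        from this[OF ec] show ?thesis unfolding exp_le_cancel_iff .
      qed
      finally show ?thesis by (simp only: exp_add)
    qed
    \<comment> \<open>The ratio \<open>exp (- 1 / 4)\<close> is at most \<open>4 / 5\<close>, whence
      the factor \<open>5\<close>.\<close>
    have geo: "(\<Sum>K\<in>{K. real K \<le> c - W}. exp (- ((c - K) / 4))) \<le> 5 * exp (- (W / 4))"
    proof (cases "0 \<le> M")
      case True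
      have q: "exp (- (1 / 4)) \<le> (4 / 5 :: real)"
      proof -
        have "5 / 4 \<le> exp (1 / 4 :: real)" using exp_ge_add_one_self[of "1 / 4 :: real"] by simp
        then show ?thesis by (simp add: exp_minus field_simps)
      qed
      have MW: "W \<le> c - real (nat M)" using True by (simp add: M_def) linarith
      have "{K. real K \<le> c - W} = {..nat M}" unfolding KM using True by auto
      then have "(\<Sum>K\<in>{K. real K \<le> c - W}. exp (- ((c - K) / 4))) = (\<Sum>K\<le>nat M. exp (- ((c - K) / 4)))" by simp
      also have "\<dots> = (\<Sum>i\<le>nat M. exp (- ((c - real (nat M)) / 4)) * exp (- (1 / 4)) ^ i)"
      proof (rule sum.reindex_bij_witness[of _ "\<lambda>i. nat M - i" "\<lambda>i. nat M - i"])
        fix K assume "K \<in> {..nat M}"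
        then have "real (nat M - K) = real (nat M) - K" by (simp add: of_nat_diff)
        then have "exp (- (1 / 4)) ^ (nat M - K) = exp (- ((real (nat M) - K) / 4))"
          by (simp add: exp_of_nat_mult[symmetric])
        then show "exp (- ((c - real (nat M)) / 4)) * exp (- (1 / 4)) ^ (nat M - K) = exp (- ((c - K) / 4))"
          by (simp add: exp_add[symmetric] diff_divide_distrib)
      qed auto
      also have "\<dots> \<le> exp (- (W / 4)) * (\<Sum>i\<le>nat M. (4 / 5) ^ i)"
        unfolding sum_distrib_left using MW q by (intro sum_mono mult_mono power_mono) auto
      also have "(\<Sum>i\<le>nat M. (4 / 5 :: real) ^ i) \<le> 5"
        by (subst sum_gp0) simp
      finally show ?thesis by (simp add: mult.commute)
    next
      case False
      then have "{K. real K \<le> c - W} = {}" unfolding KM by auto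
      then show ?thesis by (simp only: sum.empty) simp
    qed
    have "measure_pmf.prob (idla A0 n) {A. W \<le> excess A} \<le> measure_pmf.prob (idla A0 n) (\<Union>p\<in>?I. ?E p)"
    proof -
      have "A \<in> (\<Union>p\<in>?I. ?E p)" if A: "A \<in> set_pmf (idla A0 n)" and E: "W \<le> excess A" for A
      proof -
        have AS: "A \<in> idla_states N" by (rule set_idla_state[OF A0 A])
        let ?K = "filled_level N A"
        obtain x0 where x0: "x0 \<in> {0..<int N}" "(x0, int ?K + 1) \<notin> A" using filled_level_hole[OF AS] by blast
        have "lower_part N (int ?K) \<subseteq> A" using filled_iff[OF AS, of ?K] by simp
        moreover have "real ?K \<le> c - W" using E excess_idla[OF A0 A] by (simp add: c_def g0_def)
        ultimately show ?thesis using x0 by (intro UN_I[of "(?K, x0)"]) auto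
      qed
      then show ?thesis
        by (intro measure_pmf.finite_measure_mono_AE AE_pmfI) auto
    qed
    also have "\<dots> \<le> (\<Sum>p\<in>?I. measure_pmf.prob (idla A0 n) (?E p))"
      using finK by (intro measure_pmf.finite_measure_subadditive_finite) auto
    also have "\<dots> \<le> (\<Sum>p\<in>?I. exp (1 / 2 + 2 * harm (2 * N)) * exp (- ((c - fst p) / 4)))"
      by (intro sum_mono) (use p1 in auto)
    also have "\<dots> = N * exp (1 / 2 + 2 * harm (2 * N)) * (\<Sum>K\<in>{K. real K \<le> c - W}. exp (- ((c - K) / 4)))"
      unfolding sum.cartesian_product' by (simp add: sum_distrib_left mult_ac)
    also have "\<dots> \<le> N * exp (1 / 2 + 2 * harm (2 * N)) * (5 * exp (- (W / 4)))"
      by (rule mult_left_mono[OF geo]) simp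
    finally show "measure_pmf.prob (idla A0 n) {A. W \<le> excess A} \<le> 5 * N * exp (1 / 2 + 2 * harm (2 * N)) * exp (- (W / 4))"
      by (simp add: mult_ac)
  qed
qed

end

section \<open>Thin tentacles\<close>

text \<open>The probability that simple random walk on the integers is at \<open>u\<close> after
  \<open>j\<close> steps. The guard \<open>0 \<le> int j + u\<close> keeps \<open>nat\<close> from
  mapping negative indices to \<open>0\<close>.\<close>

definition srw1 :: "nat \<Rightarrow> int \<Rightarrow> real" where
  "srw1 j u = (if even (int j + u) \<and> 0 \<le> int j + u then real (j choose nat ((int j + u) div 2)) / 2 ^ j else 0)"

lemma srw1_Suc: "srw1 (Suc j) u = (srw1 j (u - 1) + srw1 j (u + 1)) / 2"
proof (cases "even (int j + u + 1)")
  case True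
  then obtain k where k: "int j + u + 1 = 2 * k" by blast
  then have u: "u = 2 * k - int j - 1" by simp
  consider "k < 0" | "k = 0" | i where "k = int (Suc i)"
    by (metis int_cases not_less_iff_gr_or_eq of_nat_0_less_iff gr0_implies_Suc less_linear negative_zless_0 of_nat_less_0_iff zero_less_imp_eq_int)
  then show ?thesis
  proof cases
    case 1
    then show ?thesis by (simp add: srw1_def u)
  next
    case 2
    then show ?thesis by (simp add: srw1_def u)
  next
    case 3
    have "nat ((2 + 2 * int i) div 2) = Suc i" by simp
    then show ?thesis using 3 by (simp add: srw1_def u field_simps)
  qed
next
  case False
  then show ?thesis by (simp add: srw1_def)
qed

text \<open>The central probability is multiplied by \<open>(2 * i + 1) / (2 * i + 2)\<close> at
  each step, and \<open>(2 * i + 1) * (2 * i + 3) \<le> (2 * i + 2)^2\<close> makes the whole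
  expression nonincreasing.\<close>

lemma central_binomial_le: "(real (2 * i choose i) / 4 ^ i)\<^sup>2 * (2 * real i + 1) \<le> 1"
proof (induction i)
  case (Suc i)
  define c where "c = real (2 * i choose i) / 4 ^ i"
  have key: "real (2 * Suc i choose Suc i) * (real i + 1) = real (2 * i choose i) * (2 * (2 * real i + 1))"
  proof -
    have "real (2 * Suc i choose Suc i) = fact (2 * Suc i) / (fact (Suc i) * fact (Suc i))"
      by (subst binomial_fact) (auto simp: numeral_2_eq_2)
    also have "\<dots> = (2 * real i + 2) * (2 * real i + 1) * fact (2 * i) / ((real i + 1) * fact i * ((real i + 1) * fact i))"
      by (simp add: algebra_simps)
    also have "\<dots> * (real i + 1) = fact (2 * i) / (fact i * fact i) * (2 * (2 * real i + 1))"
    proof -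
      have "2 * x * y * F / (x * f * (x * f)) * x = F / (f * f) * (2 * y)" if "f > 0" "x > 0" for F f x y :: real
        using that by (simp add: field_simps)
      from this[of "fact i" "real i + 1" "2 * real i + 1" "fact (2 * i)"]
      show ?thesis by (simp add: distrib_left)
    qed
    also have "fact (2 * i) / (fact i * fact i) = real (2 * i choose i)"
      by (subst binomial_fact) (auto simp: mult_2)
    finally show ?thesis .
  qed
  have gen: "b' / (4 * p) = b / p * (y / (2 * x))" if "b' * x = b * (2 * y)" "x > 0" "p > 0" for b' b x y p :: real
    using that by (simp add: field_simps)
  have "real (2 * Suc i choose Suc i) / (4 * 4 ^ i) = c * ((2 * real i + 1) / (2 * (real i + 1)))"
    unfolding c_def by (rule gen[OF key]) auto
  then have "real (2 * Suc i choose Suc i) / 4 ^ Suc i = c * ((2 * real i + 1) / (2 * real i + 2))"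
    by (simp only: power_Suc distrib_left mult_1_right)
  then have "(real (2 * Suc i choose Suc i) / 4 ^ Suc i)\<^sup>2 * (2 * real (Suc i) + 1)
      = c\<^sup>2 * (2 * real i + 1) * ((2 * real i + 1) * (2 * real i + 3) / (2 * real i + 2)\<^sup>2)"
    by (simp add: power_mult_distrib power_divide power2_eq_square add.commute)
  also have "\<dots> \<le> 1 * 1"
  proof (rule mult_mono)
    show "c\<^sup>2 * (2 * real i + 1) \<le> 1" using Suc by (simp add: c_def)
    have "(2 * real i + 1) * (2 * real i + 3) \<le> (2 * real i + 2)\<^sup>2" by (simp add: power2_eq_square algebra_simps)
    then show "(2 * real i + 1) * (2 * real i + 3) / (2 * real i + 2)\<^sup>2 \<le> 1" by (simp add: divide_le_eq_1)
  qed auto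
  finally show ?case by simp
qed simp

lemma srw1_le: "srw1 (2 * i) u \<le> real (2 * i choose i) / 4 ^ i"
proof -
  have "real (2 * i choose k) \<le> real (2 * i choose i)" for k
    using binomial_maximum[of "2 * i" k] by simp
  then show ?thesis by (auto simp: srw1_def power_mult divide_right_mono)
qed

lemma srw1_nonneg: "0 \<le> srw1 j u"
  by (simp add: srw1_def)

text \<open>In the coordinates \<open>x + y\<close> and \<open>x - y\<close> the planar walk is a pair of independent walks.\<close>

definition srw2 :: "nat \<Rightarrow> int \<times> int \<Rightarrow> real" where
  "srw2 j z = srw1 j (fst z + snd z) * srw1 j (fst z - snd z)"

lemma srw2_Suc: "srw2 (Suc j) (x, y) = (srw2 j (x + 1, y) + srw2 j (x - 1, y) + srw2 j (x, y + 1) + srw2 j (x, y - 1)) / 4"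
  unfolding srw2_def srw1_Suc by (simp add: algebra_simps)

lemma srw2_nonneg: "0 \<le> srw2 j z"
  by (simp add: srw2_def srw1_nonneg)

lemma srw2_0: "srw2 0 (0, 0) = 1"
  by (simp add: srw2_def srw1_def)

lemma srw2_le: "srw2 (2 * i) z \<le> 1 / (2 * real i + 1)"
proof -
  have "srw2 (2 * i) z \<le> (real (2 * i choose i) / 4 ^ i) * (real (2 * i choose i) / 4 ^ i)"
    unfolding srw2_def by (intro mult_mono srw1_le srw1_nonneg) auto
  also have "\<dots> \<le> 1 / (2 * real i + 1)"
    using central_binomial_le[of i] by (subst pos_le_divide_eq) (auto simp: power2_eq_square)
  finally show ?thesis .
qed

context cyl
begin

definition lift :: "site \<Rightarrow> int \<times> int \<Rightarrow> site" where
  "lift z p = ((fst z + fst p) mod int N, snd z + snd p)"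

text \<open>The projection of a planar square of radius \<open>R\<close>, so that planar walk
  estimates can be transferred to the cylinder.\<close>

definition sqr :: "site \<Rightarrow> int \<Rightarrow> site set" where
  "sqr z R = lift z ` ({- R..R} \<times> {- R..R})"

lemma finite_sqr: "finite (sqr z R)"
  by (simp add: sqr_def)

lemma move_lift: "move N (lift z p) d = lift z (fst p + fst d, snd p + snd d)"
  by (simp add: move_def lift_def mod_simps add.assoc)

lemma lift_0: "z \<in> cylinder N \<Longrightarrow> lift z (0, 0) = z"
  by (auto simp: lift_def cylinder_def)

lemma sqr_mono: "r \<le> R \<Longrightarrow> sqr z r \<subseteq> sqr z R"
  unfolding sqr_def by (intro image_mono) auto

lemma sqr_center: "z \<in> cylinder N \<Longrightarrow> 0 \<le> R \<Longrightarrow> z \<in> sqr z R"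
  unfolding sqr_def by (rule image_eqI[of _ _ "(0, 0)"]) (auto simp: lift_0)

lemma sqr_trans:
  assumes "w \<in> sqr v r" "v \<in> sqr z R"
  shows "w \<in> sqr z (R + r)"
proof -
  obtain a b where ab: "w = lift v (a, b)" "\<bar>a\<bar> \<le> r" "\<bar>b\<bar> \<le> r" using assms(1) by (auto simp: sqr_def abs_le_iff)
  obtain c d where cd: "v = lift z (c, d)" "\<bar>c\<bar> \<le> R" "\<bar>d\<bar> \<le> R" using assms(2) by (auto simp: sqr_def abs_le_iff)
  have "w = lift z (c + a, d + b)" unfolding ab cd by (simp add: lift_def mod_simps add.assoc)
  then show ?thesis unfolding sqr_def using ab cd by (intro image_eqI[of _ _ "(c + a, d + b)"]) auto
qed

lemma sqr_sym:
  assumes "w \<in> sqr v r" "v \<in> cylinder N"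
  shows "v \<in> sqr w r"
proof -
  obtain a b where ab: "w = lift v (a, b)" "\<bar>a\<bar> \<le> r" "\<bar>b\<bar> \<le> r" using assms(1) by (auto simp: sqr_def abs_le_iff)
  have "lift w (- a, - b) = lift v (0, 0)" unfolding ab by (auto simp: lift_def mod_diff_left_eq)
  then show ?thesis unfolding sqr_def using ab lift_0[OF assms(2)] by (intro image_eqI[of _ _ "(- a, - b)"]) auto
qed

lemma move_sqr: "d \<in> set_pmf step_pmf \<Longrightarrow> move N w d \<in> sqr w 1"
  unfolding sqr_def by (rule image_eqI[of _ _ d]) (auto simp: move_def lift_def set_step_pmf)

text \<open>Within \<open>2 * i\<close> steps the walk leaves the square with probability at most
  \<open>2 * i / \<rho>^2\<close>, by its second moment. Otherwise it either settles inside or is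
  still on an occupied site of the square at time \<open>2 * i\<close>, and each such site has heat
  kernel at most \<open>1 / (2 * i + 1)\<close>.\<close>

lemma escape_probability:
  assumes A: "A \<in> idla_states N" and v: "v \<in> cylinder N" and \<rho>: "1 \<le> \<rho>" "2 * \<rho> < int N"
  shows "measure_pmf.prob (exit_law A v) (- sqr v \<rho>) \<le> 2 * real i / (of_int \<rho>)\<^sup>2 + real (card (A \<inter> sqr v \<rho>)) / (2 * real i + 1)"
proof -
  define f where "f z = measure_pmf.prob (exit_law A z) (- sqr v \<rho>)" for z
  define T where "T = {p \<in> {- \<rho>..\<rho>} \<times> {- \<rho>..\<rho>}. lift v p \<in> A}"
  have finT: "finite T" unfolding T_def by simp
  have rho0: "(of_int \<rho> :: real)\<^sup>2 > 0" using \<rho> by simp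
  have f_le: "f z \<le> 1" for z by (simp add: f_def)
  have f_step: "f z = nb_avg f z" if "z \<in> A" for z
  proof -
    have e: "f u = measure_pmf.expectation (exit_law A u) (indicat_real (- sqr v \<rho>))" for u by (simp add: f_def)
    show ?thesis unfolding e
      by (rule expectation_exit_step[OF domain_state[OF A] that, where B = 1]) (auto simp: indicator_def)
  qed
  \<comment> \<open>Both terms solve the discrete heat equation: averaging \<open>x^2 + y^2\<close>
    over neighbours adds \<open>1\<close>, matching the step of \<open>j\<close>, and
    \<open>srw2\<close> averages to its successor. Off the square the first term is at least
    \<open>1\<close>, and on empty sites of the square \<open>f\<close> is \<open>0\<close>.\<close>
  have main: "f (lift v (x, y)) \<le> (real_of_int x ^ 2 + real_of_int y ^ 2 + real j) / (of_int \<rho>)\<^sup>2 + (\<Sum>t\<in>T. srw2 j (fst t - x, snd t - y))" for j x y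
  proof (induction j arbitrary: x y)
    have out: "f (lift v (x, y)) \<le> (real_of_int x ^ 2 + real_of_int y ^ 2 + real j) / (of_int \<rho>)\<^sup>2 + (\<Sum>t\<in>T. srw2 j (fst t - x, snd t - y))"
      if xy: "\<not> (\<bar>x\<bar> \<le> \<rho> \<and> \<bar>y\<bar> \<le> \<rho>) \<or> lift v (x, y) \<notin> A" for x y j
    proof (cases "\<bar>x\<bar> \<le> \<rho> \<and> \<bar>y\<bar> \<le> \<rho>")
      case True
      then have "lift v (x, y) \<in> sqr v \<rho>" by (auto simp: sqr_def abs_le_iff)
      moreover have "lift v (x, y) \<notin> A" using True xy by simp
      ultimately have "f (lift v (x, y)) = 0" by (simp add: f_def exit_law_outside)
      then show ?thesis by (simp add: sum_nonneg srw2_nonneg)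
    next
      case False
      have "(of_int \<rho> :: real)\<^sup>2 \<le> real_of_int x ^ 2 + real_of_int y ^ 2"
      proof (cases "\<bar>x\<bar> \<le> \<rho>")
        case True
        then have "real_of_int \<rho> \<le> \<bar>real_of_int y\<bar>" using False by linarith
        then have "(real_of_int \<rho>)\<^sup>2 \<le> \<bar>real_of_int y\<bar>\<^sup>2" using \<rho> by (intro power_mono) auto
        then show ?thesis by (simp add: add_increasing)
      next
        case False
        then have "real_of_int \<rho> \<le> \<bar>real_of_int x\<bar>" by linarith
        then have "(real_of_int \<rho>)\<^sup>2 \<le> \<bar>real_of_int x\<bar>\<^sup>2" using \<rho> by (intro power_mono) auto
        then show ?thesis by (simp add: add_increasing2)
      qed
      then have "1 \<le> (real_of_int x ^ 2 + real_of_int y ^ 2 + real j) / (of_int \<rho>)\<^sup>2" using rho0 by (simp add: field_simps)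
      moreover have "0 \<le> (\<Sum>t\<in>T. srw2 j (fst t - x, snd t - y))" by (simp add: sum_nonneg srw2_nonneg)
      ultimately show ?thesis using f_le[of "lift v (x, y)"] by linarith
    qed
    {
      case 0
      show ?case
      proof (cases "\<not> (\<bar>x\<bar> \<le> \<rho> \<and> \<bar>y\<bar> \<le> \<rho>) \<or> lift v (x, y) \<notin> A")
        case False
        then have "(x, y) \<in> T" by (auto simp: T_def abs_le_iff)
        then have "srw2 0 (fst (x, y) - x, snd (x, y) - y) \<le> (\<Sum>t\<in>T. srw2 0 (fst t - x, snd t - y))"
          using finT by (intro member_le_sum srw2_nonneg) auto
        then have "1 \<le> (\<Sum>t\<in>T. srw2 0 (fst t - x, snd t - y))" by (simp add: srw2_0)
        moreover have "0 \<le> (real_of_int x ^ 2 + real_of_int y ^ 2 + real 0) / (of_int \<rho>)\<^sup>2" by simp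
        ultimately show ?thesis using f_le[of "lift v (x, y)"] by linarith
      qed (use out[of x y 0] in simp)
    next
      case (Suc j)
      show ?case
      proof (cases "\<not> (\<bar>x\<bar> \<le> \<rho> \<and> \<bar>y\<bar> \<le> \<rho>) \<or> lift v (x, y) \<notin> A")
        case False
        let ?S = "\<lambda>x y. \<Sum>t\<in>T. srw2 j (fst t - x, snd t - y)"
        let ?q = "\<lambda>x y. (real_of_int x ^ 2 + real_of_int y ^ 2 + real j) / (of_int \<rho>)\<^sup>2"
        have "f (lift v (x, y)) = nb_avg f (lift v (x, y))" using False by (intro f_step) simp
        also have "\<dots> = (f (lift v (x + 1, y)) + f (lift v (x - 1, y)) + f (lift v (x, y + 1)) + f (lift v (x, y - 1))) / 4"
          by (simp add: nb_avg_def move_lift)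
        also have "\<dots> \<le> ((?q (x + 1) y + ?S (x + 1) y) + (?q (x - 1) y + ?S (x - 1) y)
            + (?q x (y + 1) + ?S x (y + 1)) + (?q x (y - 1) + ?S x (y - 1))) / 4"
          by (intro divide_right_mono add_mono Suc.IH) simp
        also have "\<dots> = (?q (x + 1) y + ?q (x - 1) y + ?q x (y + 1) + ?q x (y - 1)) / 4
            + (?S (x + 1) y + ?S (x - 1) y + ?S x (y + 1) + ?S x (y - 1)) / 4" by (simp add: add_divide_distrib)
        also have "(?q (x + 1) y + ?q (x - 1) y + ?q x (y + 1) + ?q x (y - 1)) / 4
            = (real_of_int x ^ 2 + real_of_int y ^ 2 + real (Suc j)) / (of_int \<rho>)\<^sup>2"
        proof -
          have num: "(real_of_int (x + 1) ^ 2 + real_of_int y ^ 2 + real j) + (real_of_int (x - 1) ^ 2 + real_of_int y ^ 2 + real j)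
              + (real_of_int x ^ 2 + real_of_int (y + 1) ^ 2 + real j) + (real_of_int x ^ 2 + real_of_int (y - 1) ^ 2 + real j)
              = 4 * (real_of_int x ^ 2 + real_of_int y ^ 2 + real (Suc j))"
            by (simp add: power2_eq_square algebra_simps)
          have q: "4 * X / r / 4 = X / r" for X r :: real by simp
          show ?thesis unfolding add_divide_distrib[symmetric] num q ..
        qed
        also have "(?S (x + 1) y + ?S (x - 1) y + ?S x (y + 1) + ?S x (y - 1)) / 4
            = (\<Sum>t\<in>T. srw2 (Suc j) (fst t - x, snd t - y))"
          unfolding srw2_Suc sum.distrib[symmetric] sum_divide_distrib
          by (intro sum.cong) (auto simp: algebra_simps)
        finally show ?thesis .
      qed (use out[of x y "Suc j"] in simp)
    }
  qed
  \<comment> \<open>The projection is injective on the planar square because its width is below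
    \<open>N\<close>.\<close>
  have cT: "card T \<le> card (A \<inter> sqr v \<rho>)"
  proof (rule card_inj_on_le[of "lift v"])
    show "inj_on (lift v) T"
    proof (rule inj_onI)
      fix p q assume pq: "p \<in> T" "q \<in> T" "lift v p = lift v q"
      then have "(fst v + fst p) mod int N = (fst v + fst q) mod int N" and s: "snd p = snd q" by (auto simp: lift_def)
      then have "int N dvd (fst p - fst q)" by (simp add: mod_eq_dvd_iff)
      moreover have "\<bar>fst p - fst q\<bar> < int N" using pq \<rho> by (auto simp: T_def)
      ultimately have "fst p = fst q" using zdvd_imp_le[of "int N" "\<bar>fst p - fst q\<bar>"] by (cases "fst p = fst q") auto
      with s show "p = q" by (simp add: prod_eq_iff)
    qed
    show "lift v ` T \<subseteq> A \<inter> sqr v \<rho>" by (auto simp: T_def sqr_def)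
  qed (simp add: finite_sqr)
  have "f v \<le> 2 * real i / (of_int \<rho>)\<^sup>2 + (\<Sum>t\<in>T. srw2 (2 * i) (fst t - 0, snd t - 0))"
    using main[of 0 0 "2 * i"] lift_0[OF v] by simp
  also have "(\<Sum>t\<in>T. srw2 (2 * i) (fst t - 0, snd t - 0)) \<le> (\<Sum>t\<in>T. 1 / (2 * real i + 1))"
    by (intro sum_mono srw2_le)
  also have "\<dots> = real (card T) / (2 * real i + 1)" by simp
  also have "\<dots> \<le> real (card (A \<inter> sqr v \<rho>)) / (2 * real i + 1)" using cT by (intro divide_right_mono) auto
  finally show ?thesis by (simp add: f_def)
qed

text \<open>Taking \<open>i = 2 * k^2\<close> gives \<open>4 * k^2 / (64 * k)^2 = 1 / 1024\<close>;
  thinness bounds the count by \<open>k^2 / 256\<close>, which yields the second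
  \<open>1 / 1024\<close>.\<close>

lemma thin_escape:
  assumes A: "A \<in> idla_states N" and v: "v \<in> cylinder N" and k: "1 \<le> k" "128 * k < N"
    and thin: "2 ^ 20 * card (A \<inter> sqr v (int (64 * k))) \<le> (64 * k)\<^sup>2"
  shows "measure_pmf.prob (exit_law A v) (- sqr v (int (64 * k))) \<le> 1 / 512"
proof -
  let ?c = "real (card (A \<inter> sqr v (int (64 * k))))"
  have k0: "real k > 0" using k by simp
  have "measure_pmf.prob (exit_law A v) (- sqr v (int (64 * k)))
      \<le> 2 * real (2 * k\<^sup>2) / (of_int (int (64 * k)))\<^sup>2 + ?c / (2 * real (2 * k\<^sup>2) + 1)"
    using k by (intro escape_probability[OF A v]) auto
  also have "2 * real (2 * k\<^sup>2) / (of_int (int (64 * k)))\<^sup>2 = 1 / 1024"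
    using k0 by (simp add: power2_eq_square)
  also have "?c / (2 * real (2 * k\<^sup>2) + 1) \<le> 1 / 1024"
  proof -
    have "real (2 ^ 20 * card (A \<inter> sqr v (int (64 * k)))) \<le> real ((64 * k)\<^sup>2)" using thin by (simp only: of_nat_le_iff)
    then have "1048576 * ?c \<le> 4096 * (real k)\<^sup>2" by (simp add: power_mult_distrib)
    then show ?thesis by (simp add: field_simps power2_eq_square)
  qed
  finally show ?thesis by simp
qed

lemma prob_start_exit:
  "measure_pmf.prob (start_exit A) S = (\<Sum>x\<in>{0..<int N}. measure_pmf.prob (exit_law A (x, 0)) S) / N"
  using expectation_start_exit[where f = "indicat_real S" and B = 1] by (simp add: indicator_def)

text \<open>To settle in the inner square the walk must first enter the middle one. At that moment
  it is more than \<open>64 * k\<close> from the inner square, and by thinness it settles within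
  \<open>64 * k\<close> with probability at least \<open>511 / 512\<close>: inside the outer square,
  outside the inner one.\<close>

lemma inner_exit_probability:
  assumes A: "A \<in> idla_states N" and k: "1 \<le> k" "128 * k < N" and r: "0 \<le> r"
    and thin: "2 ^ 20 * card (A \<inter> sqr z0 (r + 2 * int (64 * k) + 1)) \<le> (64 * k)\<^sup>2"
    and far: "level N 0 \<inter> sqr z0 (r + 2 * int (64 * k) + 1) = {}"
  shows "measure_pmf.prob (start_exit A) (sqr z0 r) \<le> measure_pmf.prob (start_exit A) (sqr z0 (r + 2 * int (64 * k) + 1)) / 256"
proof -
  let ?\<rho> = "int (64 * k)"
  \<comment> \<open>The \<open>+ 1\<close> accounts for the entrance step: a site of
    \<open>?M\<close> adjacent to its complement is outside \<open>sqr z0 (r + ?\<rho>)\<close>, and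
    its square of radius \<open>?\<rho>\<close> is still inside \<open>?O\<close>.\<close>
  let ?I = "sqr z0 r" and ?M = "sqr z0 (r + ?\<rho> + 1)" and ?O = "sqr z0 (r + 2 * ?\<rho> + 1)"
  define D where "D = A - ?M"
  have D: "domain D" by (rule domain_mono[OF domain_state[OF A]]) (auto simp: D_def)
  define h where "h S z = measure_pmf.prob (exit_law A z) S" for S z
  define g where "g z = h ?I z - h ?O z / 256" for z
  \<comment> \<open>Cutting the positive part of \<open>g\<close> off outside \<open>D\<close> keeps
    it subharmonic, since \<open>g \<le> 0\<close> at every neighbour outside \<open>D\<close>.
    Stopping on leaving \<open>D\<close> then takes the place of the strong Markov property.\<close>
  define G where "G z = (if z \<in> D then max (g z) 0 else 0)" for z
  have h_step: "h S z = nb_avg (h S) z" if "z \<in> A" for S z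
  proof -
    have e: "h S u = measure_pmf.expectation (exit_law A u) (indicat_real S)" for u by (simp add: h_def)
    show ?thesis unfolding e
      by (rule expectation_exit_step[OF domain_state[OF A] that, where B = 1]) (auto simp: indicator_def)
  qed
  have g_step: "g z = nb_avg g z" if "z \<in> A" for z
    using h_step[OF that, of ?I] h_step[OF that, of ?O] by (simp add: g_def nb_avg_def field_simps)
  have AC: "A \<subseteq> cylinder N" using A by (simp add: idla_states_iff)
  have g_bdd: "\<bar>g z\<bar> \<le> 1" for z
  proof -
    have "0 \<le> h ?I z" "h ?I z \<le> 1" "0 \<le> h ?O z" "h ?O z \<le> 1" by (auto simp: h_def)
    then show ?thesis by (simp add: g_def abs_le_iff)
  qed
  have nbr: "g w' \<le> G w'" if w: "w \<in> D" and d: "d \<in> set_pmf step_pmf" and w': "w' = move N w d" for w w' d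
  proof (cases "w' \<in> D")
    case True
    then show ?thesis by (simp add: G_def)
  next
    case False
    have w'c: "w' \<in> cylinder N" unfolding w' by (rule move_cylinder)
    have wc: "w \<in> cylinder N" "w \<notin> ?M" using w AC by (auto simp: D_def)
    have adj: "w' \<in> sqr w 1" unfolding w' by (rule move_sqr[OF d])
    have adj': "w \<in> sqr w' 1" by (rule sqr_sym[OF adj wc(1)])
    have "g w' \<le> 0"
    proof (cases "w' \<in> A")
      case False
      have "w' \<notin> ?I"
      proof
        assume "w' \<in> ?I"
        then have "w \<in> sqr z0 (r + 1)" by (rule sqr_trans[OF adj'])
        then show False using wc(2) sqr_mono[of "r + 1" "r + ?\<rho> + 1" z0] by auto
      qed
      then have "h ?I w' = 0" using False by (simp add: h_def exit_law_outside)
      then show ?thesis by (simp add: g_def h_def)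
    next
      case True
      then have w'M: "w' \<in> ?M" using False by (simp add: D_def)
      have w'n: "w' \<notin> sqr z0 (r + ?\<rho>)"
        using sqr_trans[OF adj', of z0 "r + ?\<rho>"] wc(2) by auto
      have sub: "sqr w' ?\<rho> \<subseteq> ?O"
        using sqr_trans[OF _ w'M, of _ ?\<rho>] by (auto simp: algebra_simps)
      have "card (A \<inter> sqr w' ?\<rho>) \<le> card (A \<inter> ?O)"
        using sub finite_sqr by (intro card_mono) auto
      then have esc: "h (- sqr w' ?\<rho>) w' \<le> 1 / 512"
        unfolding h_def using thin by (intro thin_escape[OF A w'c k]) (meson le_trans mult_le_mono2)
      have "h ?I w' \<le> h (- sqr w' ?\<rho>) w'"
        unfolding h_def
      proof (rule measure_pmf.finite_measure_mono)
        show "?I \<subseteq> - sqr w' ?\<rho>"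
        proof
          fix z assume z: "z \<in> ?I"
          show "z \<in> - sqr w' ?\<rho>"
          proof
            assume "z \<in> sqr w' ?\<rho>"
            from sqr_trans[OF sqr_sym[OF this w'c] z] w'n show False by simp
          qed
        qed
      qed simp
      moreover have "1 - h (- sqr w' ?\<rho>) w' \<le> h ?O w'"
      proof -
        have "1 - h (- sqr w' ?\<rho>) w' = h (sqr w' ?\<rho>) w'"
          unfolding h_def using measure_pmf.prob_compl[of "sqr w' ?\<rho>" "exit_law A w'"] by (simp add: Compl_eq_Diff_UNIV)
        also have "\<dots> \<le> h ?O w'" unfolding h_def using sub by (intro measure_pmf.finite_measure_mono) auto
        finally show ?thesis .
      qed
      ultimately show ?thesis using esc by (simp add: g_def)
    qed
    then show ?thesis using False by (simp add: G_def)
  qed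
  have nbr0: "0 \<le> G z" for z by (simp add: G_def)
  have gu: "g u \<le> 0" if u: "u \<in> level N 0" for u
  proof -
    have "?M \<subseteq> ?O" by (rule sqr_mono) simp
    then have uD: "u \<in> D" using u far level0_subset[OF A] by (auto simp: D_def)
    have "g u \<le> G u" using uD by (simp add: G_def)
    also have "\<dots> \<le> measure_pmf.expectation (exit_law D u) G"
    proof (rule optional_stopping[OF D])
      show "\<bar>G z\<bar> \<le> 1" for z using g_bdd[of z] by (auto simp: G_def)
      show "G z \<le> nb_avg G z" if z: "z \<in> D" for z
      proof -
        have zA: "z \<in> A" using z by (simp add: D_def)
        have "nb_avg g z \<le> nb_avg G z"
          unfolding nb_avg_def using nbr[OF z _ refl] by (intro divide_right_mono add_mono) (auto simp: set_step_pmf)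
        moreover have "0 \<le> nb_avg G z" unfolding nb_avg_def using nbr0 by simp
        ultimately show ?thesis using g_step[OF zA] z by (simp add: G_def)
      qed
    qed
    also have "\<dots> = measure_pmf.expectation (exit_law D u) (\<lambda>_. 0)"
      using set_exit_law(1)[OF D] by (intro integral_cong_AE AE_pmfI) (auto simp: G_def)
    finally show ?thesis by simp
  qed
  have "(\<Sum>x\<in>{0..<int N}. h ?I (x, 0)) / N \<le> (\<Sum>x\<in>{0..<int N}. h ?O (x, 0) / 256) / N"
    using gu by (intro divide_right_mono sum_mono) (auto simp: g_def level_def)
  then show ?thesis unfolding prob_start_exit by (simp add: h_def sum_divide_distrib[symmetric] mult.commute)
qed

text \<open>A new site gets weight \<open>128\<close> in the inner square and \<open>1 / 2\<close>
  in the rest of the outer one. The mean weight is at most \<open>1\<close> because inner landings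
  are \<open>256\<close> times rarer than outer ones, and the product is \<open>256\<close> to the
  inner count over \<open>2\<close> to the outer count.\<close>

lemma inner_count_tail:
  assumes A0: "A0 \<in> idla_states N" and k: "1 \<le> k" "128 * k < N" and r: "0 \<le> r"
    and a: "2 ^ 20 * a \<le> (64 * k)\<^sup>2"
    and far: "A0 \<inter> sqr z0 (r + 2 * int (64 * k) + 1) = {}"
  shows "measure_pmf.prob (idla A0 n) {A. card (A \<inter> sqr z0 (r + 2 * int (64 * k) + 1)) \<le> a \<and> b \<le> card (A \<inter> sqr z0 r)}
    \<le> 2 ^ a / 256 ^ b"
proof -
  let ?I = "sqr z0 r" and ?O = "sqr z0 (r + 2 * int (64 * k) + 1)"
  have IO: "?I \<subseteq> ?O" using r by (intro sqr_mono) auto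
  define \<phi> :: "site \<Rightarrow> real" where "\<phi> z = (if z \<in> ?I then 256 else 1) * (if z \<in> ?O then 1 / 2 else 1)" for z
  have farl: "level N 0 \<inter> ?O = {}" using far level0_subset[OF A0] by auto
  have "measure_pmf.prob (idla A0 n) {A. card (A \<inter> ?O) \<le> a \<and> b \<le> card (A \<inter> ?I)} \<le> 1 / (256 ^ b / 2 ^ a)"
  proof (rule multiplicative_bound[OF A0, where \<phi> = \<phi> and C = "\<lambda>A. card (A \<inter> ?O) \<le> a"])
    show "0 \<le> \<phi> z" for z by (simp add: \<phi>_def)
    show "card (A \<inter> ?O) \<le> a" if "card (insert z A \<inter> ?O) \<le> a" for A z
    proof -
      have "card (A \<inter> ?O) \<le> card (insert z A \<inter> ?O)" using finite_sqr by (intro card_mono) auto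
      then show ?thesis using that by simp
    qed
    show "(\<integral>\<^sup>+z. ennreal (\<phi> z) \<partial>start_exit A) \<le> 1" if A: "A \<in> idla_states N" "card (A \<inter> ?O) \<le> a" for A
    proof -
      let ?\<psi> = "\<lambda>z. 1 - indicat_real ?O z / 2 + 128 * indicat_real ?I z"
      have ind: "integrable (start_exit A) (indicat_real S)" for S by (rule integrable_bounded_pmf[where B = 1]) (auto simp: indicator_def)
      have "2 ^ 20 * card (A \<inter> ?O) \<le> (64 * k)\<^sup>2" using a A(2) by (meson le_trans mult_le_mono2)
      from inner_exit_probability[OF A(1) k r this farl]
      have p: "measure_pmf.prob (start_exit A) ?I \<le> measure_pmf.prob (start_exit A) ?O / 256" .
      have "(\<integral>\<^sup>+z. ennreal (\<phi> z) \<partial>start_exit A) \<le> (\<integral>\<^sup>+z. ennreal (?\<psi> z) \<partial>start_exit A)"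
        using IO by (intro nn_integral_mono ennreal_leI) (auto simp: \<phi>_def indicator_def)
      also have "\<dots> = ennreal (measure_pmf.expectation (start_exit A) ?\<psi>)"
        by (intro nn_integral_eq_integral integrable_bounded_pmf[where B = 200]) (auto simp: indicator_def)
      also have "measure_pmf.expectation (start_exit A) ?\<psi>
          = 1 - measure_pmf.prob (start_exit A) ?O / 2 + 128 * measure_pmf.prob (start_exit A) ?I"
        using ind by simp
      also have "ennreal \<dots> \<le> ennreal 1" using p by (intro ennreal_leI) simp
      finally show ?thesis by simp
    qed
    fix A assume A: "A \<in> set_pmf (idla A0 n)" and E: "A \<in> {A. card (A \<inter> ?O) \<le> a \<and> b \<le> card (A \<inter> ?I)}"
    have fin: "finite (A - A0)" by (rule set_idla(2)[OF A0 A])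
    have i: "(A - A0) \<inter> ?I = A \<inter> ?I" "(A - A0) \<inter> ?O = A \<inter> ?O" using far IO by auto
    have "(\<Prod>z\<in>A - A0. \<phi> z) = (\<Prod>z\<in>A - A0. if z \<in> ?I then 256 else 1) * (\<Prod>z\<in>A - A0. if z \<in> ?O then 1 / 2 else 1)"
      unfolding \<phi>_def by (rule prod.distrib)
    also have "\<dots> = 256 ^ card (A \<inter> ?I) * (1 / 2) ^ card (A \<inter> ?O)"
    proof -
      have "(\<Prod>z\<in>A - A0. if z \<in> S then c else 1) = c ^ card ((A - A0) \<inter> S)" for c :: real and S
        using fin by (simp add: prod.If_cases)
      then show ?thesis by (simp only: i)
    qed
    also have "\<dots> \<ge> 256 ^ b * (1 / 2) ^ a"
      using E by (intro mult_mono power_increasing power_decreasing) auto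
    finally show "card (A \<inter> ?O) \<le> a \<and> 256 ^ b / 2 ^ a \<le> (\<Prod>z\<in>A - A0. \<phi> z)"
      using E by (simp add: power_divide)
  qed auto
  then show ?thesis by simp
qed

text \<open>Particles settle next to the existing cluster, which initially misses the square.
  Reaching the center therefore requires a site in each of the \<open>R\<close> concentric shells
  besides the center itself.\<close>

lemma connected_count:
  assumes A0: "A0 \<in> idla_states N" and A: "A \<in> set_pmf (idla A0 n)" and far: "A0 \<inter> sqr z0 (int R) = {}"
    and z0: "z0 \<in> A"
  shows "R < card (A \<inter> sqr z0 (int R))"
proof -
  \<comment> \<open>The first particle to land in \<open>sqr z0 r\<close> is adjacent to an older
    site, which lies outside \<open>sqr z0 r\<close> but within radius \<open>r + 1\<close>.\<close>
  have shell: "A \<inter> (sqr z0 (r + 1) - sqr z0 r) \<noteq> {}" if "0 \<le> r" "r < int R" "A \<inter> sqr z0 r \<noteq> {}" for r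
    using A that(3)
  proof (induction n arbitrary: A)
    case 0
    have "sqr z0 r \<subseteq> sqr z0 (int R)" using that by (intro sqr_mono) auto
    then show ?case using 0 far by auto
  next
    case (Suc n)
    then obtain B z where B: "B \<in> set_pmf (idla A0 n)" and z: "z \<in> set_pmf (start_exit B)" and AB: "A = insert z B"
      by (auto simp: grow_def)
    have BS: "B \<in> idla_states N" by (rule set_idla_state[OF A0 B])
    show ?case
    proof (cases "B \<inter> sqr z0 r = {}")
      case False
      then show ?thesis using Suc.IH[OF B] AB by auto
    next
      case True
      then have zr: "z \<in> sqr z0 r" using Suc.prems AB by auto
      obtain w d where w: "w \<in> B" "d \<in> set_pmf step_pmf" "z = move N w d"
        using set_start_exit_state(3)[OF BS z] by blast
      have wc: "w \<in> cylinder N" using w BS by (auto simp: idla_states_iff)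
      have "w \<in> sqr z 1" using move_sqr[OF w(2), of w] w(3) by (intro sqr_sym[OF _ wc]) simp
      then have "w \<in> sqr z0 (r + 1)" by (rule sqr_trans[OF _ zr])
      then show ?thesis using w(1) True AB by auto
    qed
  qed
  have z0c: "z0 \<in> cylinder N" using z0 set_idla_state[OF A0 A] by (auto simp: idla_states_iff)
  have "j < card (A \<inter> sqr z0 (int j))" if "j \<le> R" for j
    using that
  proof (induction j)
    case 0
    have "A \<inter> sqr z0 0 \<noteq> {}" using z0 sqr_center[OF z0c, of 0] by auto
    then show ?case using finite_sqr[of z0 0] by (simp add: card_gt_0_iff)
  next
    case (Suc j)
    then have IH: "j < card (A \<inter> sqr z0 (int j))" by simp
    then have "A \<inter> sqr z0 (int j) \<noteq> {}" by auto
    then obtain w where w: "w \<in> A" "w \<in> sqr z0 (int j + 1)" "w \<notin> sqr z0 (int j)"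
      using shell[of "int j"] Suc.prems by auto
    have "insert w (A \<inter> sqr z0 (int j)) \<subseteq> A \<inter> sqr z0 (int (Suc j))"
      using w sqr_mono[of "int j" "int (Suc j)" z0] by (auto simp: add.commute)
    then have "card (insert w (A \<inter> sqr z0 (int j))) \<le> card (A \<inter> sqr z0 (int (Suc j)))"
      using finite_sqr by (intro card_mono) auto
    then show ?case using w IH finite_sqr by simp
  qed
  then show ?thesis by simp
qed

text \<open>Nested squares with radii decreasing from \<open>4 ^ s\<close> to about \<open>4 ^ s / 2\<close>: each time the gap halves,
  the number of occupied sites is divided by four, so that thinness at the scale of the gap persists.\<close>

lemma tentacle:
  assumes A0: "A0 \<in> idla_states N" and s: "12 \<le> s" and sN: "2 * 4 ^ s < N"
    and far: "A0 \<inter> sqr z0 (4 ^ s) = {}"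
  shows "measure_pmf.prob (idla A0 n) {A. z0 \<in> A \<and> card (A \<inter> sqr z0 (4 ^ s)) \<le> 2 ^ (4 * s - 26)} \<le> s * (1 / 2) ^ (4 ^ s)"
proof -
  \<comment> \<open>The dyadic part makes consecutive radii differ by \<open>2 * 64 * k i\<close>,
    and \<open>- i\<close> supplies the \<open>+ 1\<close> of each gap. The count \<open>a i\<close>
    is \<open>(64 * k i)^2 / 2^20\<close>, exactly the permitted thinness.\<close>
  define R where "R i = (2 ^ (2 * s - 1) + 2 ^ (2 * s - 1 - i) - int i :: int)" for i :: nat
  define a where "a i = (2 ^ (4 * s - 26 - 2 * i) :: nat)" for i
  \<comment> \<open>Before this index \<open>a i\<close> is at least \<open>4 ^ s\<close>, so every
    exceptional event is tiny. At \<open>I\<close> the count is \<open>2 ^ (2 * s - 2)\<close>,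
    below the radius, which connectedness excludes.\<close>
  define I where "I = s - 12"
  define k where "k i = (2 ^ (2 * s - 9 - i) :: nat)" for i
  have R0: "R 0 = 4 ^ s"
  proof -
    have "(2 :: int) ^ (2 * s - 1) + 2 ^ (2 * s - 1) = 2 ^ Suc (2 * s - 1)" by simp
    also have "Suc (2 * s - 1) = 2 * s" using s by simp
    finally show ?thesis by (simp add: R_def power_mult)
  qed
  have RS: "R i = R (Suc i) + 2 * int (64 * k i) + 1" if "i < I" for i
  proof -
    define e where "e = 2 * s - 9 - i"
    have e: "2 * s - 1 - i = e + 8" "2 * s - 1 - Suc i = e + 7" using that s by (auto simp: I_def e_def)
    show ?thesis unfolding R_def k_def e e_def[symmetric] power_add by simp
  qed
  have Rmono: "R i \<le> R 0" if "i \<le> I" for i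
    using that
  proof (induction i)
    case (Suc i)
    then have "R i \<le> R 0" "R i = R (Suc i) + 2 * int (64 * k i) + 1" using RS[of i] by auto
    then show ?case by simp
  qed simp
  have Rpos: "2 ^ (2 * s - 1) \<le> R i" if "i \<le> I" for i
  proof -
    have "i < 2 ^ i" by (rule less_exp)
    also have "(2 :: nat) ^ i \<le> 2 ^ (2 * s - 1 - i)" using that s by (intro power_increasing) (auto simp: I_def)
    finally have "int i \<le> 2 ^ (2 * s - 1 - i)" by (metis less_imp_le of_nat_le_iff of_nat_numeral of_nat_power)
    then show ?thesis by (simp add: R_def)
  qed
  define E where "E i = {A. card (A \<inter> sqr z0 (R i)) \<le> a i \<and> a (Suc i) \<le> card (A \<inter> sqr z0 (R (Suc i)))}" for i
  have farR: "A0 \<inter> sqr z0 (R i) = {}" if "i \<le> I" for i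
    using far sqr_mono[OF Rmono[OF that], of z0] by (auto simp: R0)
  have pE: "measure_pmf.prob (idla A0 n) (E i) \<le> (1 / 2) ^ (4 ^ s)" if i: "i < I" for i
  proof -
    have a4: "a i = 4 * a (Suc i)"
    proof -
      have "4 * s - 26 - 2 * i = 2 + (4 * s - 26 - 2 * Suc i)" using i s by (simp add: I_def)
      then show ?thesis by (simp add: a_def power_add)
    qed
    have am: "4 ^ s \<le> a i"
    proof -
      have "(2 :: nat) ^ (2 * s) \<le> 2 ^ (4 * s - 26 - 2 * i)" using i s by (intro power_increasing) (auto simp: I_def)
      then show ?thesis by (simp add: a_def power_mult)
    qed
    have k128: "128 * k i < N"
    proof -
      have "128 * k i = 2 ^ (7 + (2 * s - 9 - i))" by (simp add: k_def power_add)
      also have "\<dots> \<le> 2 ^ (2 * s)" using s by (intro power_increasing) auto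
      also have "\<dots> = 4 ^ s" by (simp add: power_mult)
      finally show ?thesis using sN by simp
    qed
    have ak: "2 ^ 20 * a i \<le> (64 * k i)\<^sup>2"
    proof -
      have "64 * k i = 2 ^ (6 + (2 * s - 9 - i))" by (simp add: k_def power_add)
      then have "(64 * k i)\<^sup>2 = 2 ^ ((6 + (2 * s - 9 - i)) * 2)" by (simp only: power_mult)
      also have "(6 + (2 * s - 9 - i)) * 2 = 20 + (4 * s - 26 - 2 * i)" using i s by (simp add: I_def)
      finally show ?thesis by (simp add: a_def power_add)
    qed
    have "measure_pmf.prob (idla A0 n) (E i) \<le> 2 ^ a i / 256 ^ a (Suc i)"
      unfolding E_def RS[OF i]
    proof (rule inner_count_tail[OF A0 _ k128 _ ak])
      show "1 \<le> k i" by (simp add: k_def)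
      show "0 \<le> R (Suc i)" using Rpos[of "Suc i"] i by (intro order_trans[OF _ Rpos]) auto
      show "A0 \<inter> sqr z0 (R (Suc i) + 2 * int (64 * k i) + 1) = {}" using farR[of i] i by (simp add: RS)
    qed
    also have "(256 :: real) ^ a (Suc i) = 2 ^ (8 * a (Suc i))" by (simp add: power_mult)
    also have "8 * a (Suc i) = a i + a i" using a4 by simp
    also have "(2 :: real) ^ a i / 2 ^ (a i + a i) = (1 / 2) ^ a i" by (simp add: power_add power_divide)
    also have "\<dots> \<le> (1 / 2) ^ (4 ^ s)" using am by (intro power_decreasing) auto
    finally show ?thesis .
  qed
  have "A \<in> (\<Union>i\<in>{..<I}. E i)"
    if A: "A \<in> set_pmf (idla A0 n)" and z: "z0 \<in> A" and c: "card (A \<inter> sqr z0 (4 ^ s)) \<le> 2 ^ (4 * s - 26)" for A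
  proof (rule ccontr)
    assume n: "A \<notin> (\<Union>i\<in>{..<I}. E i)"
    have "card (A \<inter> sqr z0 (R i)) \<le> a i" if "i \<le> I" for i
      using that
    proof (induction i)
      case 0
      then show ?case using c by (simp add: a_def R0)
    next
      case (Suc i)
      then show ?case using n by (auto simp: E_def)
    qed
    then have "card (A \<inter> sqr z0 (R I)) \<le> a I" by simp
    moreover have "nat (R I) < card (A \<inter> sqr z0 (R I))"
      using connected_count[OF A0 A _ z, of "nat (R I)"] farR[of I] Rpos[of I] by (simp add: order_trans[OF _ Rpos])
    moreover have "int (a I) \<le> R I"
    proof -
      have "4 * s - 26 - 2 * I = 2 * s - 2" using s by (simp add: I_def)
      then have "int (a I) = 2 ^ (2 * s - 2)" by (simp add: a_def)
      also have "\<dots> \<le> 2 ^ (2 * s - 1)" by (intro power_increasing) auto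
      also have "\<dots> \<le> R I" by (rule Rpos) simp
      finally show ?thesis .
    qed
    ultimately show False by linarith
  qed
  then have "measure_pmf.prob (idla A0 n) {A. z0 \<in> A \<and> card (A \<inter> sqr z0 (4 ^ s)) \<le> 2 ^ (4 * s - 26)}
      \<le> measure_pmf.prob (idla A0 n) (\<Union>i\<in>{..<I}. E i)"
    by (intro measure_pmf.finite_measure_mono_AE AE_pmfI) auto
  also have "\<dots> \<le> (\<Sum>i\<in>{..<I}. measure_pmf.prob (idla A0 n) (E i))"
    by (rule measure_pmf.finite_measure_subadditive_finite) auto
  also have "\<dots> \<le> (\<Sum>i\<in>{..<I}. (1 / 2) ^ (4 ^ s))" by (intro sum_mono pE) simp
  also have "\<dots> \<le> s * (1 / 2) ^ (4 ^ s)" by (simp add: I_def mult_right_mono)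
  finally show ?thesis .
qed

end

section \<open>Height of bulges\<close>

context cyl
begin

lemma idla_height_attained:
  assumes A: "A \<in> idla_states N"
  shows "\<exists>x. (x, idla_height A) \<in> A" "\<And>z. z \<in> A \<Longrightarrow> snd z \<le> idla_height A"
proof -
  define h where "h = Max (insert 0 (snd ` upper A 0))"
  have fin: "finite (upper A 0)" by (rule finite_above[OF A]) simp
  have le: "snd z \<le> h" if "z \<in> A" for z
  proof (cases "z \<in> upper A 0")
    case True
    then show ?thesis unfolding h_def using fin by simp
  next
    case False
    then have "snd z \<le> 0" using that by (auto simp: upper_def lower_part_def)
    also have "0 \<le> h" unfolding h_def using fin by simp
    finally show ?thesis .
  qed
  have ex: "\<exists>x. (x, h) \<in> A"
  proof -
    have "h \<in> insert 0 (snd ` upper A 0)" unfolding h_def using fin by (intro Max_in) auto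
    then show ?thesis
    proof
      assume "h = 0"
      moreover have "(0, 0) \<in> A" using level0_subset[OF A] N3 by (auto simp: level_def)
      ultimately show ?thesis by auto
    next
      assume "h \<in> snd ` upper A 0"
      then show ?thesis by (auto simp: upper_def)
    qed
  qed
  have "idla_height A = h" unfolding idla_height_def using ex le by (intro Greatest_equality) auto
  then show "\<exists>x. (x, idla_height A) \<in> A" "\<And>z. z \<in> A \<Longrightarrow> snd z \<le> idla_height A" using ex le by auto
qed

lemma idla_height_downshift:
  assumes A: "A \<in> idla_states N"
  shows "idla_height (downshift N A) = idla_height A - int (filled_level N A)"
  unfolding idla_height_def[of "downshift N A"]
  using idla_height_attained[OF A] by (intro Greatest_equality) (fastforce simp: downshift_eq mem_vshift_image)+

text \<open>A new site is at most one level above an older one, so growth cannot skip a level above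
  the initial state.\<close>

lemma levels_occupied:
  assumes A0: "A0 \<in> idla_states N" and h0: "\<And>z. z \<in> A0 \<Longrightarrow> snd z \<le> h0"
    and A: "A \<in> set_pmf (idla A0 n)" and z: "z \<in> A" and y: "h0 < y" "y \<le> snd z"
  shows "\<exists>x. (x, y) \<in> A"
  using A z y
proof (induction n arbitrary: A z)
  case 0
  then show ?case using h0[of z] by simp
next
  case (Suc n)
  then obtain B v where B: "B \<in> set_pmf (idla A0 n)" and v: "v \<in> set_pmf (start_exit B)" and AB: "A = insert v B"
    by (auto simp: grow_def)
  have BS: "B \<in> idla_states N" by (rule set_idla_state[OF A0 B])
  obtain w d where w: "w \<in> B" "d \<in> set_pmf step_pmf" "v = move N w d"
    using set_start_exit_state(3)[OF BS v] by blast
  have vw: "snd v \<le> snd w + 1" using w by (auto simp: set_step_pmf)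
  show ?case
  proof (cases "z \<in> B")
    case True
    then show ?thesis using Suc.IH[OF B] Suc.prems AB by blast
  next
    case False
    then have zv: "z = v" using Suc.prems AB by simp
    show ?thesis
    proof (cases "y \<le> snd w")
      case True
      then show ?thesis using Suc.IH[OF B w(1)] Suc.prems AB by blast
    next
      case False
      then have "y = snd v" using Suc.prems vw zv by simp
      then show ?thesis using AB by (metis insertI1 prod.collapse)
    qed
  qed
qed

text \<open>A crude deterministic height bound, used to make the number of candidate pole levels
  polynomial in \<open>N\<close>.\<close>

lemma height_le_count:
  assumes A0: "A0 \<in> idla_states N" and h0: "\<And>z. z \<in> A0 \<Longrightarrow> snd z \<le> h0"
    and A: "A \<in> set_pmf (idla A0 n)" and K: "0 \<le> K" "h0 \<le> K" and z: "z \<in> A"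
  shows "snd z - K \<le> int (card (upper A K))"
proof -
  have "{K<..snd z} \<subseteq> snd ` upper A K"
  proof
    fix y assume y: "y \<in> {K<..snd z}"
    then obtain x where "(x, y) \<in> A" using levels_occupied[OF A0 h0 A z, of y] K by auto
    then show "y \<in> snd ` upper A K" using y by (intro image_eqI[of _ _ "(x, y)"]) (auto simp: upper_def lower_part_def)
  qed
  then have "card {K<..snd z} \<le> card (snd ` upper A K)"
    using finite_above[OF set_idla_state[OF A0 A] K(1)] by (intro card_mono) auto
  also have "\<dots> \<le> card (upper A K)" by (rule card_image_le[OF finite_above[OF set_idla_state[OF A0 A] K(1)]])
  finally show ?thesis by simp
qed

text \<open>The filled slab cancels, leaving the kernel weight of the sites above it minus the
  excess. Since \<open>filled_level\<close> is below \<open>y0 - 4 ^ s\<close>, the whole square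
  counts in that weight; the height condition on \<open>y0\<close> keeps the initial share below
  \<open>1\<close>. As the cluster stays below the pole, the kernel is harmonic on it.\<close>

lemma bulge_probability:
  fixes W :: real and x0 :: int and s :: nat
  assumes A0: "A0 \<in> idla_states N" and h0: "\<And>z. z \<in> A0 \<Longrightarrow> snd z \<le> h0"
    and y0: "0 \<le> y0" "h0 + 2 * int (card (upper A0 0)) \<le> y0" and sN: "64 * 4 ^ s \<le> N"
  defines "E \<equiv> {A. A \<subseteq> lower_part N y0 \<and> excess A < W \<and> int (filled_level N A) < y0 - 4 ^ s \<and> 2 ^ (4 * s - 26) \<le> card (A \<inter> sqr (x0, y0) (4 ^ s))}"
  assumes s: "26 \<le> 4 * s"
  shows "measure_pmf.prob (idla A0 n) E \<le> exp (- ((4 ^ s / 2 ^ 35 - W - 1) / 2 - 2 * harm (2 * N)))"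
proof -
  define m where "m = (4 ^ s :: nat)"
  have m: "1 \<le> m" by (simp add: m_def)
  define J where "J = N div (64 * m)"
  have N0: "real N > 0" using N3 by simp
  have mN: "64 * m \<le> N" using sN by (simp add: m_def)
  have J1: "1 \<le> J" unfolding J_def using mN m by (simp add: Suc_le_eq div_greater_zero_iff)
  have mJ: "64 * m * J \<le> N" unfolding J_def by (rule times_div_less_eq_dividend)
  have JN: "J \<le> N" unfolding J_def by (rule div_le_dividend)
  note J = J1 JN
  have Jlow: "1 / (512 * real m) \<le> real J / (4 * N)"
  proof -
    have "N < 64 * m * (J + 1)" unfolding J_def using m by (simp add: dividend_less_times_div)
    also have "\<dots> \<le> 64 * m * (2 * J)" using J1 by (intro mult_le_mono2) simp
    finally have "real N \<le> real (64 * m * (2 * J))" by (simp only: of_nat_le_iff)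
    then show ?thesis using N0 m by (simp add: field_simps)
  qed
  define Y where "Y = y0 + int m"
  let ?p = "pole J x0 Y"
  define \<xi> where "\<xi> z = (?p z - 1 / N) / 2" for z
  show ?thesis
  proof (rule exponential_bound[OF A0, where C = "\<lambda>A. A \<subseteq> lower_part N (Y - 1)" and \<xi> = \<xi>])
    show "\<bar>\<xi> z\<bar> \<le> 1 / 2" for z
    proof -
      have "0 \<le> 1 / real N" "1 / real N \<le> 1" using N3 by auto
      then have "\<bar>?p z - 1 / N\<bar> \<le> 1" using pole_nonneg[OF J, of x0 Y z] pole_le_1[OF J, of x0 Y z] by linarith
      then show ?thesis by (simp add: \<xi>_def)
    qed
    show "measure_pmf.expectation (start_exit A) \<xi> \<le> 0" if A: "A \<in> idla_states N" "A \<subseteq> lower_part N (Y - 1)" for A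
    proof -
      have ip: "integrable (start_exit A) ?p" using pole_nonneg[OF J] pole_le_1[OF J]
        by (intro integrable_bounded_pmf[where B = 1]) auto
      have "(\<Sum>x\<in>{0..<int N}. - ?p (x, 0)) / N \<le> measure_pmf.expectation (start_exit A) (\<lambda>z. - ?p z)"
      proof (rule start_exit_subharmonic[OF domain_state[OF A(1)]])
        show "\<bar>- ?p z\<bar> \<le> 1" for z using pole_nonneg[OF J] pole_le_1[OF J] by simp
        show "- ?p z \<le> nb_avg (\<lambda>z. - ?p z) z" if z: "z \<in> A" for z
        proof -
          have "snd z < Y" using z A(2) by (auto simp: lower_part_def)
          from pole_harmonic[OF this, of J x0] show ?thesis by (simp add: nb_avg_def)
        qed
      qed
      then have "measure_pmf.expectation (start_exit A) ?p \<le> 1 / N"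
        using y0 by (simp add: sum_negf pole_level_sum[OF J] Y_def)
      moreover have "measure_pmf.expectation (start_exit A) \<xi> = (measure_pmf.expectation (start_exit A) ?p - 1 / N) / 2"
        unfolding \<xi>_def using ip by simp
      ultimately show ?thesis by simp
    qed
    fix A assume A: "A \<in> set_pmf (idla A0 n)" and E: "A \<in> E"
    have AS: "A \<in> idla_states N" by (rule set_idla_state[OF A0 A])
    define K where "K = int (filled_level N A)"
    have L: "0 \<le> K" "lower_part N K \<subseteq> A" unfolding K_def using filled_iff[OF AS, of "filled_level N A"] by auto
    have EA: "A \<subseteq> lower_part N y0" "excess A < W" "K < y0 - int m" "2 ^ (4 * s - 26) \<le> card (A \<inter> sqr (x0, y0) (int m))"
      using E by (auto simp: E_def K_def m_def)
    have AY: "A \<subseteq> lower_part N (Y - 1)" using EA(1) lower_part_mono[of y0 "Y - 1"] m by (auto simp: Y_def)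
    have big: "4 ^ s / 2 ^ 35 \<le> (\<Sum>z\<in>upper A K. ?p z)"
    proof -
      have "(\<Sum>z\<in>A \<inter> sqr (x0, y0) (int m). 1 / (512 * real m)) \<le> (\<Sum>z\<in>A \<inter> sqr (x0, y0) (int m). ?p z)"
      proof (rule sum_mono)
        fix z assume z: "z \<in> A \<inter> sqr (x0, y0) (int m)"
        then obtain a b where ab: "z = lift (x0, y0) (a, b)" "\<bar>a\<bar> \<le> int m" "\<bar>b\<bar> \<le> int m" by (auto simp: sqr_def abs_le_iff)
        have "fejer J (fst z - x0) d = fejer J a d" for d
        proof -
          have "(fst z - x0) mod int N = a mod int N" by (simp add: ab lift_def mod_diff_left_eq)
          then show ?thesis using fejer_periodic[of J "fst z - x0" d] fejer_periodic[of J a d] by simp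
        qed
        then have "?p z = fejer J a (nat (int m - b))" using ab by (simp add: pole_def lift_def Y_def)
        moreover have "real J / (4 * N) \<le> fejer J a (nat (int m - b))"
          using ab by (intro fejer_lower_bound[OF m J1 mJ]) auto
        ultimately show "1 / (512 * real m) \<le> ?p z" using Jlow by simp
      qed
      also have "\<dots> \<le> (\<Sum>z\<in>upper A K. ?p z)"
      proof (rule sum_mono2)
        show "finite (upper A K)" by (rule finite_above[OF AS L(1)])
        show "A \<inter> sqr (x0, y0) (int m) \<subseteq> upper A K"
          using EA(3) by (auto simp: upper_def lower_part_def sqr_def lift_def)
      qed (simp add: pole_nonneg[OF J])
      also have "(\<Sum>z\<in>A \<inter> sqr (x0, y0) (int m). 1 / (512 * real m)) = card (A \<inter> sqr (x0, y0) (int m)) / (512 * real m)"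
        by simp
      finally have *: "card (A \<inter> sqr (x0, y0) (int m)) / (512 * real m) \<le> (\<Sum>z\<in>upper A K. ?p z)" .
      \<comment> \<open>The count \<open>m^2 / 2^26\<close> times the weight
        \<open>1 / (512 * m)\<close> is \<open>m / 2^35\<close>.\<close>
      have "4 ^ s / 2 ^ 35 = (2 ^ (4 * s - 26) :: real) / (512 * real m)"
      proof -
        have "(2 :: real) ^ (4 * s - 26) * 2 ^ 26 = 2 ^ (2 * s) * 2 ^ (2 * s)"
          using s unfolding power_add[symmetric] by (intro arg_cong[where f = "power 2"]) simp
        moreover have "(2 :: real) ^ (2 * s) = 4 ^ s" by (simp add: power_mult)
        ultimately show ?thesis by (simp add: m_def field_simps)
      qed
      also have "\<dots> \<le> card (A \<inter> sqr (x0, y0) (int m)) / (512 * real m)"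
      proof (rule divide_right_mono)
        have "real (2 ^ (4 * s - 26)) \<le> real (card (A \<inter> sqr (x0, y0) (int m)))" using EA(4) by (simp only: of_nat_le_iff)
        then show "(2 :: real) ^ (4 * s - 26) \<le> real (card (A \<inter> sqr (x0, y0) (int m)))" by simp
      qed simp
      finally show ?thesis using * by simp
    qed
    have init: "(\<Sum>z\<in>upper A0 0. ?p z - 1 / N) \<le> 1"
    proof -
      have "?p z - 1 / N \<le> 1 / card (upper A0 0)" if z: "z \<in> upper A0 0" for z
      proof -
        define g0 where "g0 = card (upper A0 0)"
        have g0: "g0 > 0" using z finite_above[OF A0, of 0] by (auto simp: g0_def card_gt_0_iff)
        have zh: "snd z \<le> h0" using z h0 by (auto simp: upper_def)
        define d where "d = nat (Y - snd z)"
        have d: "2 * g0 \<le> d" using zh y0 by (simp add: d_def Y_def g0_def)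
        have "snd z \<le> Y" using zh y0 by (simp add: Y_def)
        then have "?p z - 1 / N \<le> 2 * (1 / d - 1 / real (d + 2 * N))"
          using fejer_deviation[OF J, of d "fst z - x0"] d g0 by (simp add: pole_def flip: d_def)
        also have "\<dots> \<le> 2 * (1 / d)" by simp
        also have "\<dots> \<le> 2 * (1 / (2 * g0))" using d g0 by (intro mult_left_mono divide_left_mono) auto
        finally show ?thesis by (simp add: g0_def)
      qed
      then have "(\<Sum>z\<in>upper A0 0. ?p z - 1 / N) \<le> (\<Sum>z\<in>upper A0 0. 1 / card (upper A0 0))" by (intro sum_mono) simp
      also have "\<dots> \<le> 1" by simp
      finally show ?thesis .
    qed
    have "(\<Sum>z\<in>A - A0. ?p z - 1 / N) = (\<Sum>z\<in>upper A 0. ?p z - 1 / N) - (\<Sum>z\<in>upper A0 0. ?p z - 1 / N)"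
      by (rule sum_new_sites[OF A0 A])
    also have "(\<Sum>z\<in>upper A 0. ?p z - 1 / N) = (\<Sum>z\<in>upper (lower_part N K) 0. ?p z - 1 / N) + (\<Sum>z\<in>upper A K. ?p z - 1 / N)"
      by (rule sum_above_split[OF AS L])
    also have "(\<Sum>z\<in>upper (lower_part N K) 0. ?p z - 1 / N) = 0"
      using pole_slab_sum[OF J L(1), of Y x0] EA(3) N0 L(1) card_slab[of K] by (simp add: sum_subtractf Y_def)
    also have "(\<Sum>z\<in>upper A K. ?p z - 1 / N) = (\<Sum>z\<in>upper A K. ?p z) - excess A"
      by (simp add: sum_subtractf excess_def K_def)
    finally have "4 ^ s / 2 ^ 35 - W - 1 \<le> (\<Sum>z\<in>A - A0. ?p z - 1 / N)" using big init EA(2) by simp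
    then have s1: "(4 ^ s / 2 ^ 35 - W - 1) / 2 \<le> (\<Sum>z\<in>A - A0. \<xi> z)"
      unfolding \<xi>_def sum_divide_distrib[symmetric] by (rule divide_right_mono) simp
    have "(\<Sum>z\<in>A - A0. (?p z - 1 / N)\<^sup>2) \<le> (\<Sum>z\<in>upper A 0. (?p z - 1 / N)\<^sup>2)"
      unfolding sum_new_sites[OF A0 A, of "\<lambda>z. (?p z - 1 / N)\<^sup>2"] by (simp add: sum_nonneg)
    also have "\<dots> \<le> (\<Sum>z\<in>upper (lower_part N (Y - 1)) 0. (?p z - 1 / N)\<^sup>2)"
      using AY by (intro sum_mono2 finite_slab_set) (auto simp: upper_def)
    also have "\<dots> \<le> 4 * harm (2 * N)" by (rule pole_slab_square_sum[OF J])
    finally have s2: "(\<Sum>z\<in>A - A0. (\<xi> z)\<^sup>2) \<le> harm (2 * N)"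
      unfolding \<xi>_def by (simp add: power_divide sum_divide_distrib[symmetric])
    show "A \<subseteq> lower_part N (Y - 1) \<and> (4 ^ s / 2 ^ 35 - W - 1) / 2 - 2 * harm (2 * N) \<le> (\<Sum>z\<in>A - A0. \<xi> z) - 2 * (\<Sum>z\<in>A - A0. (\<xi> z)\<^sup>2)"
    proof -
      have "x / 2 \<le> S \<Longrightarrow> T \<le> h \<Longrightarrow> x / 2 - 2 * h \<le> S - 2 * T" for x S T h :: real by linarith
      from this[OF s1 s2] AY show ?thesis by blast
    qed
  qed auto
qed

text \<open>Either the excess is large, or a topmost site has a thin or a thick neighbourhood of
  radius \<open>4 ^ s\<close>; the last two cases are summed over all possible positions of that
  site.\<close>

lemma height_tail:
  fixes W :: real
  assumes A0: "A0 \<in> idla_states N" and W: "0 \<le> W" and s: "12 \<le> s" and sN: "64 * 4 ^ s \<le> N"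
  shows "\<forall>\<^sub>F n in sequentially. measure_pmf.prob (idla A0 n) {A. 4 ^ s < idla_height A - int (filled_level N A)}
    \<le> 5 * N * exp (1 / 2 + 2 * harm (2 * N)) * exp (- (W / 4))
      + N * (N * W + W + 1) * (s * (1 / 2) ^ (4 ^ s) + exp (- ((4 ^ s / 2 ^ 35 - W - 1) / 2 - 2 * harm (2 * N))))"
proof -
  have N0: "real N > 0" using N3 by simp
  obtain h0 where h0: "0 \<le> h0" "\<And>z. z \<in> A0 \<Longrightarrow> snd z \<le> h0" using states_height_bound[OF A0] by blast
  define g0 where "g0 = card (upper A0 0)"
  \<comment> \<open>From here on \<open>c \<ge> W + h0 + 2 * g0\<close>, so all candidate levels
    above \<open>c - W\<close> satisfy the height condition of the bulge estimate.\<close>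
  define n0 where "n0 = nat \<lceil>N * (W + h0 + 2 * g0)\<rceil>"
  show ?thesis
    using excess_tail[OF A0 W] eventually_ge_at_top[of n0]
  proof eventually_elim
    case (elim n)
    define c where "c = real (g0 + n) / N"
    have c: "W + h0 + 2 * real g0 \<le> c"
    proof -
      have "N * (W + h0 + 2 * g0) \<le> n" using elim(2) unfolding n0_def by linarith
      also have "\<dots> \<le> real (g0 + n)" by simp
      finally show ?thesis using N0 by (simp add: c_def field_simps)
    qed
    \<comment> \<open>With excess below \<open>W\<close> the filled level lies between
      \<open>c - W\<close> and \<open>c\<close>, and the top is at most \<open>N * W\<close> higher
      because \<open>N\<close> times the excess counts the sites above it.\<close>
    define Ys where "Ys = {y :: int. c - W < y \<and> y \<le> c + N * W}"
    have Ys_sub: "Ys \<subseteq> {\<lfloor>c - W\<rfloor> + 1..\<lfloor>c + N * W\<rfloor>}" by (auto simp: Ys_def le_floor_iff) linarith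
    then have finY: "finite Ys" by (rule finite_subset) simp
    have cardY: "real (card Ys) \<le> N * W + W + 1"
    proof -
      have "card Ys \<le> card {\<lfloor>c - W\<rfloor> + 1..\<lfloor>c + N * W\<rfloor>}" using Ys_sub by (intro card_mono) auto
      also have "\<dots> = nat (\<lfloor>c + N * W\<rfloor> - \<lfloor>c - W\<rfloor>)" by simp
      finally have "real (card Ys) \<le> real (nat (\<lfloor>c + N * W\<rfloor> - \<lfloor>c - W\<rfloor>))" by simp
      also have "\<dots> \<le> N * W + W + 1"
      proof -
        have "c - W \<le> c + N * W" using W N0 by (simp add: add_increasing2)
        then have "\<lfloor>c - W\<rfloor> \<le> \<lfloor>c + N * W\<rfloor>" by (rule floor_mono)
        then have "real (nat (\<lfloor>c + N * W\<rfloor> - \<lfloor>c - W\<rfloor>)) = real_of_int \<lfloor>c + N * W\<rfloor> - real_of_int \<lfloor>c - W\<rfloor>" by simp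
        also have "\<dots> \<le> N * W + W + 1" by linarith
        finally show ?thesis .
      qed
      finally show ?thesis .
    qed
    let ?I = "{0..<int N} \<times> {y \<in> Ys. h0 + 4 ^ s < y}"
    let ?T = "\<lambda>z. {A. z \<in> A \<and> card (A \<inter> sqr z (4 ^ s)) \<le> 2 ^ (4 * s - 26)}"
    let ?B = "\<lambda>z. {A. A \<subseteq> lower_part N (snd z) \<and> excess A < W \<and> int (filled_level N A) < snd z - 4 ^ s
        \<and> 2 ^ (4 * s - 26) \<le> card (A \<inter> sqr z (4 ^ s))}"
    let ?t = "s * (1 / 2) ^ (4 ^ s) :: real" and ?b = "exp (- ((4 ^ s / 2 ^ 35 - W - 1) / 2 - 2 * harm (2 * N)))"
    have "A \<in> {A. W \<le> excess A} \<union> (\<Union>z\<in>?I. ?T z \<union> ?B z)"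
      if A: "A \<in> set_pmf (idla A0 n)" and tall: "4 ^ s < idla_height A - int (filled_level N A)" for A
    proof (cases "W \<le> excess A")
      case False
      have AS: "A \<in> idla_states N" by (rule set_idla_state[OF A0 A])
      let ?K = "int (filled_level N A)"
      have ex: "excess A = c - filled_level N A" using excess_idla[OF A0 A] by (simp add: c_def g0_def)
      have KcW: "c - W < filled_level N A" using False ex by simp
      then have "real_of_int h0 < filled_level N A" using c by simp
      then have hK: "h0 < ?K" by linarith
      obtain x0 where x0: "(x0, idla_height A) \<in> A" using idla_height_attained(1)[OF AS] by blast
      let ?z = "(x0, idla_height A)"
      have "idla_height A - ?K \<le> int (card (upper A ?K))"
        using height_le_count[OF A0 h0(2) A _ _ x0, of ?K] hK by simp
      moreover have "real (card (upper A ?K)) = N * excess A" using N0 by (simp add: excess_def)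
      ultimately have "real_of_int (idla_height A) - filled_level N A \<le> N * excess A" by linarith
      also have "\<dots> \<le> N * W" using False N0 by (intro mult_left_mono) auto
      finally have hW: "real_of_int (idla_height A) - filled_level N A \<le> N * W" .
      have "real_of_int (idla_height A) \<le> c + N * W"
      proof -
        have "0 \<le> excess A" by (simp add: excess_def)
        then have "real (filled_level N A) \<le> c" using ex by simp
        then show ?thesis using hW by linarith
      qed
      moreover have "(0 :: int) < 4 ^ s" by simp
      then have "?K < idla_height A" using tall by linarith
      then have "c - W < idla_height A" using KcW by linarith
      ultimately have "?z \<in> ?I"
        using x0 AS tall hK by (auto simp: Ys_def idla_states_iff cylinder_def)
      moreover have "A \<in> ?T ?z \<union> ?B ?z"
      proof (cases "card (A \<inter> sqr ?z (4 ^ s)) \<le> 2 ^ (4 * s - 26)")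
        case False
        have "A \<subseteq> lower_part N (idla_height A)"
          using idla_height_attained(2)[OF AS] AS by (fastforce simp: lower_part_def idla_states_iff)
        then show ?thesis using False tall \<open>\<not> W \<le> excess A\<close> by auto
      qed (use x0 in auto)
      ultimately show ?thesis by blast
    qed simp
    then have "measure_pmf.prob (idla A0 n) {A. 4 ^ s < idla_height A - int (filled_level N A)}
      \<le> measure_pmf.prob (idla A0 n) ({A. W \<le> excess A} \<union> (\<Union>z\<in>?I. ?T z \<union> ?B z))"
      by (intro measure_pmf.finite_measure_mono_AE AE_pmfI) auto
    also have "\<dots> \<le> measure_pmf.prob (idla A0 n) {A. W \<le> excess A} + measure_pmf.prob (idla A0 n) (\<Union>z\<in>?I. ?T z \<union> ?B z)"
      by (rule measure_Un_le) auto
    also have "measure_pmf.prob (idla A0 n) (\<Union>z\<in>?I. ?T z \<union> ?B z) \<le> (\<Sum>z\<in>?I. measure_pmf.prob (idla A0 n) (?T z \<union> ?B z))"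
      using finY by (intro measure_pmf.finite_measure_subadditive_finite) auto
    also have "\<dots> \<le> (\<Sum>z\<in>?I. ?t + ?b)"
    proof (rule sum_mono)
      fix z assume z: "z \<in> ?I"
      have far: "A0 \<inter> sqr z (4 ^ s) = {}"
      proof -
        have "snd w > h0" if "w \<in> sqr z (4 ^ s)" for w using that z by (auto simp: sqr_def lift_def)
        then show ?thesis using h0(2) by fastforce
      qed
      have "0 \<le> snd z" using z h0(1) by (auto intro: order_trans[rotated, OF less_imp_le])
      moreover have "h0 + 2 * int g0 \<le> snd z"
      proof -
        have "real_of_int (h0 + 2 * int g0) \<le> snd z" using z c by (auto simp: Ys_def)
        then show ?thesis by linarith
      qed
      ultimately have "measure_pmf.prob (idla A0 n) (?B z) \<le> ?b"
        using bulge_probability[OF A0 h0(2), where ?y0.0 = "snd z" and ?x0.0 = "fst z" and s = s and W = W and n = n] sN s by (simp add: g0_def)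
      moreover have "measure_pmf.prob (idla A0 n) (?T z) \<le> ?t"
        using sN N3 by (intro tentacle[OF A0 s _ far]) (auto intro: le_less_trans[rotated] less_le_trans[of _ "64 * 4 ^ s"])
      moreover have "measure_pmf.prob (idla A0 n) (?T z \<union> ?B z) \<le> measure_pmf.prob (idla A0 n) (?T z) + measure_pmf.prob (idla A0 n) (?B z)"
        by (rule measure_Un_le) auto
      ultimately show "measure_pmf.prob (idla A0 n) (?T z \<union> ?B z) \<le> ?t + ?b" by linarith
    qed
    also have "\<dots> = real (card ?I) * (?t + ?b)" by simp
    also have "\<dots> \<le> N * (N * W + W + 1) * (?t + ?b)"
    proof (rule mult_right_mono)
      have "card {y \<in> Ys. h0 + 4 ^ s < y} \<le> card Ys" using finY by (intro card_mono) auto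
      then have "real (card {y \<in> Ys. h0 + 4 ^ s < y}) \<le> N * W + W + 1" using cardY by linarith
      then show "real (card ?I) \<le> N * (N * W + W + 1)" by (simp add: card_cartesian_product mult_left_mono)
    qed (simp add: add_nonneg_nonneg)
    finally show ?case using elim(1) by simp
  qed
qed

section \<open>Transfer to stationary and lukewarm laws\<close>

lemma stationary_height_bound:
  assumes st: "shifted_stationary N \<mu>"
    and tail: "\<And>A0. A0 \<in> idla_states N \<Longrightarrow>
      \<forall>\<^sub>F n in sequentially. measure_pmf.prob (idla A0 n) {A. a < real_of_int (idla_height A - int (filled_level N A))} \<le> \<epsilon>"
  shows "measure_pmf.prob \<mu> {A \<in> idla_states N. a < real_of_int (idla_height A)} \<le> \<epsilon>"
proof -
  let ?E = "{A \<in> idla_states N. a < real_of_int (idla_height A)}"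
  let ?F = "{A. a < real_of_int (idla_height A - int (filled_level N A))}"
  have sub: "set_pmf \<mu> \<subseteq> idla_states N" using st by (simp add: shifted_stationary_def)
  define f where "f n A = measure_pmf.prob (idla A (Suc n)) ?F" for n A
  have f01: "0 \<le> f n A" "f n A \<le> 1" for n A by (auto simp: f_def)
  have eq: "measure_pmf.prob \<mu> ?E = measure_pmf.expectation \<mu> (f n)" for n
  proof -
    have "measure_pmf.prob \<mu> ?E = measure_pmf.expectation (bind_pmf \<mu> (\<lambda>A. map_pmf (downshift N) (idla A (Suc n)))) (indicat_real ?E)"
      using stationary_idla[OF st, of n] by simp
    also have "\<dots> = measure_pmf.expectation \<mu> (\<lambda>A. measure_pmf.expectation (map_pmf (downshift N) (idla A (Suc n))) (indicat_real ?E))"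
      by (rule expectation_bind_bounded[where B = 1]) (simp add: indicator_def)
    also have "\<dots> = measure_pmf.expectation \<mu> (f n)"
    proof (rule integral_cong_AE)
      show "AE A in \<mu>. measure_pmf.expectation (map_pmf (downshift N) (idla A (Suc n))) (indicat_real ?E) = f n A"
      proof (rule AE_pmfI)
        fix A assume "A \<in> set_pmf \<mu>"
        then have A: "A \<in> idla_states N" using sub by auto
        have "measure_pmf.expectation (map_pmf (downshift N) (idla A (Suc n))) (indicat_real ?E)
          = measure_pmf.prob (idla A (Suc n)) (downshift N -` ?E)"
          by (simp only: integral_indicator measure_map_pmf Bochner_Integration.integral_indicator) simp
        also have "\<dots> = f n A" unfolding f_def
        proof (rule measure_pmf.finite_measure_eq_AE)
          show "AE B in idla A (Suc n). (B \<in> downshift N -` ?E) = (B \<in> ?F)"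
          proof (rule AE_pmfI)
            fix B assume "B \<in> set_pmf (idla A (Suc n))"
            then have "B \<in> idla_states N" by (rule set_idla_state[OF A])
            then show "(B \<in> downshift N -` ?E) = (B \<in> ?F)"
              by (simp add: downshift_state idla_height_downshift)
          qed
        qed auto
        finally show "measure_pmf.expectation (map_pmf (downshift N) (idla A (Suc n))) (indicat_real ?E) = f n A" .
      qed
    qed auto
    finally show ?thesis .
  qed
  \<comment> \<open>The threshold time in \<open>tail\<close> depends on the initial state, so
    dominated convergence is applied; \<open>max (f n A) \<epsilon>\<close> is used since it is
    eventually constant, while \<open>f n A\<close> itself need not converge.\<close>
  have lim: "(\<lambda>n. measure_pmf.expectation \<mu> (\<lambda>A. max (f n A) \<epsilon>)) \<longlonglongrightarrow> measure_pmf.expectation \<mu> (\<lambda>_. \<epsilon>)"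
  proof (rule integral_dominated_convergence[where w = "\<lambda>_. 1 + \<bar>\<epsilon>\<bar>"])
    show "AE A in \<mu>. (\<lambda>n. max (f n A) \<epsilon>) \<longlonglongrightarrow> \<epsilon>"
    proof (rule AE_pmfI)
      fix A assume "A \<in> set_pmf \<mu>"
      then have "A \<in> idla_states N" using sub by auto
      from tail[OF this] have "\<forall>\<^sub>F n in sequentially. f n A \<le> \<epsilon>"
        unfolding f_def by (subst eventually_sequentially_Suc)
      then have "\<forall>\<^sub>F n in sequentially. max (f n A) \<epsilon> = \<epsilon>" by eventually_elim simp
      then show "(\<lambda>n. max (f n A) \<epsilon>) \<longlonglongrightarrow> \<epsilon>" by (rule tendsto_eventually)
    qed
    show "AE A in \<mu>. norm (max (f n A) \<epsilon>) \<le> 1 + \<bar>\<epsilon>\<bar>" for n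
    proof (rule AE_pmfI)
      fix A show "norm (max (f n A) \<epsilon>) \<le> 1 + \<bar>\<epsilon>\<bar>" using f01[of n A] by (auto simp: max_def)
    qed
  qed auto
  have "measure_pmf.prob \<mu> ?E \<le> measure_pmf.expectation \<mu> (\<lambda>A. max (f n A) \<epsilon>)" for n
    unfolding eq[of n]
  proof (rule integral_mono)
    show "integrable \<mu> (f n)" using f01 by (intro integrable_bounded_pmf[where B = 1]) simp
    show "integrable \<mu> (\<lambda>A. max (f n A) \<epsilon>)"
    proof (rule integrable_bounded_pmf[where B = "1 + \<bar>\<epsilon>\<bar>"])
      fix A show "\<bar>max (f n A) \<epsilon>\<bar> \<le> 1 + \<bar>\<epsilon>\<bar>" using f01[of n A] by (auto simp: max_def)
    qed
  qed simp
  then have "measure_pmf.prob \<mu> ?E \<le> measure_pmf.expectation \<mu> (\<lambda>_. \<epsilon>)"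
    by (intro LIMSEQ_le_const[OF lim]) auto
  then show ?thesis by simp
qed

lemma lukewarm_prob_le:
  assumes "lukewarm_start N k \<mu> \<nu>" and E: "E \<subseteq> idla_states N"
  shows "measure_pmf.prob \<nu> E \<le> real N ^ k * measure_pmf.prob \<mu> E"
proof -
  have "emeasure \<nu> E = (\<integral>\<^sup>+A. ennreal (pmf \<nu> A) \<partial>count_space E)" by (rule nn_integral_pmf[symmetric])
  also have "\<dots> \<le> (\<integral>\<^sup>+A. ennreal (real N ^ k) * ennreal (pmf \<mu> A) \<partial>count_space E)"
    using assms by (intro nn_integral_mono) (auto simp: lukewarm_start_def ennreal_mult[symmetric] intro!: ennreal_leI)
  also have "\<dots> = ennreal (real N ^ k) * emeasure \<mu> E" by (subst nn_integral_cmult) (auto simp: nn_integral_pmf)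
  finally have "ennreal (measure_pmf.prob \<nu> E) \<le> ennreal (real N ^ k * measure_pmf.prob \<mu> E)"
    by (simp add: measure_pmf.emeasure_eq_measure ennreal_mult)
  then show ?thesis by (subst (asm) ennreal_le_iff) auto
qed

end

lemma power_of_four_between:
  fixes x :: real
  assumes "1 \<le> x"
  obtains s :: nat where "x \<le> 4 ^ s" "4 ^ s \<le> 4 * x"
proof -
  obtain n where "x < 4 ^ n" using real_arch_pow[of 4 x] by auto
  then have ex: "\<exists>n. x \<le> 4 ^ n" by (intro exI[of _ n]) simp
  define s where "s = (LEAST n. x \<le> 4 ^ n)"
  have 1: "x \<le> 4 ^ s" unfolding s_def by (rule LeastI_ex[OF ex])
  have "4 ^ s \<le> 4 * x"
  proof (cases s)
    case (Suc r)
    then have "\<not> x \<le> 4 ^ r" using not_less_Least[of r "\<lambda>n. x \<le> 4 ^ n"] by (simp add: s_def)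
    then show ?thesis using Suc by simp
  qed (use assms in simp)
  with 1 show ?thesis by (rule that)
qed

theorem theorem1p2:
  fixes \<gamma> :: real and k :: nat
  assumes "\<gamma> > 0"
  shows "\<exists>c :: real. \<exists>N0 \<ge> 3. \<forall>N \<ge> N0. \<forall>\<mu> \<nu> :: site set pmf.
           shifted_stationary N \<mu> \<longrightarrow> lukewarm_start N k \<mu> \<nu> \<longrightarrow>
           measure_pmf.prob \<nu> {A \<in> idla_states N. real_of_int (idla_height A) > c * ln (real N)}
             \<le> real N powr (- \<gamma>)"
proof -
  define \<gamma>' where "\<gamma>' = \<gamma> + k"
  \<comment> \<open>The prefactors are of orders \<open>N^3\<close> and \<open>N^4\<close>; the
    surplus in the exponent leaves at least \<open>N^2\<close> to absorb numerical
    constants.\<close>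
  define g where "g = \<gamma>' + 6"
  have g: "g \<ge> 6" using assms by (simp add: g_def \<gamma>'_def)
  \<comment> \<open>With \<open>L = ln N \<ge> 1\<close>, a scale of at least \<open>C * L\<close>
    yields kernel weight \<open>6 * g * L + 13 * L\<close>. Removing \<open>W = 4 * g * L\<close>
    and \<open>1\<close>, halving, and paying \<open>2 * harm (2 * N) \<le> 2 * (2 + L)\<close>
    leaves at least \<open>g * L\<close>.\<close>
  define C where "C = 2 ^ 35 * (6 * g + 13)"
  have C: "C \<ge> 2 ^ 35" using g by (simp add: C_def)
  have "\<forall>\<^sub>F N :: nat in sequentially. 256 * C * ln (real N) \<le> real N"
    using C by real_asymp
  then obtain N1 where N1: "\<And>N :: nat. N1 \<le> N \<Longrightarrow> 256 * C * ln (real N) \<le> real N"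
    by (auto simp: eventually_sequentially)
  \<comment> \<open>The value \<open>17\<close> makes \<open>1280 / N^3 + 3 / N^2\<close> at most
    \<open>1\<close>; it also gives \<open>ln N \<ge> 1\<close>.\<close>
  define N0 where "N0 = max 17 N1"
  have main: "measure_pmf.prob \<nu> {A \<in> idla_states N. real_of_int (idla_height A) > 4 * C * ln (real N)} \<le> real N powr (- \<gamma>)"
    if N: "N0 \<le> N" and st: "shifted_stationary N \<mu>" and lw: "lukewarm_start N k \<mu> \<nu>"
    for N :: nat and \<mu> \<nu> :: "site set pmf"
  proof -
    have N17: "17 \<le> N" and NC: "256 * C * ln (real N) \<le> real N" using N N1 by (auto simp: N0_def)
    interpret cyl N by unfold_locales (use N17 in simp)
    define \<Lambda> where "\<Lambda> = ln (real N)"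
    have N0: "real N > 0" using N17 by simp
    have \<Lambda>: "1 \<le> \<Lambda>"
    proof -
      have "exp 1 \<le> real N" using exp_le N17 by linarith
      then show ?thesis using N0 by (simp add: \<Lambda>_def ln_ge_iff)
    qed
    have expL: "exp (- (b * \<Lambda>)) = real N powr (- b)" for b using N0 by (simp add: powr_def \<Lambda>_def)
    have CL: "2 ^ 35 \<le> C * \<Lambda>" using mult_mono[OF C \<Lambda>] C by simp
    then have "1 \<le> C * \<Lambda>" by simp
    then obtain s :: nat where s: "C * \<Lambda> \<le> 4 ^ s" "4 ^ s \<le> 4 * (C * \<Lambda>)" by (rule power_of_four_between)
    have s12: "12 \<le> s"
    proof (rule ccontr)
      assume "\<not> 12 \<le> s"
      then have "(4 :: real) ^ s \<le> 4 ^ 12" by (intro power_increasing) auto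
      then show False using s(1) CL by simp
    qed
    have sN: "64 * 4 ^ s \<le> N"
    proof -
      have "64 * (4 :: real) ^ s \<le> N" using s(2) NC by (simp add: \<Lambda>_def)
      then have "real (64 * 4 ^ s) \<le> real N" by simp
      then show ?thesis by (simp only: of_nat_le_iff)
    qed
    \<comment> \<open>Chosen so that \<open>exp (- (W / 4))\<close> is \<open>N\<close> to the power
      \<open>- g\<close>.\<close>
    define W where "W = 4 * (g * \<Lambda>)"
    have W: "0 \<le> W" using g \<Lambda> by (simp add: W_def)
    define H where "H = (harm (2 * N) :: real)"
    have Hln: "H \<le> 1 + ln (2 * real N)" using harm_le_ln[of "2 * N"] N17 by (simp add: H_def)
    have H2: "H \<le> 2 + \<Lambda>"
    proof -
      have "ln (2 * real N) = ln 2 + \<Lambda>" using N0 by (simp add: ln_mult \<Lambda>_def)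
      moreover have "ln 2 \<le> (1 :: real)" using ln_2_less_1 by simp
      ultimately show ?thesis using Hln by simp
    qed
    have first: "5 * N * exp (1 / 2 + 2 * H) * exp (- (W / 4)) \<le> 1280 * real N powr (3 - g)"
    proof -
      have "exp (1 / 2 + 2 * H) \<le> exp (3 + (ln (2 * real N) + ln (2 * real N)))" using Hln by simp
      also have "\<dots> = exp 1 ^ 3 * (2 * real N) ^ 2"
      proof -
        have "exp (3 :: real) = exp 1 ^ 3" by (simp add: exp_of_nat_mult[symmetric])
        moreover have "exp (ln (2 * real N)) = 2 * real N" using N0 by simp
        ultimately show ?thesis by (simp only: exp_add power2_eq_square)
      qed
      also have "\<dots> \<le> 3 ^ 3 * (2 * real N) ^ 2" using exp_le by (intro mult_right_mono power_mono) auto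
      finally have "exp (1 / 2 + 2 * H) \<le> 108 * real N ^ 2" by (simp add: power2_eq_square)
      then have "5 * N * exp (1 / 2 + 2 * H) * exp (- (W / 4)) \<le> 5 * N * (108 * real N ^ 2) * exp (- (W / 4))"
        by (intro mult_right_mono mult_left_mono) auto
      also have "\<dots> = 540 * (real N ^ 3 * real N powr (- g))"
        using expL[of g] by (simp add: W_def power2_eq_square power3_eq_cube)
      also have "real N ^ 3 * real N powr (- g) = real N powr (3 - g)"
        using N0 by (simp add: powr_add[symmetric] flip: powr_numeral)
      also have "540 * real N powr (3 - g) \<le> 1280 * real N powr (3 - g)" by (intro mult_right_mono) auto
      finally show ?thesis by simp
    qed
    have second: "N * (N * W + W + 1) * (s * (1 / 2) ^ (4 ^ s) + exp (- ((4 ^ s / 2 ^ 35 - W - 1) / 2 - 2 * H))) \<le> 3 * real N powr (4 - g)"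
    proof -
      have C\<Lambda>: "C * \<Lambda> / 2 ^ 35 = 6 * (g * \<Lambda>) + 13 * \<Lambda>" by (simp add: C_def algebra_simps)
      have g\<Lambda>: "0 \<le> g * \<Lambda>" using g \<Lambda> by simp
      have WC: "W \<le> C * \<Lambda>"
      proof -
        have "4 * x \<le> c" if "c / 2 ^ 35 = 6 * x + 13 * y" "0 \<le> x" "1 \<le> y" for c x y :: real
          using that by simp
        from this[OF C\<Lambda> g\<Lambda> \<Lambda>] show ?thesis by (simp only: W_def)
      qed
      have "W \<le> N" using WC NC CL by (simp add: \<Lambda>_def)
      then have "N * W + W + 1 \<le> real N * N + N * N + N * N"
        using N17 by (intro add_mono mult_left_mono) (auto intro: order_trans[of _ "real N"])
      then have c1: "N * (N * W + W + 1) \<le> 3 * real N ^ 3"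
        using mult_left_mono[of "N * W + W + 1" "real N * N + N * N + N * N" "real N"] by (simp add: power3_eq_cube)
      have t1: "(1 / 2) ^ (4 ^ s) \<le> real N powr (- g)"
      proof -
        have "1 / 2 \<le> exp (- (1 / 2) :: real)" using exp_ge_add_one_self[of "- (1 / 2) :: real"] by simp
        then have "(1 / 2) ^ (4 ^ s) \<le> exp (- (1 / 2) :: real) ^ (4 ^ s)" by (intro power_mono) auto
        also have "\<dots> = exp (- (4 ^ s / 2))" by (simp add: exp_of_nat_mult[symmetric])
        also have "\<dots> \<le> exp (- (g * \<Lambda>))" using s(1) C\<Lambda> g\<Lambda> \<Lambda> by simp
        finally show ?thesis by (simp only: expL)
      qed
      have t2: "exp (- ((4 ^ s / 2 ^ 35 - W - 1) / 2 - 2 * H)) \<le> real N powr (- g)"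
      proof -
        have "C * \<Lambda> / 2 ^ 35 \<le> 4 ^ s / 2 ^ 35" using s(1) by (rule divide_right_mono) simp
        then have "6 * (g * \<Lambda>) + 13 * \<Lambda> \<le> 4 ^ s / 2 ^ 35" by (simp only: C\<Lambda>)
        moreover have "x \<le> (u - 4 * x - 1) / 2 - 2 * h" if "6 * x + 13 * y \<le> u" "h \<le> 2 + y" "1 \<le> y" for x y u h :: real
          using that by (simp add: field_simps)
        ultimately have "g * \<Lambda> \<le> (4 ^ s / 2 ^ 35 - W - 1) / 2 - 2 * H"
          unfolding W_def using H2 \<Lambda> by blast
        then show ?thesis unfolding expL[symmetric] by simp
      qed
      have "s + 1 \<le> N" using sN less_exp[of s] power_mono[of 2 "4 :: nat" s] by linarith
      then have "real s + 1 \<le> N" by linarith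
      have "s * (1 / 2) ^ (4 ^ s) + exp (- ((4 ^ s / 2 ^ 35 - W - 1) / 2 - 2 * H)) \<le> s * real N powr (- g) + real N powr (- g)"
        using t1 t2 by (intro add_mono mult_left_mono) auto
      also have "\<dots> = (real s + 1) * real N powr (- g)" by (simp add: algebra_simps)
      also have "\<dots> \<le> N * real N powr (- g)" using \<open>real s + 1 \<le> N\<close> by (intro mult_right_mono) auto
      finally have c2: "s * (1 / 2) ^ (4 ^ s) + exp (- ((4 ^ s / 2 ^ 35 - W - 1) / 2 - 2 * H)) \<le> N * real N powr (- g)" .
      have "N * (N * W + W + 1) * (s * (1 / 2) ^ (4 ^ s) + exp (- ((4 ^ s / 2 ^ 35 - W - 1) / 2 - 2 * H)))
          \<le> 3 * real N ^ 3 * (N * real N powr (- g))"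
        by (rule mult_mono[OF c1 c2]) (auto intro!: add_nonneg_nonneg)
      also have "\<dots> = 3 * (real N ^ 4 * real N powr (- g))" by (simp add: power_numeral_reduce)
      also have "real N ^ 4 * real N powr (- g) = real N powr (4 - g)"
        using N0 by (simp add: powr_add[symmetric] flip: powr_numeral)
      finally show ?thesis .
    qed
    have "measure_pmf.prob \<mu> {A \<in> idla_states N. 4 * C * ln (real N) < real_of_int (idla_height A)} \<le> real N powr (- \<gamma>')"
    proof (rule stationary_height_bound[OF st])
      fix A0 assume A0: "A0 \<in> idla_states N"
      show "\<forall>\<^sub>F n in sequentially. measure_pmf.prob (idla A0 n) {A. 4 * C * ln (real N) < real_of_int (idla_height A - int (filled_level N A))}
        \<le> real N powr (- \<gamma>')"
        using height_tail[OF A0 W s12 sN]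
      proof eventually_elim
        case (elim n)
        have "{A. 4 * C * ln (real N) < real_of_int (idla_height A - int (filled_level N A))}
            \<subseteq> {A. 4 ^ s < idla_height A - int (filled_level N A)}"
        proof safe
          fix A assume "4 * C * ln (real N) < real_of_int (idla_height A - int (filled_level N A))"
          then have "(4 :: real) ^ s < real_of_int (idla_height A - int (filled_level N A))" using s(2) by (simp add: \<Lambda>_def)
          then have "real_of_int (4 ^ s) < real_of_int (idla_height A - int (filled_level N A))" by simp
          then show "4 ^ s < idla_height A - int (filled_level N A)" by (simp only: of_int_less_iff)
        qed
        then have "measure_pmf.prob (idla A0 n) {A. 4 * C * ln (real N) < real_of_int (idla_height A - int (filled_level N A))}
            \<le> measure_pmf.prob (idla A0 n) {A. 4 ^ s < idla_height A - int (filled_level N A)}"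
          by (intro measure_pmf.finite_measure_mono) auto
        also have "\<dots> \<le> 1280 * real N powr (3 - g) + 3 * real N powr (4 - g)"
          using elim first second unfolding H_def by linarith
        also have "\<dots> = (1280 / real N ^ 3 + 3 / real N ^ 2) * real N powr (- \<gamma>')"
        proof -
          have "real N powr (3 - g) = real N powr (- \<gamma>') / real N ^ 3" "real N powr (4 - g) = real N powr (- \<gamma>') / real N ^ 2"
            using N0 by (simp_all add: g_def powr_diff[symmetric] minus_diff_commute flip: powr_numeral)
          then show ?thesis by (simp add: distrib_right)
        qed
        also have "\<dots> \<le> 1 * real N powr (- \<gamma>')"
        proof (rule mult_right_mono)
          have "(17 :: real) ^ 3 \<le> real N ^ 3" "(17 :: real) ^ 2 \<le> real N ^ 2" using N17 by (intro power_mono; simp)+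
          then have "1280 / real N ^ 3 \<le> 1280 / 17 ^ 3" "3 / real N ^ 2 \<le> 3 / 17 ^ 2" using N0 by (simp_all add: field_simps)
          then show "1280 / real N ^ 3 + 3 / real N ^ 2 \<le> 1" by simp
        qed simp
        finally show ?case by simp
      qed
    qed
    then have "real N ^ k * measure_pmf.prob \<mu> {A \<in> idla_states N. 4 * C * ln (real N) < real_of_int (idla_height A)}
        \<le> real N ^ k * real N powr (- \<gamma>')" by (intro mult_left_mono) auto
    also have "\<dots> = real N powr (- \<gamma>)"
      using N0 by (simp add: powr_realpow[symmetric] powr_add[symmetric] \<gamma>'_def)
    finally show ?thesis
      using lukewarm_prob_le[OF lw, of "{A \<in> idla_states N. 4 * C * ln (real N) < real_of_int (idla_height A)}"] by auto
  qed
  show ?thesis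
    by (intro exI[of _ "4 * C"] exI[of _ N0] conjI allI impI main) (auto simp: N0_def)
qed

end
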